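(* Let $0<\alpha<1$, $T>0$, let $M$ be a spherically symmetric $C^2$ manifold, let $J$ have support contained in $[0,1]$, and let $\mathfrak q=\frac1{2N}\int_{\mathbb{R}^N}J(|z|)\,|z|^2\,dz$. For $\varepsilon>0$ set $$L_\varepsilon w(x)=\frac1{\varepsilon^2}\int_M\varepsilon^{-N}J\Big(\frac{s_{xy}}{\varepsilon}\Big)\big(w(y)-w(x)\big)\,d\mu_y .$$ Let $u\in C^{2+\alpha,1+\alpha/2}(M\times[0,T])$ be the solution of $$u_t-\mathfrak q\,\Delta_M u=0\ \text{ in }M\times(0,T],\qquad u(x,0)=u_0(x)\ \text{ in }M,$$ and let $u^\varepsilon$ be the (bounded) solution of $$u^\varepsilon_t-L_\varepsilon u^\varepsilon=0\ \text{ in }M\times(0,T],\qquad u^\varepsilon(x,0)=u_0(x)\ \text{ in }M.$$ Then $u^\varepsilon\to u$ uniformly in $M\times[0,T]$ as $\varepsilon\to0$.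
   Context: $M$ is an $N$-dimensional Riemannian manifold without boundary, with a fixed point $O$ and a family of isometries $\tau_x:M\to M$, $x\in M$, with $\tau_x(x)=O$. $s_{xy}$ is the geodesic distance. $J:\mathbb{R}_{\ge0}\to\mathbb{R}_{\ge0}$ is normalized by $\int_M J(s_{xO})\,d\mu_x=1$. "Spherically symmetric $C^2$ manifold" means: around any point of $M$ (taken as the center) there is a small ball $B_R$ (disjoint from the cut locus of its center) and polar coordinates $(r,\theta)$, $\theta\in\mathbb{S}^{N-1}$, in which the Riemannian metric on the punctured ball is $ds^2=dr^2+\psi^2(r)\,d\theta^2$, where $d\theta^2$ is the standard metric of $\mathbb{S}^{N-1}$, $\psi\in C^2$, $\psi(0)=0$, $\psi'(0)=1$ (by homogeneity, $\psi$ and $R$ can be taken the same for all centers). The measure $\mu$ is the one with $d\mu=\psi^{N-1}(r)\,dr\,d\theta$ in these coordinates, and $\Delta_M=\partial_{rr}+(N-1)\frac{\psi'}{\psi}\partial_r+\frac1{\psi^2}\Delta_{\mathbb{S}^{N-1}}$ is the Laplace–Beltrami operator. $C^{2+\alpha,1+\alpha/2}(M\times[0,T])$ is the usual (global) parabolic Hölder space; in particular $u$, $u_t$ and the space derivatives up to order 2 are bounded, with $u(\cdot,t)$ bounded in $C^{2+\alpha}(M)$ uniformly in $t\in[0,T]$; the global $C^{2+\alpha}(M)$ norm is the supremum over $x\in M$ of the $C^{2+\alpha}$ norm on a ball of fixed small radius about $x$ in coordinates centered at $x$. The solution $u^\varepsilon$ is the unique one in $C([0,T];L^\infty(M))$;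 since $u_0$ is continuous and bounded, it is continuous on $M\times[0,T]$. *)

theory Defs
  imports "HOL-Analysis.Analysis"
begin

section \<open>Riemannian manifolds\<close>

text \<open>For maps between normed spaces; only used on open sets.\<close>

definition C1_on :: "('a::real_normed_vector \<Rightarrow> 'b::real_normed_vector) \<Rightarrow> 'a set \<Rightarrow> bool" where
  "C1_on f S \<longleftrightarrow>
     (\<exists>f'. (\<forall>x\<in>S. (f has_derivative blinfun_apply (f' x)) (at x)) \<and> continuous_on S f')"

definition C2_on :: "('a::real_normed_vector \<Rightarrow> 'b::real_normed_vector) \<Rightarrow> 'a set \<Rightarrow> bool" where
  "C2_on f S \<longleftrightarrow>
     (\<exists>f'. (\<forall>x\<in>S. (f has_derivative blinfun_apply (f' x)) (at x)) \<and> C1_on f' S)"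

datatype ('m, 'e) chart = Chart (chart_dom: "'m set") (chart_map: "'m \<Rightarrow> 'e")

abbreviation chart_inv :: "('m, 'e) chart \<Rightarrow> 'e \<Rightarrow> 'm" where
  "chart_inv \<kappa> \<equiv> inv_into (chart_dom \<kappa>) (chart_map \<kappa>)"

text \<open>The manifold is the whole type \<open>'m\<close>, modelled on the Euclidean space \<open>'e\<close> of dimension
  \<open>N = DIM('e)\<close>. The metric tensor is given by its coordinate expressions: \<open>metric M \<kappa> p v w\<close> is the
  inner product of the tangent vectors at \<open>p\<close> whose components in the chart \<open>\<kappa>\<close> are \<open>v\<close> and \<open>w\<close>.\<close>

datatype ('m, 'e) riemannian_structure = Riemannian_Structure
  (atlas: "('m, 'e) chart set")
  (metric: "('m, 'e) chart \<Rightarrow> 'm \<Rightarrow> 'e \<Rightarrow> 'e \<Rightarrow> real")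

text \<open>Only a \<open>C\<^sup>2\<close> atlas and a continuous metric are required, so smooth Riemannian
  manifolds are included. Charts map onto open subsets of \<open>'e\<close>: there is no boundary. Connectedness
  makes the geodesic distance finite.\<close>

definition riemannian_manifold ::
  "('m::{t2_space,second_countable_topology}, 'e::euclidean_space) riemannian_structure \<Rightarrow> bool" where
  "riemannian_manifold M \<longleftrightarrow>
     connected (UNIV :: 'm set) \<and>
     (\<Union>\<kappa>\<in>atlas M. chart_dom \<kappa>) = UNIV \<and>
     (\<forall>\<kappa>\<in>atlas M.
        open (chart_dom \<kappa>) \<and> open (chart_map \<kappa> ` chart_dom \<kappa>) \<and>
        homeomorphism (chart_dom \<kappa>) (chart_map \<kappa> ` chart_dom \<kappa>) (chart_map \<kappa>) (chart_inv \<kappa>)) \<and>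
     (\<forall>\<kappa>\<in>atlas M. \<forall>\<kappa>'\<in>atlas M.
        C2_on (chart_map \<kappa>' \<circ> chart_inv \<kappa>) (chart_map \<kappa> ` (chart_dom \<kappa> \<inter> chart_dom \<kappa>'))) \<and>
     (\<forall>\<kappa>\<in>atlas M. \<forall>p\<in>chart_dom \<kappa>.
        bilinear (metric M \<kappa> p) \<and>
        (\<forall>v w. metric M \<kappa> p v w = metric M \<kappa> p w v) \<and>
        (\<forall>v. v \<noteq> 0 \<longrightarrow> 0 < metric M \<kappa> p v v)) \<and>
     (\<forall>\<kappa>\<in>atlas M. \<forall>v w. continuous_on (chart_dom \<kappa>) (\<lambda>p. metric M \<kappa> p v w)) \<and>
     (\<forall>\<kappa>\<in>atlas M. \<forall>\<kappa>'\<in>atlas M. \<forall>p\<in>chart_dom \<kappa> \<inter> chart_dom \<kappa>'.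
        let D = frechet_derivative (chart_map \<kappa>' \<circ> chart_inv \<kappa>) (at (chart_map \<kappa> p))
        in \<forall>v w. metric M \<kappa> p v w = metric M \<kappa>' p (D v) (D w))"

text \<open>The inverse of \<open>f\<close> is \<open>C\<^sup>1\<close> by the inverse function theorem,
  since the differential of \<open>f\<close> preserves the metric and is therefore injective.\<close>

definition riemannian_isometry ::
  "('m::{t2_space,second_countable_topology}, 'e::euclidean_space) riemannian_structure
     \<Rightarrow> ('m \<Rightarrow> 'm) \<Rightarrow> bool" where
  "riemannian_isometry M f \<longleftrightarrow>
     bij f \<and> continuous_on UNIV f \<and>
     (\<forall>\<kappa>\<in>atlas M. \<forall>\<kappa>'\<in>atlas M.
        C1_on (chart_map \<kappa>' \<circ> f \<circ> chart_inv \<kappa>)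
          (chart_map \<kappa> ` (chart_dom \<kappa> \<inter> f -` chart_dom \<kappa>')) \<and>
        (\<forall>p \<in> chart_dom \<kappa> \<inter> f -` chart_dom \<kappa>'.
           let D = frechet_derivative (chart_map \<kappa>' \<circ> f \<circ> chart_inv \<kappa>) (at (chart_map \<kappa> p))
           in \<forall>v w. metric M \<kappa> p v w = metric M \<kappa>' (f p) (D v) (D w)))"

definition piecewise_C1_curve ::
  "('m::{t2_space,second_countable_topology}, 'e::euclidean_space) riemannian_structure
     \<Rightarrow> (real \<Rightarrow> 'm) \<Rightarrow> bool" where
  "piecewise_C1_curve M \<gamma> \<longleftrightarrow>
     continuous_on {0..1} \<gamma> \<and>
     (\<exists>S. finite S \<and>
        (\<forall>\<kappa>\<in>atlas M. (chart_map \<kappa> \<circ> \<gamma>) C1_differentiable_on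
                       (({0<..<1} - S) \<inter> \<gamma> -` chart_dom \<kappa>)))"

text \<open>The choice of the chart does not matter, by the transformation law of the metric.\<close>

definition curve_speed ::
  "('m, 'e::euclidean_space) riemannian_structure \<Rightarrow> (real \<Rightarrow> 'm) \<Rightarrow> real \<Rightarrow> real" where
  "curve_speed M \<gamma> t =
     (let \<kappa> = (SOME \<kappa>. \<kappa> \<in> atlas M \<and> \<gamma> t \<in> chart_dom \<kappa>);
          v = vector_derivative (chart_map \<kappa> \<circ> \<gamma>) (at t)
      in sqrt (metric M \<kappa> (\<gamma> t) v v))"

definition curve_length ::
  "('m, 'e::euclidean_space) riemannian_structure \<Rightarrow> (real \<Rightarrow> 'm) \<Rightarrow> ennreal" where
  "curve_length M \<gamma> = (\<integral>\<^sup>+t\<in>{0..1}. ennreal (curve_speed M \<gamma> t) \<partial>lborel)"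

definition geodist ::
  "('m::{t2_space,second_countable_topology}, 'e::euclidean_space) riemannian_structure
     \<Rightarrow> 'm \<Rightarrow> 'm \<Rightarrow> real" where
  "geodist M x y =
     enn2real (INF \<gamma>\<in>{\<gamma>. piecewise_C1_curve M \<gamma> \<and> \<gamma> 0 = x \<and> \<gamma> 1 = y}. curve_length M \<gamma>)"

definition geodesic_ball ::
  "('m::{t2_space,second_countable_topology}, 'e::euclidean_space) riemannian_structure
     \<Rightarrow> 'm \<Rightarrow> real \<Rightarrow> 'm set" where
  "geodesic_ball M c R = {y. geodist M c y < R}"


section \<open>Polar coordinates and spherical symmetry\<close>

text \<open>Polar coordinates \<open>(r, \<theta>)\<close> are written through \<open>z = r \<theta>\<close>, so that \<open>r = norm z\<close> and
  \<open>\<theta> = sgn z\<close>. For a tangent vector \<open>v\<close> at \<open>z\<close>, \<open>d_r z v\<close> and \<open>d_theta z v\<close> are the values on \<open>v\<close> of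
  the differentials of \<open>r\<close> and of the map \<open>\<theta>\<close> into the unit sphere.\<close>

definition d_r :: "'e::euclidean_space \<Rightarrow> 'e \<Rightarrow> real" where
  "d_r z v = v \<bullet> sgn z"

definition d_theta :: "'e::euclidean_space \<Rightarrow> 'e \<Rightarrow> 'e" where
  "d_theta z v = (v - d_r z v *\<^sub>R sgn z) /\<^sub>R norm z"

definition polar_metric :: "(real \<Rightarrow> real) \<Rightarrow> 'e::euclidean_space \<Rightarrow> 'e \<Rightarrow> 'e \<Rightarrow> real" where
  "polar_metric \<psi> z v w = d_r z v * d_r z w + (\<psi> (norm z))\<^sup>2 * (d_theta z v \<bullet> d_theta z w)"

text \<open>\<open>\<Phi>\<close> parametrizes the geodesic ball of radius \<open>R\<close> about \<open>c\<close> by \<open>z = r \<theta>\<close>. Since the coordinate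
  \<open>r\<close> is the distance to \<open>c\<close> on the whole ball, all radial geodesics minimize there and the ball
  does not meet the cut locus of \<open>c\<close>. On the punctured ball \<open>\<Phi>\<close> is compatible with the atlas and
  the metric is \<open>dr\<^sup>2 + \<psi>\<^sup>2 d\<theta>\<^sup>2\<close>.\<close>

definition polar_coordinates ::
  "('m::{t2_space,second_countable_topology}, 'e::euclidean_space) riemannian_structure
     \<Rightarrow> (real \<Rightarrow> real) \<Rightarrow> real \<Rightarrow> 'm \<Rightarrow> ('e \<Rightarrow> 'm) \<Rightarrow> bool" where
  "polar_coordinates M \<psi> R c \<Phi> \<longleftrightarrow>
     open (geodesic_ball M c R) \<and>
     (\<exists>\<Psi>. homeomorphism (ball 0 R) (geodesic_ball M c R) \<Phi> \<Psi>) \<and>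
     \<Phi> 0 = c \<and>
     (\<forall>z\<in>ball 0 R. geodist M c (\<Phi> z) = norm z) \<and>
     (\<forall>\<kappa>\<in>atlas M.
        C2_on (chart_map \<kappa> \<circ> \<Phi>) ((ball 0 R - {0}) \<inter> \<Phi> -` chart_dom \<kappa>) \<and>
        (\<forall>z \<in> (ball 0 R - {0}) \<inter> \<Phi> -` chart_dom \<kappa>.
           let D = frechet_derivative (chart_map \<kappa> \<circ> \<Phi>) (at z)
           in \<forall>v w. metric M \<kappa> (\<Phi> z) (D v) (D w) = polar_metric \<psi> z v w))"

definition warping_function :: "(real \<Rightarrow> real) \<Rightarrow> real \<Rightarrow> bool" where
  "warping_function \<psi> R \<longleftrightarrow>
     \<psi> 0 = 0 \<and> (\<forall>r\<in>{0<..<R}. 0 < \<psi> r) \<and>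
     (\<exists>\<psi>' \<psi>''.
        (\<forall>r\<in>{0..<R}. (\<psi> has_real_derivative \<psi>' r) (at r within {0..<R})) \<and>
        (\<forall>r\<in>{0..<R}. (\<psi>' has_real_derivative \<psi>'' r) (at r within {0..<R})) \<and>
        continuous_on {0..<R} \<psi>'' \<and> \<psi>' 0 = 1)"

definition spherically_symmetric ::
  "('m::{t2_space,second_countable_topology}, 'e::euclidean_space) riemannian_structure
     \<Rightarrow> (real \<Rightarrow> real) \<Rightarrow> real \<Rightarrow> bool" where
  "spherically_symmetric M \<psi> R \<longleftrightarrow>
     0 < R \<and> warping_function \<psi> R \<and> (\<forall>c. \<exists>\<Phi>. polar_coordinates M \<psi> R c \<Phi>)"

text \<open>The surface measure on the unit sphere, as a Borel measure on \<open>'e\<close>: the image of Lebesgue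
  measure on the unit ball under radial projection, normalized by the factor \<open>N\<close>, so that
  \<open>dz = r\<^sup>N\<^sup>-\<^sup>1 dr d\<theta>\<close>. For \<open>N = 1\<close> it is the counting measure on the two unit vectors.\<close>

definition sphere_measure :: "'e::euclidean_space measure" where
  "sphere_measure =
     scale_measure (of_nat DIM('e)) (distr (restrict_space lborel (ball 0 1)) borel sgn)"

text \<open>\<open>\<mu>\<close> is the Borel measure with \<open>d\<mu> = \<psi>\<^sup>N\<^sup>-\<^sup>1 dr d\<theta>\<close> in polar coordinates; it is determined by
  its values on subsets of small balls.\<close>

definition polar_volume ::
  "('m::{t2_space,second_countable_topology}, 'e::euclidean_space) riemannian_structure
     \<Rightarrow> (real \<Rightarrow> real) \<Rightarrow> real \<Rightarrow> 'm measure \<Rightarrow> bool" where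
  "polar_volume M \<psi> R \<mu> \<longleftrightarrow>
     sets \<mu> = sets borel \<and>
     (\<forall>c \<Phi> A. polar_coordinates M \<psi> R c \<Phi> \<longrightarrow> A \<in> sets borel \<longrightarrow> A \<subseteq> geodesic_ball M c R \<longrightarrow>
        emeasure \<mu> A =
          (\<integral>\<^sup>+\<theta>. (\<integral>\<^sup>+r\<in>{0<..<R}. indicator A (\<Phi> (r *\<^sub>R \<theta>)) * ennreal (\<psi> r ^ (DIM('e) - 1)) \<partial>lborel)
             \<partial>(sphere_measure :: 'e measure)))"


section \<open>The Laplace--Beltrami operator\<close>

text \<open>The Laplacian of the unit sphere: the Euclidean Laplacian at \<open>\<theta>\<close> of the extension of \<open>h\<close>
  that is homogeneous of degree 0.\<close>

definition sphere_laplacian :: "('e::euclidean_space \<Rightarrow> real) \<Rightarrow> 'e \<Rightarrow> real" where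
  "sphere_laplacian h \<theta> = (\<Sum>b\<in>Basis. deriv (deriv (\<lambda>s. h (sgn (\<theta> + s *\<^sub>R b)))) 0)"

definition polar_laplacian :: "(real \<Rightarrow> real) \<Rightarrow> ('e::euclidean_space \<Rightarrow> real) \<Rightarrow> 'e \<Rightarrow> real" where
  "polar_laplacian \<psi> f z =
     (let r = norm z; \<theta> = sgn z
      in deriv (deriv (\<lambda>\<rho>. f (\<rho> *\<^sub>R \<theta>))) r
         + (real DIM('e) - 1) * (deriv \<psi> r / \<psi> r) * deriv (\<lambda>\<rho>. f (\<rho> *\<^sub>R \<theta>)) r
         + sphere_laplacian (\<lambda>\<omega>. f (r *\<^sub>R \<omega>)) \<theta> / (\<psi> r)\<^sup>2)"

text \<open>\<open>\<Delta>\<^sub>M f (y) = l\<close>. The polar expression is singular at the center of the coordinates, so it is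
  used in the punctured balls containing \<open>y\<close>; there always are some, centered at points near \<open>y\<close>.\<close>

definition has_laplace_beltrami ::
  "('m::{t2_space,second_countable_topology}, 'e::euclidean_space) riemannian_structure
     \<Rightarrow> (real \<Rightarrow> real) \<Rightarrow> real \<Rightarrow> ('m \<Rightarrow> real) \<Rightarrow> real \<Rightarrow> 'm \<Rightarrow> bool" where
  "has_laplace_beltrami M \<psi> R f l y \<longleftrightarrow>
     (\<forall>c \<Phi> z. polar_coordinates M \<psi> R c \<Phi> \<longrightarrow> z \<in> ball 0 R - {0} \<longrightarrow> \<Phi> z = y \<longrightarrow>
        polar_laplacian \<psi> (\<lambda>z. f (\<Phi> z)) z = l)"


section \<open>Parabolic Hoelder spaces\<close>

text \<open>\<open>w t z\<close> has all terms of the \<open>C\<^sup>2\<^sup>+\<^sup>\<alpha>\<^sup>,\<^sup>1\<^sup>+\<^sup>\<alpha>\<^sup>/\<^sup>2\<close> norm on \<open>B \<times> [0,T]\<close> bounded by \<open>K\<close>.\<close>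

definition parabolic_holder_bound ::
  "real \<Rightarrow> real \<Rightarrow> real \<Rightarrow> 'e::euclidean_space set \<Rightarrow> (real \<Rightarrow> 'e \<Rightarrow> real) \<Rightarrow> bool" where
  "parabolic_holder_bound K \<alpha> T B w \<longleftrightarrow>
     (\<exists>(wt :: real \<Rightarrow> 'e \<Rightarrow> real) (Dw :: real \<Rightarrow> 'e \<Rightarrow> 'e \<Rightarrow>\<^sub>L real) (D2w :: real \<Rightarrow> 'e \<Rightarrow> 'e \<Rightarrow>\<^sub>L 'e \<Rightarrow>\<^sub>L real).
        (\<forall>t\<in>{0..T}. \<forall>z\<in>B.
           ((\<lambda>s. w s z) has_real_derivative wt t z) (at t within {0..T}) \<and>
           (w t has_derivative blinfun_apply (Dw t z)) (at z) \<and>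
           (Dw t has_derivative blinfun_apply (D2w t z)) (at z) \<and>
           \<bar>w t z\<bar> \<le> K \<and> \<bar>wt t z\<bar> \<le> K \<and> norm (Dw t z) \<le> K \<and> norm (D2w t z) \<le> K) \<and>
        (\<forall>t\<in>{0..T}. \<forall>s\<in>{0..T}. \<forall>z\<in>B. \<forall>y\<in>B.
           \<bar>wt t z - wt s y\<bar> \<le> K * (dist z y powr \<alpha> + \<bar>t - s\<bar> powr (\<alpha> / 2)) \<and>
           norm (D2w t z - D2w s y) \<le> K * (dist z y powr \<alpha> + \<bar>t - s\<bar> powr (\<alpha> / 2))) \<and>
        (\<forall>t\<in>{0..T}. \<forall>s\<in>{0..T}. \<forall>z\<in>B.
           norm (Dw t z - Dw s z) \<le> K * \<bar>t - s\<bar> powr ((1 + \<alpha>) / 2)))"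

definition parabolic_holder ::
  "('m::{t2_space,second_countable_topology}, 'e::euclidean_space) riemannian_structure
     \<Rightarrow> (real \<Rightarrow> real) \<Rightarrow> real \<Rightarrow> real \<Rightarrow> real \<Rightarrow> ('m \<Rightarrow> real \<Rightarrow> real) \<Rightarrow> bool" where
  "parabolic_holder M \<psi> R \<alpha> T u \<longleftrightarrow>
     (\<exists>\<rho> K. 0 < \<rho> \<and> \<rho> < R \<and>
        (\<forall>x \<Phi>. polar_coordinates M \<psi> R x \<Phi> \<longrightarrow>
           parabolic_holder_bound K \<alpha> T (ball 0 \<rho>) (\<lambda>t z. u (\<Phi> z) t)))"


section \<open>The local and nonlocal evolution problems\<close>

definition heat_solution ::
  "('m::{t2_space,second_countable_topology}, 'e::euclidean_space) riemannian_structure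
     \<Rightarrow> (real \<Rightarrow> real) \<Rightarrow> real \<Rightarrow> real \<Rightarrow> real \<Rightarrow> ('m \<Rightarrow> real) \<Rightarrow> ('m \<Rightarrow> real \<Rightarrow> real) \<Rightarrow> bool" where
  "heat_solution M \<psi> R q T u0 u \<longleftrightarrow>
     (\<forall>x. u x 0 = u0 x) \<and>
     (\<forall>x. \<forall>t\<in>{0<..T}. \<exists>l.
        has_laplace_beltrami M \<psi> R (\<lambda>y. u y t) l x \<and>
        (u x has_real_derivative q * l) (at t within {0..T}))"

definition nonlocal_operator ::
  "('m::{t2_space,second_countable_topology}, 'e::euclidean_space) riemannian_structure
     \<Rightarrow> 'm measure \<Rightarrow> (real \<Rightarrow> real) \<Rightarrow> real \<Rightarrow> ('m \<Rightarrow> real) \<Rightarrow> 'm \<Rightarrow> real" where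
  "nonlocal_operator M \<mu> J \<epsilon> w x =
     1 / \<epsilon>\<^sup>2 * (\<integral>y. 1 / \<epsilon> ^ DIM('e) * J (geodist M x y / \<epsilon>) * (w y - w x) \<partial>\<mu>)"

text \<open>The first four conditions say that \<open>v\<close> is continuous on \<open>M \<times> [0,T]\<close>, bounded, continuous from
  \<open>[0,T]\<close> to \<open>L\<^sup>\<infinity>(M)\<close> (for continuous functions the \<open>L\<^sup>\<infinity>\<close> norm is the supremum norm, as \<open>\<mu>\<close> charges
  every nonempty open set), and has initial value \<open>u0\<close>.\<close>

definition nonlocal_solution ::
  "('m::{t2_space,second_countable_topology}, 'e::euclidean_space) riemannian_structure
     \<Rightarrow> 'm measure \<Rightarrow> (real \<Rightarrow> real) \<Rightarrow> real \<Rightarrow> real \<Rightarrow> ('m \<Rightarrow> real) \<Rightarrow> ('m \<Rightarrow> real \<Rightarrow> real) \<Rightarrow> bool" where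
  "nonlocal_solution M \<mu> J \<epsilon> T u0 v \<longleftrightarrow>
     continuous_on (UNIV \<times> {0..T}) (\<lambda>(x, t). v x t) \<and>
     bounded ((\<lambda>(x, t). v x t) ` (UNIV \<times> {0..T})) \<and>
     (\<forall>t\<in>{0..T}. uniform_limit UNIV (\<lambda>s x. v x s) (\<lambda>x. v x t) (at t within {0..T})) \<and>
     (\<forall>x. v x 0 = u0 x) \<and>
     (\<forall>x. \<forall>t\<in>{0<..T}.
        (v x has_real_derivative nonlocal_operator M \<mu> J \<epsilon> (\<lambda>y. v y t) x) (at t within {0..T}))"

end

theory Submission
  imports Defs
begin

text \<open>In coordinates centered at \<open>x\<close>, put \<open>v z = u (\<Phi> z) t\<close>. The nonlocal operator is an integral
  over \<open>\<epsilon> y\<close> with the radial weight \<open>J(norm y) (\<psi>(r) / r)\<^sup>N\<^sup>-\<^sup>1\<close>, \<open>r = \<epsilon> norm y\<close>. In the second-order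
  Taylor expansion of \<open>v\<close> the linear term integrates to \<open>0\<close>, the quadratic one to \<open>q\<close> times the trace
  of \<open>D\<^sup>2 v(0)\<close> up to the deviation of the weight from \<open>J\<close>, and the remainder is \<open>O(\<epsilon>\<^sup>\<alpha>)\<close> by the
  Hoelder bound, uniformly in \<open>x\<close> and \<open>t\<close>. That \<open>u\<^sub>t\<close> equals \<open>q\<close> times the trace at \<open>x\<close> follows by
  averaging the heat equation over antipodal points near the center and letting them tend to it.
  Hence \<open>u\<close> solves the nonlocal equation up to a uniformly small
  error, and the comparison principle for the nonlocal equation, whose kernel is nonnegative with
  total mass independent of \<open>x\<close>, bounds \<open>u\<^sup>\<epsilon> - u\<close> by \<open>T\<close> times that error.\<close>

section \<open>Integration in polar coordinates\<close>

text \<open>After rescaling, the linear Taylor term carries a factor \<open>1 / \<epsilon>\<close>,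
  so knowing that the weight is close to 1 would not control it. It has to cancel exactly, which it
  does because the weight is radial. Only the terms that stay bounded may then use
  \<open>\<psi>(r) / r --> 1\<close>, a consequence of \<open>\<psi> 0 = 0\<close> and
  \<open>\<psi>' 0 = 1\<close>. This limit is used with an arbitrary tolerance \<open>\<eta>\<close>
  and without a rate, whence errors of the form \<open>\<epsilon> powr \<alpha> + \<eta>\<close>.
  Uniformity in the center has three sources: one \<open>\<psi>\<close> and one \<open>R\<close>
  serve every center, one Hoelder constant \<open>K\<close> serves every chart, and for
  \<open>\<epsilon> < R\<close> the support of \<open>J\<close> confines the kernel to a single
  polar chart. The weight itself is the quotient of two volume elements,
  \<open>\<psi>^(N-1) dr d\<theta>\<close> for the manifold and \<open>r^(N-1) dr d\<theta>\<close>
  for Lebesgue measure. Euclidean polar integration therefore comes before everything else.\<close>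

lemma nn_integral_lborel_scaleR:
  fixes f :: "'a::euclidean_space \<Rightarrow> ennreal"
  assumes [measurable]: "f \<in> borel_measurable borel" and "c \<noteq> 0"
  shows "(\<integral>\<^sup>+x. f x \<partial>lborel) = ennreal (\<bar>c\<bar> ^ DIM('a)) * (\<integral>\<^sup>+x. f (c *\<^sub>R x) \<partial>lborel)"
  by (subst lborel_affine[OF \<open>c \<noteq> 0\<close>, of 0])
     (simp add: nn_integral_density nn_integral_distr nn_integral_cmult)

lemma nn_integral_sphere_measure:
  fixes G :: "'e::euclidean_space \<Rightarrow> ennreal"
  assumes [measurable]: "G \<in> borel_measurable borel"
  shows "(\<integral>\<^sup>+\<theta>. G \<theta> \<partial>sphere_measure) =
    of_nat DIM('e) * (\<integral>\<^sup>+z. G (sgn z) * indicator (ball 0 1) z \<partial>lborel)"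
proof -
  have m: "sgn \<in> measurable (restrict_space lborel (ball (0::'e) 1)) borel"
    by (intro measurable_restrict_space1) (simp add: sgn_div_norm[abs_def])
  have "(\<integral>\<^sup>+\<theta>. G \<theta> \<partial>sphere_measure) =
    of_nat DIM('e) * (\<integral>\<^sup>+\<theta>. G \<theta> \<partial>distr (restrict_space lborel (ball 0 1)) borel sgn)"
    unfolding sphere_measure_def by (subst nn_integral_scale_measure) auto
  also have "(\<integral>\<^sup>+\<theta>. G \<theta> \<partial>distr (restrict_space lborel (ball 0 1)) borel sgn) =
    (\<integral>\<^sup>+z. G (sgn z) \<partial>restrict_space lborel (ball 0 1))"
    by (subst nn_integral_distr[OF m]) auto
  also have "\<dots> = (\<integral>\<^sup>+z. G (sgn z) * indicator (ball 0 1) z \<partial>lborel)"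
    by (subst nn_integral_restrict_space) auto
  finally show ?thesis .
qed

text \<open>\<open>sgn z\<close> has norm 1 except at \<open>z = 0\<close>, a null set. Since
  \<open>sphere_measure\<close> lives on the whole space, this is what allows polar integrands to be
  compared for unit vectors only.\<close>

lemma AE_sphere_measure_norm: "AE \<theta> in (sphere_measure :: 'e::euclidean_space measure). norm \<theta> = 1"
proof -
  let ?G = "indicator {\<theta>. norm \<theta> \<noteq> 1} :: 'e \<Rightarrow> ennreal"
  have "(\<integral>\<^sup>+\<theta>. ?G \<theta> \<partial>sphere_measure) =
    of_nat DIM('e) * (\<integral>\<^sup>+z. ?G (sgn z) * indicator (ball 0 1) z \<partial>lborel)"
    by (rule nn_integral_sphere_measure) measurable
  also have "(\<integral>\<^sup>+z. ?G (sgn z) * indicator (ball 0 1) z \<partial>lborel) = (\<integral>\<^sup>+z. 0 \<partial>(lborel :: 'e measure))"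
    by (intro nn_integral_cong_AE AE_I'[of "{0}"])
       (auto simp: norm_sgn indicator_def null_sets_def)
  finally have "(\<integral>\<^sup>+\<theta>. ?G \<theta> \<partial>sphere_measure) = 0" by simp
  moreover have "?G \<in> borel_measurable sphere_measure"
    by (simp add: sphere_measure_def)
  ultimately have "AE \<theta> in (sphere_measure :: 'e measure). ?G \<theta> = 0"
    using nn_integral_0_iff_AE by blast
  then show ?thesis
    by eventually_elim (auto simp: indicator_def split: if_splits)
qed

text \<open>With \<open>a = norm y\<close> and \<open>n = N\<close> this is the last integral in the
  proof of \<open>nn_integral_polar\<close>, where it cancels the factor
  \<open>norm y ^ N\<close>.\<close>

lemma nn_integral_inverse_power_tail:
  assumes "0 < (a::real)" "0 < n"
  shows "(\<integral>\<^sup>+s. ennreal (real n / s ^ (n + 1)) * indicator {a<..} s \<partial>lborel) = ennreal (1 / a ^ n)"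
proof -
  have "(\<integral>\<^sup>+s. ennreal (real n / s ^ (n + 1)) * indicator {a<..} s \<partial>lborel) =
     (\<integral>\<^sup>+s. ennreal (real n / s ^ (n + 1)) * indicator {a..} s \<partial>lborel)"
    by (intro nn_integral_cong_AE AE_I'[of "{a}"]) (auto simp: indicator_def null_sets_def)
  also have "\<dots> = ennreal (0 - (- (1 / a ^ n)))"
  proof (rule nn_integral_FTC_atLeast)
    fix x assume "a \<le> x"
    then have "x > 0" using assms by simp
    obtain k where k: "n = Suc k" using \<open>0 < n\<close> by (cases n) auto
    then show "((\<lambda>x::real. - (1 / x ^ n)) has_real_derivative real n / x ^ (n + 1)) (at x)"
      unfolding inverse_eq_divide[symmetric] using \<open>x > 0\<close>
      by (rule_tac DERIV_cong[OF DERIV_minus[OF DERIV_inverse'[OF DERIV_pow]]])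
         (auto simp: k field_simps)
    show "0 \<le> real n / x ^ (n + 1)" using \<open>x > 0\<close> by simp
  next
    have "((\<lambda>x::real. - (inverse x ^ n)) \<longlongrightarrow> - (0 ^ n)) at_top"
      by (intro tendsto_intros tendsto_inverse_0_at_top filterlim_ident)
    then show "((\<lambda>x::real. - (1 / x ^ n)) \<longlongrightarrow> 0) at_top"
      using \<open>0 < n\<close> by (simp add: inverse_eq_divide power_one_over zero_power)
  qed measurable
  finally show ?thesis by simp
qed

text \<open>On the unit ball, substitute \<open>r = norm z * s\<close>, exchange the integrals, substitute
  \<open>y = s z\<close> and exchange again; the remaining integral over \<open>s > norm y\<close> is elementary.\<close>

lemma nn_integral_polar:
  fixes h :: "'e::euclidean_space \<Rightarrow> ennreal"
  assumes [measurable]: "h \<in> borel_measurable borel"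
  shows "(\<integral>\<^sup>+\<theta>. (\<integral>\<^sup>+r\<in>{0<..}. h (r *\<^sub>R \<theta>) * ennreal (r ^ (DIM('e) - 1)) \<partial>lborel) \<partial>sphere_measure) =
    (\<integral>\<^sup>+z. h z \<partial>lborel)"
proof -
  define N where "N = DIM('e)"
  have N: "N > 0" by (simp add: N_def)
  then obtain k where k: "N = Suc k" by (cases N) auto
  define G where "G = (\<lambda>\<theta>. \<integral>\<^sup>+r\<in>{0<..}. h (r *\<^sub>R \<theta>) * ennreal (r ^ (N - 1)) \<partial>lborel)"
  have [measurable]: "G \<in> borel_measurable borel" unfolding G_def by measurable
  have G_sgn: "G (sgn z) = (\<integral>\<^sup>+s. h (s *\<^sub>R z) * ennreal (norm z ^ N * s ^ (N - 1)) * indicator {0<..} s \<partial>lborel)"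
    if "z \<noteq> 0" for z
  proof -
    have "G (sgn z) = ennreal (norm z) * (\<integral>\<^sup>+s. h ((norm z * s) *\<^sub>R sgn z) * ennreal ((norm z * s) ^ (N - 1)) * indicator {0<..} (norm z * s) \<partial>lborel)"
      unfolding G_def using that by (subst nn_integral_real_affine[where c="norm z" and t=0]) auto
    also have "\<dots> = (\<integral>\<^sup>+s. ennreal (norm z) * (h ((norm z * s) *\<^sub>R sgn z) * ennreal ((norm z * s) ^ (N - 1)) * indicator {0<..} (norm z * s)) \<partial>lborel)"
      by (rule nn_integral_cmult[symmetric]) measurable
    also have "\<dots> = (\<integral>\<^sup>+s. h (s *\<^sub>R z) * ennreal (norm z ^ N * s ^ (N - 1)) * indicator {0<..} s \<partial>lborel)"
    proof (rule nn_integral_cong)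
      fix s :: real
      have 1: "(norm z * s) *\<^sub>R sgn z = s *\<^sub>R z" using that by (simp add: sgn_div_norm)
      have 2: "indicator {0<..} (norm z * s) = (indicator {0<..} s :: ennreal)"
        using that by (simp add: indicator_def zero_less_mult_iff)
      have "norm z * (norm z * s) ^ (N - 1) = norm z ^ N * s ^ (N - 1)"
        by (simp add: k power_mult_distrib)
      then have 3: "ennreal (norm z) * ennreal ((norm z * s) ^ (N - 1)) = ennreal (norm z ^ N * s ^ (N - 1))"
        by (simp flip: ennreal_mult')
      show "ennreal (norm z) * (h ((norm z * s) *\<^sub>R sgn z) * ennreal ((norm z * s) ^ (N - 1)) * indicator {0<..} (norm z * s))
        = h (s *\<^sub>R z) * ennreal (norm z ^ N * s ^ (N - 1)) * indicator {0<..} s"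
        unfolding 1 2 3[symmetric] by (simp add: mult_ac)
    qed
    finally show ?thesis .
  qed
  define F where "F = (\<lambda>(z::'e) s. h (s *\<^sub>R z) * ennreal (norm z ^ N * s ^ (N - 1)) * indicator {0<..} s * indicator (ball 0 1) z)"
  have "(\<integral>\<^sup>+\<theta>. G \<theta> \<partial>sphere_measure) =
      of_nat N * (\<integral>\<^sup>+z. G (sgn z) * indicator (ball 0 1) z \<partial>lborel)"
    unfolding N_def by (rule nn_integral_sphere_measure) measurable
  also have "(\<integral>\<^sup>+z. G (sgn z) * indicator (ball 0 1) z \<partial>lborel) = (\<integral>\<^sup>+z. (\<integral>\<^sup>+s. F z s \<partial>lborel) \<partial>lborel)"
  proof (intro nn_integral_cong_AE AE_I'[of "{0}"])
    show "{z \<in> space lborel. G (sgn z) * indicator (ball 0 1) z \<noteq> (\<integral>\<^sup>+s. F z s \<partial>lborel)} \<subseteq> {0}"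
    proof -
      have "G (sgn z) * indicator (ball 0 1) z = (\<integral>\<^sup>+s. F z s \<partial>lborel)" if "z \<noteq> 0" for z
        unfolding F_def G_sgn[OF that] by (rule nn_integral_multc[symmetric]) measurable
      then show ?thesis by auto
    qed
  qed (simp add: null_sets_def)
  also have "\<dots> = (\<integral>\<^sup>+s. (\<integral>\<^sup>+z. F z s \<partial>lborel) \<partial>lborel)"
    by (rule lborel_pair.Fubini'[symmetric]) (simp add: F_def indicator_def, measurable)
  also have "of_nat N * \<dots> = (\<integral>\<^sup>+s. of_nat N * (\<integral>\<^sup>+z. F z s \<partial>lborel) \<partial>lborel)"
    by (rule nn_integral_cmult[symmetric]) (simp add: F_def indicator_def, measurable)
  \<comment> \<open>Under \<open>y = s z\<close> the condition \<open>norm z < 1\<close> becomes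
    \<open>norm y < s\<close>. The exponent \<open>N + 1\<close> collects \<open>s^(N-1)\<close>
    from \<open>F\<close>, \<open>s^(-N)\<close> from \<open>norm z ^ N\<close>, and
    \<open>s^(-N)\<close> from the Jacobian.\<close>
  also have "\<dots> = (\<integral>\<^sup>+s. (\<integral>\<^sup>+y. h y * ennreal (norm y ^ N) * (ennreal (real N / s ^ (N + 1)) * indicator {norm y<..} s) \<partial>lborel) \<partial>lborel)"
  proof (rule nn_integral_cong)
    fix s :: real
    show "of_nat N * (\<integral>\<^sup>+z. F z s \<partial>lborel) =
       (\<integral>\<^sup>+y. h y * ennreal (norm y ^ N) * (ennreal (real N / s ^ (N + 1)) * indicator {norm y<..} s) \<partial>lborel)"
    proof (cases "s > 0")
      case False
      then have "\<And>y::'e. \<not> norm y < s" using norm_ge_zero order_le_less_trans by blast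
      then show ?thesis using False by (simp add: F_def)
    next
      case True
      have "(\<integral>\<^sup>+y. h y * ennreal (norm y ^ N) * (ennreal (real N / s ^ (N + 1)) * indicator {norm y<..} s) \<partial>lborel)
        = ennreal (s ^ N) * (\<integral>\<^sup>+z. h (s *\<^sub>R z) * ennreal (norm (s *\<^sub>R z) ^ N) * (ennreal (real N / s ^ (N + 1)) * indicator {norm (s *\<^sub>R z)<..} s) \<partial>lborel)"
      proof -
        have m: "(\<lambda>y. h y * ennreal (norm y ^ N) * (ennreal (real N / s ^ (N + 1)) * indicator {norm y<..} s)) \<in> borel_measurable borel"
          by (simp add: indicator_def, measurable)
        show ?thesis using True by (subst nn_integral_lborel_scaleR[OF m, of s]) (auto simp: N_def)
      qed
      also have "\<dots> = (\<integral>\<^sup>+z. ennreal (s ^ N) * (h (s *\<^sub>R z) * ennreal (norm (s *\<^sub>R z) ^ N) * (ennreal (real N / s ^ (N + 1)) * indicator {norm (s *\<^sub>R z)<..} s)) \<partial>lborel)"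
        by (rule nn_integral_cmult[symmetric]) (simp add: indicator_def, measurable)
      also have "\<dots> = (\<integral>\<^sup>+z. of_nat N * F z s \<partial>lborel)"
      proof (rule nn_integral_cong)
        fix z :: 'e
        have "s ^ N * ((s * norm z) ^ N * (real N / s ^ (N + 1))) = real N * (norm z ^ N * s ^ (N - 1))"
          using True by (simp add: k power_mult_distrib field_simps)
        then have 1: "ennreal (s ^ N) * (ennreal (norm (s *\<^sub>R z) ^ N) * ennreal (real N / s ^ (N + 1))) =
             of_nat N * ennreal (norm z ^ N * s ^ (N - 1))"
          using True by (simp add: ennreal_of_nat_eq_real_of_nat flip: ennreal_mult')
        have 2: "indicator {norm (s *\<^sub>R z)<..} s = (indicator {0<..} s * indicator (ball 0 1) z :: ennreal)"
          using True by (simp add: indicator_def)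
        have "ennreal (s ^ N) * (h (s *\<^sub>R z) * ennreal (norm (s *\<^sub>R z) ^ N) * (ennreal (real N / s ^ (N + 1)) * indicator {norm (s *\<^sub>R z)<..} s))
          = h (s *\<^sub>R z) * (ennreal (s ^ N) * (ennreal (norm (s *\<^sub>R z) ^ N) * ennreal (real N / s ^ (N + 1)))) * indicator {norm (s *\<^sub>R z)<..} s"
          by (simp add: mult_ac)
        also have "\<dots> = of_nat N * F z s"
          unfolding 1 2 F_def by (simp add: mult_ac)
        finally show "ennreal (s ^ N) * (h (s *\<^sub>R z) * ennreal (norm (s *\<^sub>R z) ^ N) * (ennreal (real N / s ^ (N + 1)) * indicator {norm (s *\<^sub>R z)<..} s))
          = of_nat N * F z s" .
      qed
      also have "\<dots> = of_nat N * (\<integral>\<^sup>+z. F z s \<partial>lborel)"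
        by (rule nn_integral_cmult) (simp add: F_def indicator_def, measurable)
      finally show ?thesis by simp
    qed
  qed
  also have "\<dots> = (\<integral>\<^sup>+y. (\<integral>\<^sup>+s. h y * ennreal (norm y ^ N) * (ennreal (real N / s ^ (N + 1)) * indicator {norm y<..} s) \<partial>lborel) \<partial>lborel)"
    by (rule lborel_pair.Fubini') (simp add: indicator_def, measurable)
  also have "\<dots> = (\<integral>\<^sup>+y. h y \<partial>lborel)"
  proof (intro nn_integral_cong_AE AE_I'[of "{0}"])
    show "{y \<in> space lborel. (\<integral>\<^sup>+s. h y * ennreal (norm y ^ N) * (ennreal (real N / s ^ (N + 1)) * indicator {norm y<..} s) \<partial>lborel) \<noteq> h y} \<subseteq> {0}"
    proof safe
      fix y :: 'e
      assume ne: "(\<integral>\<^sup>+s. h y * ennreal (norm y ^ N) * (ennreal (real N / s ^ (N + 1)) * indicator {norm y<..} s) \<partial>lborel) \<noteq> h y"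
      show "y = 0"
      proof (rule ccontr)
        assume "y \<noteq> 0"
        have "(\<integral>\<^sup>+s. h y * ennreal (norm y ^ N) * (ennreal (real N / s ^ (N + 1)) * indicator {norm y<..} s) \<partial>lborel)
          = h y * (ennreal (norm y ^ N) * ennreal (1 / norm y ^ N))"
          using \<open>y \<noteq> 0\<close> N nn_integral_inverse_power_tail[of "norm y" N]
          by (subst nn_integral_cmult) (auto simp: mult_ac)
        also have "ennreal (norm y ^ N) * ennreal (1 / norm y ^ N) = 1"
          using \<open>y \<noteq> 0\<close> by (simp flip: ennreal_mult')
        finally show False using ne by simp
      qed
    qed
  qed (simp add: null_sets_def)
  finally show ?thesis unfolding G_def N_def .
qed

section \<open>Moments of radial functions\<close>

lemma
  fixes f :: "'a::euclidean_space \<Rightarrow> real"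
  assumes [measurable]: "f \<in> borel_measurable borel" and c: "c \<noteq> 0"
  shows integral_lborel_scaleR: "(\<integral>x. f x \<partial>lborel) = \<bar>c\<bar> ^ DIM('a) * (\<integral>x. f (c *\<^sub>R x) \<partial>lborel)"
    and integrable_lborel_scaleR: "integrable lborel (\<lambda>x. f (c *\<^sub>R x)) \<longleftrightarrow> integrable lborel f"
proof -
  have T: "(\<lambda>x::'a. 0 + c *\<^sub>R x) \<in> measurable lborel borel" by measurable
  have "(\<integral>x. f x \<partial>lborel) = (\<integral>x. f x \<partial>density (distr lborel borel (\<lambda>x::'a. 0 + c *\<^sub>R x)) (\<lambda>_. \<bar>c\<bar>^DIM('a)))"
    using lborel_affine[OF c, of "0::'a"] by simp
  also have "\<dots> = (\<integral>x. \<bar>c\<bar>^DIM('a) *\<^sub>R f x \<partial>distr lborel borel (\<lambda>x::'a. 0 + c *\<^sub>R x))"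
    by (rule integral_density) auto
  also have "\<dots> = (\<integral>x. \<bar>c\<bar>^DIM('a) *\<^sub>R f (0 + c *\<^sub>R x) \<partial>lborel)"
    by (rule integral_distr[OF T]) simp
  finally show "(\<integral>x. f x \<partial>lborel) = \<bar>c\<bar> ^ DIM('a) * (\<integral>x. f (c *\<^sub>R x) \<partial>lborel)"
    by simp
  have "integrable lborel f \<longleftrightarrow> integrable (density (distr lborel borel (\<lambda>x::'a. 0 + c *\<^sub>R x)) (\<lambda>_. \<bar>c\<bar>^DIM('a))) f"
    using lborel_affine[OF c, of "0::'a"] by simp
  also have "\<dots> \<longleftrightarrow> integrable (distr lborel borel (\<lambda>x::'a. 0 + c *\<^sub>R x)) (\<lambda>x. \<bar>c\<bar>^DIM('a) *\<^sub>R f x)"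
    by (rule integrable_density) auto
  also have "\<dots> \<longleftrightarrow> integrable lborel (\<lambda>x. \<bar>c\<bar>^DIM('a) *\<^sub>R f (0 + c *\<^sub>R x))"
    by (rule integrable_distr_eq[OF T]) simp
  also have "\<dots> \<longleftrightarrow> integrable lborel (\<lambda>x. f (c *\<^sub>R x))"
    using c by simp
  finally show "integrable lborel (\<lambda>x. f (c *\<^sub>R x)) \<longleftrightarrow> integrable lborel f" by simp
qed

text \<open>The reflection is diagonal with entries 1 and a single -1, so its determinant has
  absolute value 1. It serves to remove the mixed second moments.\<close>

lemma integral_lborel_reflect_basis:
  fixes f :: "'a::euclidean_space \<Rightarrow> real"
  assumes f [measurable]: "f \<in> borel_measurable borel" and i: "i \<in> Basis"
  shows "(\<integral>x. f x \<partial>lborel) = (\<integral>x. f (x - (2 * (x \<bullet> i)) *\<^sub>R i) \<partial>lborel)"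
proof -
  define c where "c = (\<lambda>b::'a. if b = i then -1 else 1 :: real)"
  let ?T = "\<lambda>x::'a. 0 + (\<Sum>b\<in>Basis. (c b * (x \<bullet> b)) *\<^sub>R b)"
  have T: "?T x = x - (2 * (x \<bullet> i)) *\<^sub>R i" for x
  proof (rule euclidean_eqI)
    fix b :: 'a assume b: "b \<in> Basis"
    then have "?T x \<bullet> b = c b * (x \<bullet> b)" by simp
    also have "\<dots> = (x - (2 * (x \<bullet> i)) *\<^sub>R i) \<bullet> b"
      using i b by (cases "b = i") (simp_all add: c_def inner_diff_left inner_Basis)
    finally show "?T x \<bullet> b = (x - (2 * (x \<bullet> i)) *\<^sub>R i) \<bullet> b" .
  qed
  have "(\<Prod>b\<in>Basis. \<bar>c b\<bar>) = 1"
    by (intro prod.neutral) (auto simp: c_def)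
  moreover have "lborel = density (distr lborel borel ?T) (\<lambda>_. ennreal (\<Prod>b\<in>Basis. \<bar>c b\<bar>))"
    by (rule lborel_affine_euclidean) (simp add: c_def)
  ultimately have "lborel = density (distr lborel borel ?T) (\<lambda>_. 1)" by simp
  then have L: "lborel = distr lborel borel ?T" by (simp only: density_1)
  have "(\<integral>x. f x \<partial>lborel) = (\<integral>x. f x \<partial>distr lborel borel ?T)"
    using L by simp
  also have "\<dots> = (\<integral>x. f (?T x) \<partial>lborel)"
    by (rule integral_distr) measurable
  finally show ?thesis by (simp only: T)
qed

definition permute_coords :: "('a \<Rightarrow> 'a) \<Rightarrow> 'a::euclidean_space \<Rightarrow> 'a" where
  "permute_coords \<pi> x = (\<Sum>b\<in>Basis. (x \<bullet> \<pi> b) *\<^sub>R b)"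

lemma permute_coords_inner [simp]: "b \<in> Basis \<Longrightarrow> permute_coords \<pi> x \<bullet> b = x \<bullet> \<pi> b"
  by (simp add: permute_coords_def)

lemma power2_norm_eq_sum_Basis: "(norm x)\<^sup>2 = (\<Sum>b\<in>Basis. (x \<bullet> b)\<^sup>2)"
  unfolding power2_norm_eq_inner by (subst euclidean_inner) (simp add: power2_eq_square)

lemma norm_permute_coords:
  assumes "bij_betw \<pi> Basis Basis"
  shows "norm (permute_coords \<pi> x) = norm x"
proof -
  have "(\<Sum>b\<in>Basis. (x \<bullet> \<pi> b)\<^sup>2) = (\<Sum>b\<in>Basis. (x \<bullet> b)\<^sup>2)"
    using assms by (rule sum.reindex_bij_betw)
  then have "(norm (permute_coords \<pi> x))\<^sup>2 = (norm x)\<^sup>2"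
    by (simp add: power2_norm_eq_sum_Basis)
  then show ?thesis by simp
qed

text \<open>Boxes determine Lebesgue measure, and the preimage of a box is the box whose corners are
  permuted by the inverse \<open>?\<sigma>\<close>: the same side lengths in another order.\<close>

lemma distr_lborel_permute_coords:
  assumes \<pi>: "bij_betw \<pi> Basis (Basis :: 'a::euclidean_space set)"
  shows "lborel = distr lborel borel (permute_coords \<pi>)"
proof (rule lborel_eqI)
  have [measurable]: "permute_coords \<pi> \<in> borel_measurable borel"
    unfolding permute_coords_def[abs_def] by measurable
  let ?\<sigma> = "inv_into Basis \<pi>"
  have \<sigma>: "bij_betw ?\<sigma> Basis Basis" using \<pi> by (rule bij_betw_inv_into)
  have \<sigma>_in: "b \<in> Basis \<Longrightarrow> ?\<sigma> b \<in> Basis" "b \<in> Basis \<Longrightarrow> \<pi> b \<in> Basis" for b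
    using \<sigma> \<pi> by (auto simp: bij_betw_def)
  have inv: "b \<in> Basis \<Longrightarrow> \<pi> (?\<sigma> b) = b" "b \<in> Basis \<Longrightarrow> ?\<sigma> (\<pi> b) = b" for b
    using bij_betw_inv_into_right[OF \<pi>] bij_betw_inv_into_left[OF \<pi>] by auto
  fix l u :: 'a assume lu: "\<And>b. b \<in> Basis \<Longrightarrow> l \<bullet> b \<le> u \<bullet> b"
  have "permute_coords \<pi> -` box l u = box (permute_coords ?\<sigma> l) (permute_coords ?\<sigma> u)"
  proof (intro set_eqI iffI)
    fix x assume x: "x \<in> permute_coords \<pi> -` box l u"
    show "x \<in> box (permute_coords ?\<sigma> l) (permute_coords ?\<sigma> u)"
      unfolding mem_box
    proof
      fix i :: 'a assume i: "i \<in> Basis"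
      then have "l \<bullet> ?\<sigma> i < permute_coords \<pi> x \<bullet> ?\<sigma> i \<and> permute_coords \<pi> x \<bullet> ?\<sigma> i < u \<bullet> ?\<sigma> i"
        using x \<sigma>_in by (auto simp del: permute_coords_inner simp: mem_box)
      then show "permute_coords ?\<sigma> l \<bullet> i < x \<bullet> i \<and> x \<bullet> i < permute_coords ?\<sigma> u \<bullet> i"
        using i by (simp add: \<sigma>_in inv)
    qed
  next
    fix x assume x: "x \<in> box (permute_coords ?\<sigma> l) (permute_coords ?\<sigma> u)"
    show "x \<in> permute_coords \<pi> -` box l u"
      unfolding vimage_def mem_Collect_eq mem_box
    proof
      fix i :: 'a assume i: "i \<in> Basis"
      then have "permute_coords ?\<sigma> l \<bullet> \<pi> i < x \<bullet> \<pi> i \<and> x \<bullet> \<pi> i < permute_coords ?\<sigma> u \<bullet> \<pi> i"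
        using x \<sigma>_in by (auto simp del: permute_coords_inner simp: mem_box)
      then show "l \<bullet> i < permute_coords \<pi> x \<bullet> i \<and> permute_coords \<pi> x \<bullet> i < u \<bullet> i"
        using i by (simp add: \<sigma>_in inv)
    qed
  qed
  then have "emeasure (distr lborel borel (permute_coords \<pi>)) (box l u) =
      emeasure lborel (box (permute_coords ?\<sigma> l) (permute_coords ?\<sigma> u))"
    by (simp add: emeasure_distr)
  also have "\<dots> = ennreal (\<Prod>b\<in>Basis. (u - l) \<bullet> ?\<sigma> b)"
    using lu \<sigma>_in by (subst emeasure_lborel_box) (auto simp: inner_diff_left intro!: prod.cong)
  also have "(\<Prod>b\<in>Basis. (u - l) \<bullet> ?\<sigma> b) = (\<Prod>b\<in>Basis. (u - l) \<bullet> b)"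
    using \<sigma> by (rule prod.reindex_bij_betw)
  finally show "emeasure (distr lborel borel (permute_coords \<pi>)) (box l u) = (\<Prod>b\<in>Basis. (u - l) \<bullet> b)" .
qed simp

text \<open>The substitution of \<open>-z\<close> for \<open>z\<close> shows that the integral
  equals its own negative.\<close>

lemma integral_radial_odd:
  fixes f :: "real \<Rightarrow> real" and L :: "'e::euclidean_space \<Rightarrow> real"
  assumes f: "(\<lambda>z::'e. f (norm z)) \<in> borel_measurable borel" and L: "bounded_linear L"
  shows "(\<integral>z. f (norm z) * L z \<partial>lborel) = 0"
proof -
  have Lm: "L \<in> borel_measurable borel"
    using L by (intro borel_measurable_continuous_onI linear_continuous_on)
  have "(\<integral>z. f (norm z) * L z \<partial>lborel) = \<bar>-1\<bar> ^ DIM('e) * (\<integral>z. f (norm (-1 *\<^sub>R z)) * L (-1 *\<^sub>R z) \<partial>lborel)"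
    by (rule integral_lborel_scaleR) (auto intro!: borel_measurable_times f Lm)
  also have "\<dots> = - (\<integral>z. f (norm z) * L z \<partial>lborel)"
    using L by (simp add: linear_simps bounded_linear.linear linear_neg)
  finally show ?thesis by simp
qed

text \<open>Reflecting one coordinate makes the mixed moments vanish, and swapping two coordinates
  makes the pure ones equal, each being \<open>1/N\<close> of the moment of
  \<open>(norm z)^2\<close>. So only the trace of \<open>B\<close> survives. Together with the
  Taylor factor 1/2 this produces the \<open>1/(2N)\<close> in \<open>q\<close>.\<close>

lemma integral_radial_quadratic:
  fixes f :: "real \<Rightarrow> real" and B :: "'e::euclidean_space \<Rightarrow> 'e \<Rightarrow> real"
  assumes f [measurable]: "(\<lambda>z::'e. f (norm z)) \<in> borel_measurable borel"
    and int: "integrable lborel (\<lambda>z::'e. f (norm z) * (norm z)\<^sup>2)"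
    and B: "bilinear B"
  shows "(\<integral>z. f (norm z) * B z z \<partial>lborel) =
    (\<Sum>b\<in>Basis. B b b) / DIM('e) * (\<integral>z. f (norm (z::'e)) * (norm z)\<^sup>2 \<partial>lborel)"
proof -
  define I where "I = (\<lambda>i j. \<integral>z. f (norm (z::'e)) * ((z \<bullet> i) * (z \<bullet> j)) \<partial>lborel)"
  have int_ij: "integrable lborel (\<lambda>z::'e. f (norm z) * ((z \<bullet> i) * (z \<bullet> j)))" if "i \<in> Basis" "j \<in> Basis" for i j
  proof (rule Bochner_Integration.integrable_bound[OF int])
    show "AE z::'e in lborel. norm (f (norm z) * ((z \<bullet> i) * (z \<bullet> j))) \<le> norm (f (norm z) * (norm z)\<^sup>2)"
      using that Basis_le_norm[OF that(1)] Basis_le_norm[OF that(2)]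
      by (auto simp: abs_mult power2_eq_square intro!: mult_left_mono mult_mono)
  qed measurable
  have off: "I i j = 0" if "i \<in> Basis" "j \<in> Basis" "i \<noteq> j" for i j
  proof -
    have n: "norm (z - (2 * (z \<bullet> i)) *\<^sub>R i) = norm z" for z :: 'e
      using that(1) by (simp add: norm_eq_sqrt_inner inner_diff_left inner_diff_right inner_commute power2_eq_square algebra_simps)
    have "I i j = (\<integral>z. f (norm ((z::'e) - (2 * (z \<bullet> i)) *\<^sub>R i)) *
        (((z - (2 * (z \<bullet> i)) *\<^sub>R i) \<bullet> i) * ((z - (2 * (z \<bullet> i)) *\<^sub>R i) \<bullet> j)) \<partial>lborel)"
      unfolding I_def by (rule integral_lborel_reflect_basis[OF _ that(1)]) measurable
    also have "\<dots> = - I i j"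
      unfolding n using that by (simp add: inner_diff_left inner_Basis I_def)
    finally show ?thesis by simp
  qed
  have diag: "I i i = I j j" if "i \<in> Basis" "j \<in> Basis" for i j
  proof -
    let ?\<pi> = "\<lambda>b. if b = i then j else if b = j then i else b"
    have \<pi>: "bij_betw ?\<pi> Basis Basis"
      using that by (intro bij_betwI[of _ _ _ "?\<pi>"]) auto
    have [measurable]: "permute_coords ?\<pi> \<in> borel_measurable borel"
      unfolding permute_coords_def[abs_def] by measurable
    have "I i i = (\<integral>z. f (norm (z::'e)) * ((z \<bullet> i) * (z \<bullet> i)) \<partial>distr lborel borel (permute_coords ?\<pi>))"
      unfolding I_def using distr_lborel_permute_coords[OF \<pi>] by simp
    also have "\<dots> = (\<integral>z. f (norm (permute_coords ?\<pi> z)) * ((permute_coords ?\<pi> z \<bullet> i) * (permute_coords ?\<pi> z \<bullet> i)) \<partial>lborel)"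
      by (rule integral_distr) measurable
    also have "\<dots> = I j j"
      using that by (simp add: norm_permute_coords[OF \<pi>] I_def)
    finally show ?thesis .
  qed
  obtain e :: 'e where e: "e \<in> Basis" using nonempty_Basis by blast
  have "(\<integral>z. f (norm (z::'e)) * (norm z)\<^sup>2 \<partial>lborel) = (\<integral>z. (\<Sum>i\<in>Basis. f (norm (z::'e)) * ((z \<bullet> i) * (z \<bullet> i))) \<partial>lborel)"
    unfolding power2_norm_eq_sum_Basis by (simp add: sum_distrib_left power2_eq_square)
  also have "\<dots> = (\<Sum>i\<in>Basis. I i i)"
    unfolding I_def by (rule Bochner_Integration.integral_sum) (rule int_ij)
  also have "\<dots> = (\<Sum>i\<in>(Basis::'e set). I e e)"
    by (intro sum.cong diag e) auto
  finally have tot: "(\<integral>z. f (norm (z::'e)) * (norm z)\<^sup>2 \<partial>lborel) = DIM('e) * I e e" by simp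
  have expand: "B z z = (\<Sum>i\<in>Basis. \<Sum>j\<in>Basis. (z \<bullet> i) * (z \<bullet> j) * B i j)" for z
  proof -
    have "B z z = B (\<Sum>i\<in>Basis. (z \<bullet> i) *\<^sub>R i) (\<Sum>i\<in>Basis. (z \<bullet> i) *\<^sub>R i)"
      by (simp add: euclidean_representation)
    also have "\<dots> = (\<Sum>(i, j)\<in>Basis \<times> Basis. B ((z \<bullet> i) *\<^sub>R i) ((z \<bullet> j) *\<^sub>R j))"
      by (rule bilinear_sum[OF B])
    also have "\<dots> = (\<Sum>i\<in>Basis. \<Sum>j\<in>Basis. (z \<bullet> i) * (z \<bullet> j) * B i j)"
      unfolding sum.cartesian_product[symmetric]
      by (simp add: bilinear_lmul[OF B] bilinear_rmul[OF B] mult_ac)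
    finally show ?thesis .
  qed
  have "(\<integral>z. f (norm z) * B z z \<partial>lborel) =
    (\<integral>z. (\<Sum>i\<in>Basis. \<Sum>j\<in>Basis. B i j * (f (norm z) * ((z \<bullet> i) * (z \<bullet> j)))) \<partial>lborel)"
    by (simp add: expand sum_distrib_left mult_ac)
  also have "\<dots> = (\<Sum>i\<in>Basis. \<Sum>j\<in>Basis. B i j * I i j)"
    by (simp add: int_ij I_def)
  also have "\<dots> = (\<Sum>i\<in>Basis. B i i * I i i)"
  proof (rule sum.cong)
    fix i :: 'e assume i: "i \<in> Basis"
    then have "(\<Sum>j\<in>Basis. B i j * I i j) = (\<Sum>j\<in>Basis. if j = i then B i i * I i i else 0)"
      by (intro sum.cong) (auto simp: off)
    then show "(\<Sum>j\<in>Basis. B i j * I i j) = B i i * I i i" using i by simp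
  qed simp
  also have "\<dots> = (\<Sum>i\<in>Basis. B i i * I e e)"
    by (intro sum.cong) (auto simp: diag[OF _ e])
  also have "\<dots> = (\<Sum>i\<in>Basis. B i i) * I e e"
    by (simp add: sum_distrib_right)
  finally show ?thesis using tot by simp
qed

section \<open>Taylor expansion and the Laplacian at the center\<close>

context
  fixes v :: "'e::euclidean_space \<Rightarrow> real" and Dv :: "'e \<Rightarrow> 'e \<Rightarrow>\<^sub>L real"
    and D2v :: "'e \<Rightarrow> 'e \<Rightarrow>\<^sub>L 'e \<Rightarrow>\<^sub>L real" and \<rho> :: real
  assumes D1: "\<And>z. z \<in> ball 0 \<rho> \<Longrightarrow> (v has_derivative blinfun_apply (Dv z)) (at z)"
    and D2: "\<And>z. z \<in> ball 0 \<rho> \<Longrightarrow> (Dv has_derivative blinfun_apply (D2v z)) (at z)"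
begin

lemma DERIV_along_curve:
  assumes "(\<gamma> has_vector_derivative d) (at s)" "\<gamma> s \<in> ball 0 \<rho>"
  shows "((\<lambda>s. v (\<gamma> s)) has_real_derivative Dv (\<gamma> s) d) (at s)"
proof -
  have "((\<lambda>s. v (\<gamma> s)) has_derivative (\<lambda>h. Dv (\<gamma> s) (h *\<^sub>R d))) (at s)"
    using has_derivative_compose[OF assms(1)[unfolded has_vector_derivative_def] D1[OF assms(2)]] .
  then show ?thesis
    by (simp add: has_field_derivative_def blinfun.scaleR_right mult.commute[of _ "Dv (\<gamma> s) d"])
qed

lemma DERIV_differential_along_curve:
  assumes \<gamma>: "(\<gamma> has_vector_derivative \<gamma>1 s) (at s)" "\<gamma> s \<in> ball 0 \<rho>"
    and \<gamma>1: "(\<gamma>1 has_vector_derivative \<gamma>2) (at s)"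
  shows "((\<lambda>s. Dv (\<gamma> s) (\<gamma>1 s)) has_real_derivative D2v (\<gamma> s) (\<gamma>1 s) (\<gamma>1 s) + Dv (\<gamma> s) \<gamma>2) (at s)"
proof -
  have "((\<lambda>s. Dv (\<gamma> s)) has_derivative (\<lambda>h. D2v (\<gamma> s) (h *\<^sub>R \<gamma>1 s))) (at s)"
    using has_derivative_compose[OF \<gamma>(1)[unfolded has_vector_derivative_def] D2[OF \<gamma>(2)]] .
  from blinfun.FDERIV[OF this \<gamma>1[unfolded has_vector_derivative_def]]
  have "((\<lambda>s. Dv (\<gamma> s) (\<gamma>1 s)) has_derivative
      (\<lambda>h. Dv (\<gamma> s) (h *\<^sub>R \<gamma>2) + D2v (\<gamma> s) (h *\<^sub>R \<gamma>1 s) (\<gamma>1 s))) (at s)" .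
  then show ?thesis
    by (rule has_derivative_imp_has_field_derivative)
       (simp add: blinfun.scaleR_right blinfun.scaleR_left algebra_simps)
qed

text \<open>The acceleration \<open>\<gamma>2\<close> contributes a first-order term; for great
  circles it is the source of the \<open>Dv\<close> part of the spherical Laplacian. The outer
  \<open>deriv\<close> needs the inner one on a whole neighborhood, hence the open set
  \<open>U\<close>.\<close>

lemma deriv_deriv_along_curve:
  assumes U: "open U" "s \<in> U"
    and \<gamma>: "\<And>s. s \<in> U \<Longrightarrow> (\<gamma> has_vector_derivative \<gamma>1 s) (at s)" "\<And>s. s \<in> U \<Longrightarrow> \<gamma> s \<in> ball 0 \<rho>"
    and \<gamma>1: "(\<gamma>1 has_vector_derivative \<gamma>2) (at s)"
  shows "deriv (deriv (\<lambda>s. v (\<gamma> s))) s = D2v (\<gamma> s) (\<gamma>1 s) (\<gamma>1 s) + Dv (\<gamma> s) \<gamma>2"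
proof -
  have "deriv (\<lambda>s. v (\<gamma> s)) s = Dv (\<gamma> s) (\<gamma>1 s)" if "s \<in> U" for s
    using DERIV_along_curve[OF \<gamma>[OF that]] by (rule DERIV_imp_deriv)
  then have "eventually (\<lambda>s. deriv (\<lambda>s. v (\<gamma> s)) s = Dv (\<gamma> s) (\<gamma>1 s)) (nhds s)"
    using U by (auto simp: eventually_nhds)
  then have "deriv (deriv (\<lambda>s. v (\<gamma> s))) s = deriv (\<lambda>s. Dv (\<gamma> s) (\<gamma>1 s)) s"
    by (rule deriv_cong_ev) simp
  also have "\<dots> = D2v (\<gamma> s) (\<gamma>1 s) (\<gamma>1 s) + Dv (\<gamma> s) \<gamma>2"
    using DERIV_differential_along_curve[OF \<gamma>[OF U(2)] \<gamma>1] by (rule DERIV_imp_deriv)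
  finally show ?thesis .
qed

text \<open>On the segment from 0 to \<open>z\<close> the Lagrange remainder contains
  \<open>D2v\<close> at an intermediate point \<open>t z\<close>; the Hoelder bound is the price of
  replacing it by \<open>D2v 0\<close>.\<close>

lemma taylor2_holder:
  assumes z: "z \<in> ball 0 \<rho>" and "0 \<le> K" "0 \<le> \<alpha>"
    and holder: "\<And>z. z \<in> ball 0 \<rho> \<Longrightarrow> norm (D2v z - D2v 0) \<le> K * norm z powr \<alpha>"
  shows "\<bar>v z - v 0 - Dv 0 z - D2v 0 z z / 2\<bar> \<le> K / 2 * norm z powr \<alpha> * (norm z)\<^sup>2"
proof -
  define d where "d = (\<lambda>(m::nat) s. if m = 0 then v (s *\<^sub>R z) else if m = 1 then Dv (s *\<^sub>R z) z else D2v (s *\<^sub>R z) z z)"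
  have in_ball: "s *\<^sub>R z \<in> ball 0 \<rho>" if "0 \<le> s" "s \<le> 1" for s
    using z that mult_left_le_one_le[of "norm z" s] by auto
  have line: "((\<lambda>s. s *\<^sub>R z) has_vector_derivative z) (at s)" for s
    by (auto intro!: derivative_eq_intros)
  have "\<exists>t. 0 < t \<and> t < 1 \<and> d 0 1 = (\<Sum>m<2. d m 0 / fact m * 1 ^ m) + d 2 t / fact 2 * 1 ^ 2"
  proof (rule Maclaurin)
    show "\<forall>m t. m < 2 \<and> 0 \<le> t \<and> t \<le> 1 \<longrightarrow> (d m has_real_derivative d (Suc m) t) (at t)"
    proof (intro allI impI)
      fix m :: nat and t :: real assume t: "m < 2 \<and> 0 \<le> t \<and> t \<le> 1"
      then consider "m = 0" | "m = 1" by linarith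
      then show "(d m has_real_derivative d (Suc m) t) (at t)"
      proof cases
        case 1
        then show ?thesis using DERIV_along_curve[OF line in_ball, of t] t by (simp add: d_def)
      next
        case 2
        then show ?thesis
          using DERIV_differential_along_curve[of "\<lambda>s. s *\<^sub>R z" "\<lambda>_. z" t 0, OF line in_ball] t
          by (simp add: d_def)
      qed
    qed
  qed auto
  then obtain t where t: "0 < t" "t < 1"
    and "d 0 1 = (\<Sum>m<2. d m 0 / fact m * 1 ^ m) + d 2 t / fact 2 * 1 ^ 2" by blast
  then have "v z - v 0 - Dv 0 z - D2v 0 z z / 2 = (D2v (t *\<^sub>R z) - D2v 0) z z / 2"
    by (simp add: d_def numeral_2_eq_2 blinfun.diff_left)
  also have "\<bar>\<dots>\<bar> \<le> norm (D2v (t *\<^sub>R z) - D2v 0) * norm z * norm z / 2"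
    using norm_blinfun[of "(D2v (t *\<^sub>R z) - D2v 0) z" z] norm_blinfun[of "D2v (t *\<^sub>R z) - D2v 0" z]
    by (simp add: mult_right_mono order_trans)
  also have "\<dots> \<le> (K * norm z powr \<alpha>) * norm z * norm z / 2"
  proof -
    have "norm (D2v (t *\<^sub>R z) - D2v 0) \<le> K * norm (t *\<^sub>R z) powr \<alpha>"
      using holder[OF in_ball[of t]] t by simp
    also have "\<dots> \<le> K * norm z powr \<alpha>"
      using t \<open>0 \<le> K\<close> \<open>0 \<le> \<alpha>\<close> mult_left_le_one_le[of "norm z" t] by (intro mult_left_mono powr_mono2) auto
    finally show ?thesis by (intro divide_right_mono mult_right_mono) auto
  qed
  finally show ?thesis by (simp add: power2_eq_square mult_ac)
qed

text \<open>\<open>sphere_laplacian\<close> sums over \<open>Basis\<close>, so on a coordinate axis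
  every summand is explicit. Along \<open>e\<close> the point \<open>sgn (\<theta> + s e)\<close>
  does not move for small \<open>s\<close>. Along any other \<open>b\<close> it runs through a great
  circle with velocity \<open>b\<close> and acceleration \<open>-\<theta>\<close> at
  \<open>s = 0\<close>.\<close>

lemma polar_laplacian_axis:
  assumes e: "e \<in> Basis" and \<theta>: "\<theta> = e \<or> \<theta> = - e" and r: "0 < r" "r < \<rho>"
  shows "polar_laplacian \<psi> v (r *\<^sub>R \<theta>) =
    D2v (r *\<^sub>R \<theta>) e e + (real DIM('e) - 1) * (deriv \<psi> r / \<psi> r) * Dv (r *\<^sub>R \<theta>) \<theta> +
    (r\<^sup>2 * (\<Sum>b\<in>Basis - {e}. D2v (r *\<^sub>R \<theta>) b b) - (real DIM('e) - 1) * r * Dv (r *\<^sub>R \<theta>) \<theta>) / (\<psi> r)\<^sup>2"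
proof -
  have nt: "norm \<theta> = 1" using e \<theta> by auto
  have sg: "sgn (r *\<^sub>R \<theta>) = \<theta>" "norm (r *\<^sub>R \<theta>) = r"
    using nt r by (simp_all add: sgn_scaleR sgn_div_norm)
  have line: "((\<lambda>s. s *\<^sub>R \<theta>) has_vector_derivative \<theta>) (at s)" for s
    by (auto intro!: derivative_eq_intros)
  have in_ball: "s *\<^sub>R \<theta> \<in> ball 0 \<rho>" if "s \<in> {-\<rho><..<\<rho>}" for s
    using nt that by auto
  have 1: "deriv (\<lambda>s. v (s *\<^sub>R \<theta>)) r = Dv (r *\<^sub>R \<theta>) \<theta>"
    using r by (intro DERIV_imp_deriv DERIV_along_curve line in_ball) auto
  have 2: "deriv (deriv (\<lambda>s. v (s *\<^sub>R \<theta>))) r = D2v (r *\<^sub>R \<theta>) e e"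
    using deriv_deriv_along_curve[of "{-\<rho><..<\<rho>}" r "\<lambda>s. s *\<^sub>R \<theta>" "\<lambda>_. \<theta>" 0] r line in_ball \<theta>
    by (auto simp: blinfun.minus_left blinfun.minus_right)
  have parallel: "deriv (deriv (\<lambda>s. v (r *\<^sub>R sgn (\<theta> + s *\<^sub>R e)))) 0 = 0"
  proof -
    have "v (r *\<^sub>R sgn (\<theta> + s *\<^sub>R e)) = v (r *\<^sub>R \<theta>)" if "s \<in> {-1<..<1}" for s
    proof -
      obtain \<sigma> :: real where \<sigma>: "\<theta> = \<sigma> *\<^sub>R e" "\<sigma> = 1 \<or> \<sigma> = -1"
        using \<theta> by (metis scaleR_minus1_left scaleR_one)
      have "\<theta> + s *\<^sub>R e = (\<sigma> + s) *\<^sub>R e" by (simp add: \<sigma> scaleR_left_distrib)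
      moreover have "sgn (\<sigma> + s) = \<sigma>" using \<sigma>(2) that by auto
      moreover have "sgn e = e" using e by (simp add: sgn_div_norm)
      ultimately have "sgn (\<theta> + s *\<^sub>R e) = \<theta>" by (simp add: sgn_scaleR \<sigma>(1))
      then show ?thesis by simp
    qed
    then have ev: "eventually (\<lambda>s. v (r *\<^sub>R sgn (\<theta> + s *\<^sub>R e)) = v (r *\<^sub>R \<theta>)) (nhds s)" if "s \<in> {-1<..<1}" for s
      using that by (auto simp: eventually_nhds intro!: exI[of _ "{-1<..<1::real}"])
    then have "deriv (\<lambda>s. v (r *\<^sub>R sgn (\<theta> + s *\<^sub>R e))) s = 0" if "s \<in> {-1<..<1}" for s
      using deriv_cong_ev[OF ev[OF that] refl] by simp
    then have "eventually (\<lambda>s. deriv (\<lambda>s. v (r *\<^sub>R sgn (\<theta> + s *\<^sub>R e))) s = 0) (nhds (0::real))"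
      by (auto simp: eventually_nhds intro!: exI[of _ "{-1<..<1::real}"])
    from deriv_cong_ev[OF this refl] show ?thesis by simp
  qed
  have perp: "deriv (deriv (\<lambda>s. v (r *\<^sub>R sgn (\<theta> + s *\<^sub>R b)))) 0 =
      r\<^sup>2 * D2v (r *\<^sub>R \<theta>) b b - r * Dv (r *\<^sub>R \<theta>) \<theta>" if b: "b \<in> Basis - {e}" for b
  proof -
    have orth: "\<theta> \<bullet> b = 0" "b \<bullet> \<theta> = 0" "b \<bullet> b = 1" "\<theta> \<bullet> \<theta> = 1"
      using b e \<theta> by (auto simp: inner_Basis)
    have norm: "norm (\<theta> + s *\<^sub>R b) = sqrt (1 + s\<^sup>2)" for s
      using orth by (simp add: norm_eq_sqrt_inner inner_add_left inner_add_right power2_eq_square)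
    have pos: "0 < 1 + s\<^sup>2" for s :: real by (simp add: add_pos_nonneg)
    let ?p = "\<lambda>s::real. inverse (sqrt (1 + s\<^sup>2))"
    let ?g = "\<lambda>s. r *\<^sub>R sgn (\<theta> + s *\<^sub>R b)"
    let ?g1 = "\<lambda>s. r *\<^sub>R (?p s *\<^sub>R b - (s * ?p s ^ 3) *\<^sub>R (\<theta> + s *\<^sub>R b))"
    have dp: "(?p has_real_derivative - (s * ?p s ^ 3)) (at s)" for s
      using pos[of s] pos[of s, THEN less_imp_neq]
      by (auto intro!: derivative_eq_intros simp: power3_eq_cube field_simps)
    have g: "?g s = r *\<^sub>R (?p s *\<^sub>R (\<theta> + s *\<^sub>R b))" for s
      by (simp add: sgn_div_norm norm)
    have dl: "((\<lambda>s. \<theta> + s *\<^sub>R b) has_vector_derivative b) (at s)" for s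
      by (auto intro!: derivative_eq_intros)
    have dg: "(?g has_vector_derivative ?g1 s) (at s)" for s
      unfolding g
      by (rule derivative_eq_intros dp dl refl | simp add: algebra_simps)+
    \<comment> \<open>The derivative of \<open>s * ?p s ^ 3\<close> at 0 is 1 and that of
      \<open>?p\<close> is 0, so what remains is the centripetal acceleration.\<close>
    have dg1: "(?g1 has_vector_derivative - (r *\<^sub>R \<theta>)) (at 0)"
    proof -
      have d3: "((\<lambda>s. s * ?p s ^ 3) has_real_derivative 1) (at 0)"
        by (rule derivative_eq_intros dp refl | simp)+
      show ?thesis
        by (rule derivative_eq_intros dp[of 0] dl[of 0] d3 refl | simp)+
    qed
    have "deriv (deriv (\<lambda>s. v (?g s))) 0 = D2v (?g 0) (?g1 0) (?g1 0) + Dv (?g 0) (- (r *\<^sub>R \<theta>))"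
    proof (rule deriv_deriv_along_curve[of UNIV])
      have "norm (sgn (\<theta> + s *\<^sub>R b)) = 1" for s
        using norm[of s] pos[of s] by (auto simp: norm_sgn)
      then show "?g s \<in> ball 0 \<rho>" for s using r by simp
    qed (use dg dg1 in auto)
    also have "?g 0 = r *\<^sub>R \<theta>" using nt by (simp add: sgn_div_norm)
    also have "?g1 0 = r *\<^sub>R b" by simp
    finally show ?thesis
      by (simp add: blinfun.scaleR_left blinfun.scaleR_right blinfun.minus_right power2_eq_square)
  qed
  have "sphere_laplacian (\<lambda>\<omega>. v (r *\<^sub>R \<omega>)) \<theta> =
      (\<Sum>b\<in>insert e (Basis - {e}). deriv (deriv (\<lambda>s. v (r *\<^sub>R sgn (\<theta> + s *\<^sub>R b)))) 0)"
    unfolding sphere_laplacian_def using e by (simp add: insert_absorb)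
  also have "\<dots> = (\<Sum>b\<in>Basis - {e}. r\<^sup>2 * D2v (r *\<^sub>R \<theta>) b b - r * Dv (r *\<^sub>R \<theta>) \<theta>)"
    by (subst sum.insert) (auto simp: parallel perp simp del: insert_Diff_single)
  also have "\<dots> = r\<^sup>2 * (\<Sum>b\<in>Basis - {e}. D2v (r *\<^sub>R \<theta>) b b) - (real DIM('e) - 1) * r * Dv (r *\<^sub>R \<theta>) \<theta>"
    using e DIM_positive[where 'a='e]
    by (simp add: sum_subtractf sum_distrib_left card_Diff_singleton of_nat_diff Suc_le_eq)
  finally show ?thesis
    unfolding polar_laplacian_def Let_def sg 1 2 by simp
qed

text \<open>Averaging over antipodal points removes the first-order terms, which would otherwise
  survive when \<open>\<psi>''(0) \<noteq> 0\<close>.\<close>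

lemma polar_laplacian_antipodal_limit:
  assumes e: "e \<in> Basis" and \<rho>: "0 < \<rho>" and cont: "isCont D2v 0"
    and \<psi>: "((\<lambda>r. \<psi> r / r) \<longlongrightarrow> 1) (at_right 0)" and \<psi>': "((\<lambda>r. deriv \<psi> r) \<longlongrightarrow> 1) (at_right 0)"
  shows "((\<lambda>r. polar_laplacian \<psi> v (r *\<^sub>R e) + polar_laplacian \<psi> v (r *\<^sub>R (- e))) \<longlongrightarrow>
    2 * (\<Sum>b\<in>Basis. D2v 0 b b)) (at_right 0)"
proof -
  let ?n = "real DIM('e) - 1"
  let ?f = "\<lambda>r. Dv (r *\<^sub>R e) e"
  let ?A = "\<lambda>r. D2v (r *\<^sub>R e) e e + D2v (r *\<^sub>R (- e)) e e"
  let ?B = "\<lambda>r. (\<Sum>b\<in>Basis - {e}. D2v (r *\<^sub>R e) b b + D2v (r *\<^sub>R (- e)) b b)"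
  \<comment> \<open>This is the sum of the two outward derivatives, at \<open>r e\<close> and
    \<open>- r e\<close>, divided by \<open>r\<close>. Inserting and removing \<open>?f 0\<close>
    turns it into two difference quotients of \<open>Dv (s e) e\<close>, which converge.\<close>
  let ?Q = "\<lambda>r. (?f r - ?f 0) / r + (?f (- r) - ?f 0) / (- r)"
  have lim: "((\<lambda>r. D2v (r *\<^sub>R x) b b) \<longlongrightarrow> D2v 0 b b) (at_right 0)" for x b
  proof -
    have "((\<lambda>r::real. r *\<^sub>R x) \<longlongrightarrow> 0) (at_right 0)"
      by (auto intro!: tendsto_eq_intros)
    then have "((\<lambda>r. D2v (r *\<^sub>R x)) \<longlongrightarrow> D2v 0) (at_right 0)"
      by (rule isCont_tendsto_compose[OF cont])
    then show ?thesis by (intro tendsto_intros)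
  qed
  have inv: "((\<lambda>r. r / \<psi> r) \<longlongrightarrow> 1) (at_right 0)"
    using tendsto_inverse[OF \<psi>] by simp
  have "((\<lambda>s. s *\<^sub>R e) has_vector_derivative e) (at 0)"
    by (auto intro!: derivative_eq_intros)
  then have df: "(?f has_real_derivative D2v 0 e e) (at 0)"
    using DERIV_differential_along_curve[of "\<lambda>s. s *\<^sub>R e" "\<lambda>_. e" 0 0] \<rho> by simp
  then have f0: "((\<lambda>h. (?f h - ?f 0) / h) \<longlongrightarrow> D2v 0 e e) (at 0)"
    by (simp add: has_field_derivative_iff)
  have Q: "(?Q \<longlongrightarrow> D2v 0 e e + D2v 0 e e) (at_right 0)"
  proof (rule tendsto_add)
    show "((\<lambda>r. (?f r - ?f 0) / r) \<longlongrightarrow> D2v 0 e e) (at_right 0)"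
      by (rule tendsto_mono[OF _ f0]) (simp add: at_le)
    have "filterlim (\<lambda>r::real. - r) (at 0) (at_right 0)"
      by (auto simp: filterlim_at eventually_at_filter intro!: tendsto_eq_intros)
    from filterlim_compose[OF f0 this]
    show "((\<lambda>r. (?f (- r) - ?f 0) / (- r)) \<longlongrightarrow> D2v 0 e e) (at_right 0)" .
  qed
  \<comment> \<open>The coefficient of \<open>?Q\<close> combines \<open>\<psi>'/\<psi>\<close> from
    the radial part with \<open>r / \<psi>^2\<close> from the sphere. It tends to
    \<open>1 * 1 - 1^2 = 0\<close>, so convergence of \<open>?Q\<close> is enough to remove the
    first-order terms.\<close>
  have L: "((\<lambda>r. ?A r + (r / \<psi> r)\<^sup>2 * ?B r + ?n * ((r / \<psi> r) * deriv \<psi> r - (r / \<psi> r)\<^sup>2) * ?Q r) \<longlongrightarrow>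
      (D2v 0 e e + D2v 0 e e) + 1\<^sup>2 * (\<Sum>b\<in>Basis - {e}. D2v 0 b b + D2v 0 b b) +
      ?n * (1 * 1 - 1\<^sup>2) * (D2v 0 e e + D2v 0 e e)) (at_right 0)"
    by (intro tendsto_intros lim inv \<psi>' Q)
  have eq: "eventually (\<lambda>r. ?A r + (r / \<psi> r)\<^sup>2 * ?B r + ?n * ((r / \<psi> r) * deriv \<psi> r - (r / \<psi> r)\<^sup>2) * ?Q r =
     polar_laplacian \<psi> v (r *\<^sub>R e) + polar_laplacian \<psi> v (r *\<^sub>R (- e))) (at_right 0)"
    unfolding eventually_at_right_field
  proof (intro exI conjI allI impI)
    fix r assume r: "0 < r" "r < \<rho>"
    have Q: "?Q r = (Dv (r *\<^sub>R e) e + Dv (r *\<^sub>R (- e)) (- e)) / r"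
      using r by (simp add: blinfun.minus_right field_simps)
    \<comment> \<open>If \<open>\<psi> r = 0\<close>, division by zero reduces both sides to
      \<open>?A r\<close>.\<close>
    have "?A r + (r / \<psi> r)\<^sup>2 * ?B r + ?n * ((r / \<psi> r) * deriv \<psi> r - (r / \<psi> r)\<^sup>2) * ?Q r =
      ?A r + r\<^sup>2 * ?B r / (\<psi> r)\<^sup>2 + ?n * (deriv \<psi> r / \<psi> r) * (Dv (r *\<^sub>R e) e + Dv (r *\<^sub>R (- e)) (- e))
       - ?n * r * (Dv (r *\<^sub>R e) e + Dv (r *\<^sub>R (- e)) (- e)) / (\<psi> r)\<^sup>2"
      unfolding Q using r by (cases "\<psi> r = 0") (simp_all add: power2_eq_square field_simps)
    also have "\<dots> = polar_laplacian \<psi> v (r *\<^sub>R e) + polar_laplacian \<psi> v (r *\<^sub>R (- e))"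
      unfolding polar_laplacian_axis[OF e disjI1[OF refl] r] polar_laplacian_axis[OF e disjI2[OF refl] r]
        sum.distrib by (simp only: add_divide_distrib diff_divide_distrib distrib_left distrib_right)
    finally show "?A r + (r / \<psi> r)\<^sup>2 * ?B r + ?n * ((r / \<psi> r) * deriv \<psi> r - (r / \<psi> r)\<^sup>2) * ?Q r =
     polar_laplacian \<psi> v (r *\<^sub>R e) + polar_laplacian \<psi> v (r *\<^sub>R (- e))" .
  qed (rule \<rho>)
  have "(\<Sum>b\<in>Basis. D2v 0 b b) = D2v 0 e e + (\<Sum>b\<in>Basis - {e}. D2v 0 b b)"
    using e by (simp add: sum.remove)
  then show ?thesis
    using Lim_transform_eventually[OF L eq] by (simp add: sum.distrib sum_distrib_left)
qed

end

text \<open>The one-sided difference quotient of \<open>\<psi>\<close> at 0 is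
  \<open>\<psi> r / r\<close>. For the second limit, \<open>\<psi>'\<close> is continuous at 0
  because it is differentiable there, and it coincides with \<open>deriv \<psi>\<close> in the
  interior of the interval.\<close>

lemma warping_function_limits:
  assumes "warping_function \<psi> R" "0 < R"
  shows "((\<lambda>r. \<psi> r / r) \<longlongrightarrow> 1) (at_right 0)" "((\<lambda>r. deriv \<psi> r) \<longlongrightarrow> 1) (at_right 0)"
proof -
  obtain \<psi>' \<psi>'' where \<psi>: "\<psi> 0 = 0" "\<psi>' 0 = 1"
    and d1: "\<And>r. r \<in> {0..<R} \<Longrightarrow> (\<psi> has_real_derivative \<psi>' r) (at r within {0..<R})"
    and d2: "\<And>r. r \<in> {0..<R} \<Longrightarrow> (\<psi>' has_real_derivative \<psi>'' r) (at r within {0..<R})"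
    using assms unfolding warping_function_def by blast
  have w: "at 0 within {0..<R} = at_right 0"
    using assms(2) by (intro at_within_nhd[of _ "{-1<..<R}"]) auto
  show "((\<lambda>r. \<psi> r / r) \<longlongrightarrow> 1) (at_right 0)"
    using d1[of 0] assms(2) unfolding has_field_derivative_iff w by (simp add: \<psi>)
  have "(\<psi>' \<longlongrightarrow> \<psi>' 0) (at 0 within {0..<R})"
    using DERIV_continuous[OF d2[of 0]] assms(2) by (simp add: continuous_within)
  then have "(\<psi>' \<longlongrightarrow> 1) (at_right 0)" by (simp add: w \<psi>)
  moreover have "eventually (\<lambda>r. \<psi>' r = deriv \<psi> r) (at_right 0)"
    unfolding eventually_at_right_field
  proof (intro exI conjI allI impI)
    fix r assume "0 < r" "r < R"
    then have "at r within {0..<R} = at r"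
      by (intro at_within_nhd[of _ "{0<..<R}"]) auto
    then show "\<psi>' r = deriv \<psi> r"
      using d1[of r] \<open>0 < r\<close> \<open>r < R\<close> by (simp add: DERIV_imp_deriv)
  qed (rule assms(2))
  ultimately show "((\<lambda>r. deriv \<psi> r) \<longlongrightarrow> 1) (at_right 0)"
    by (rule Lim_transform_eventually)
qed

section \<open>Symmetry of the geodesic distance\<close>

text \<open>Stated without measurability, because the speed of a curve (an arbitrary choice of chart
  at each time) is not known to be measurable.\<close>

lemma nn_integral_lborel_reflect_le:
  fixes f :: "real \<Rightarrow> ennreal"
  shows "(\<integral>\<^sup>+x. f x \<partial>lborel) \<le> (\<integral>\<^sup>+x. f (1 - x) \<partial>lborel)"
  unfolding nn_integral_def[of lborel f]
proof (rule SUP_least)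
  \<comment> \<open>The integral is a supremum over simple functions below \<open>f\<close>. Each of
    these is measurable, so the substitution is legitimate for it even when \<open>f\<close> is not
    measurable.\<close>
  fix g assume "g \<in> {g. simple_function lborel g \<and> g \<le> f}"
  then have g: "simple_function lborel g" "g \<le> f" by auto
  have [measurable]: "g \<in> borel_measurable borel"
    using borel_measurable_simple_function[OF g(1)] by simp
  have "integral\<^sup>S lborel g = (\<integral>\<^sup>+x. g x \<partial>lborel)"
    using g(1) by (rule nn_integral_eq_simple_integral[symmetric])
  also have "\<dots> = (\<integral>\<^sup>+x. g (1 - x) \<partial>lborel)"
    by (subst nn_integral_real_affine[where c="-1" and t=1]) auto
  also have "\<dots> \<le> (\<integral>\<^sup>+x. f (1 - x) \<partial>lborel)"
    by (rule nn_integral_mono) (use g(2) in \<open>auto simp: le_fun_def\<close>)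
  finally show "integral\<^sup>S lborel g \<le> (\<integral>\<^sup>+x. f (1 - x) \<partial>lborel)" .
qed

lemma has_vector_derivative_reflect_iff:
  "((\<lambda>s. f (1 - s)) has_vector_derivative v) (at t) \<longleftrightarrow>
   (f has_vector_derivative - v) (at (1 - t :: real))"
proof -
  have *: "((\<lambda>s. f (1 - s)) has_vector_derivative - v) (at t)"
    if "(f has_vector_derivative v) (at (1 - t))" for f :: "real \<Rightarrow> 'a" and t v
  proof -
    have "((\<lambda>s::real. 1 - s) has_vector_derivative -1) (at t)"
      by (auto intro!: derivative_eq_intros)
    from vector_diff_chain_at[OF this that] show ?thesis by (simp add: o_def)
  qed
  from *[of f "- v" t] *[of "\<lambda>s. f (1 - s)" v "1 - t"] show ?thesis by auto
qed

lemma vector_derivative_reflect: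
  assumes "f differentiable (at (1 - t :: real))"
  shows "vector_derivative (\<lambda>s. f (1 - s)) (at t) = - vector_derivative f (at (1 - t))"
  using assms
  by (intro vector_derivative_at)
     (simp add: has_vector_derivative_reflect_iff vector_derivative_works)

lemma piecewise_C1_curve_reflect:
  assumes "piecewise_C1_curve M \<gamma>"
  shows "piecewise_C1_curve M (\<lambda>s. \<gamma> (1 - s))"
proof -
  obtain S where S: "continuous_on {0..1} \<gamma>" "finite S"
    "\<And>\<kappa>. \<kappa> \<in> atlas M \<Longrightarrow> (chart_map \<kappa> \<circ> \<gamma>) C1_differentiable_on (({0<..<1} - S) \<inter> \<gamma> -` chart_dom \<kappa>)"
    using assms unfolding piecewise_C1_curve_def by blast
  have "continuous_on {0..1} (\<lambda>s. \<gamma> (1 - s))"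
    by (rule continuous_on_compose2[OF S(1)]) (auto intro!: continuous_intros)
  moreover have "(chart_map \<kappa> \<circ> (\<lambda>s. \<gamma> (1 - s))) C1_differentiable_on
      (({0<..<1} - (\<lambda>s. 1 - s) ` S) \<inter> (\<lambda>s. \<gamma> (1 - s)) -` chart_dom \<kappa>)" if \<kappa>: "\<kappa> \<in> atlas M" for \<kappa>
  proof -
    let ?A = "({0<..<1} - S) \<inter> \<gamma> -` chart_dom \<kappa>"
    let ?B = "({0<..<1} - (\<lambda>s. 1 - s) ` S) \<inter> (\<lambda>s. \<gamma> (1 - s)) -` chart_dom \<kappa>"
    obtain D where D: "\<And>x. x \<in> ?A \<Longrightarrow> ((chart_map \<kappa> \<circ> \<gamma>) has_vector_derivative D x) (at x)" "continuous_on ?A D"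
      using S(3)[OF \<kappa>] unfolding C1_differentiable_on_def by metis
    have AB: "1 - x \<in> ?A" if "x \<in> ?B" for x
      using that by (auto simp: image_iff)
    show ?thesis
      unfolding C1_differentiable_on_def
    proof (intro exI conjI ballI)
      show "((chart_map \<kappa> \<circ> (\<lambda>s. \<gamma> (1 - s))) has_vector_derivative - D (1 - x)) (at x)" if "x \<in> ?B" for x
        using D(1)[OF AB[OF that]] has_vector_derivative_reflect_iff[of "chart_map \<kappa> \<circ> \<gamma>" "- D (1 - x)" x]
        by (simp add: o_def)
      show "continuous_on ?B (\<lambda>x. - D (1 - x))"
        by (intro continuous_intros continuous_on_compose2[OF D(2)]) (use AB in auto)
    qed
  qed
  ultimately show ?thesis
    unfolding piecewise_C1_curve_def using \<open>finite S\<close> by blast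
qed

text \<open>The chart chosen by \<open>SOME\<close> depends only on the point, hence is the same for
  both curves at corresponding times. The velocities there are opposite, which the bilinear metric
  does not see. The exceptional times form a finite set.\<close>

lemma curve_length_reflect_le:
  assumes M: "riemannian_manifold M" and \<gamma>: "piecewise_C1_curve M \<gamma>"
  shows "curve_length M (\<lambda>s. \<gamma> (1 - s)) \<le> curve_length M \<gamma>"
proof -
  obtain S where S: "finite S"
    "\<And>\<kappa>. \<kappa> \<in> atlas M \<Longrightarrow> (chart_map \<kappa> \<circ> \<gamma>) C1_differentiable_on (({0<..<1} - S) \<inter> \<gamma> -` chart_dom \<kappa>)"
    using \<gamma> unfolding piecewise_C1_curve_def by blast
  have speed: "curve_speed M (\<lambda>s. \<gamma> (1 - s)) (1 - t) = curve_speed M \<gamma> t" if t: "t \<in> {0<..<1} - S" for t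
  proof -
    define \<kappa> where "\<kappa> = (SOME \<kappa>. \<kappa> \<in> atlas M \<and> \<gamma> t \<in> chart_dom \<kappa>)"
    have "\<exists>\<kappa>. \<kappa> \<in> atlas M \<and> \<gamma> t \<in> chart_dom \<kappa>"
      using M unfolding riemannian_manifold_def by blast
    then have \<kappa>: "\<kappa> \<in> atlas M" "\<gamma> t \<in> chart_dom \<kappa>"
      unfolding \<kappa>_def by (metis (mono_tags, lifting) someI_ex)+
    have "(chart_map \<kappa> \<circ> \<gamma>) differentiable (at t)"
      using S(2)[OF \<kappa>(1)] t \<kappa>(2) by (auto simp: C1_differentiable_on_eq)
    then have "vector_derivative (chart_map \<kappa> \<circ> (\<lambda>s. \<gamma> (1 - s))) (at (1 - t)) =
        - vector_derivative (chart_map \<kappa> \<circ> \<gamma>) (at t)"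
      using vector_derivative_reflect[of "chart_map \<kappa> \<circ> \<gamma>" "1 - t"] by (simp add: o_def)
    moreover have "bilinear (metric M \<kappa> (\<gamma> t))"
      using M \<kappa> unfolding riemannian_manifold_def by blast
    ultimately show ?thesis
      unfolding curve_speed_def Let_def
      by (simp add: \<kappa>_def[symmetric] bilinear_lneg bilinear_rneg)
  qed
  have "curve_length M (\<lambda>s. \<gamma> (1 - s)) \<le>
      (\<integral>\<^sup>+t. ennreal (curve_speed M (\<lambda>s. \<gamma> (1 - s)) (1 - t)) * indicator {0..1} (1 - t) \<partial>lborel)"
    unfolding curve_length_def by (rule nn_integral_lborel_reflect_le)
  also have "\<dots> = (\<integral>\<^sup>+t. ennreal (curve_speed M \<gamma> t) * indicator {0..1} t \<partial>lborel)"
  proof (intro nn_integral_cong_AE AE_I'[of "insert 0 (insert 1 S)"])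
    show "insert 0 (insert 1 S) \<in> null_sets lborel"
      using S(1) by (intro finite_imp_null_set_lborel) auto
    show "{t \<in> space lborel. ennreal (curve_speed M (\<lambda>s. \<gamma> (1 - s)) (1 - t)) * indicator {0..1} (1 - t) \<noteq>
        ennreal (curve_speed M \<gamma> t) * indicator {0..1} t} \<subseteq> insert 0 (insert 1 S)"
    proof (rule subsetI, rule ccontr)
      fix t assume "t \<in> {t \<in> space lborel. ennreal (curve_speed M (\<lambda>s. \<gamma> (1 - s)) (1 - t)) * indicator {0..1} (1 - t) \<noteq>
        ennreal (curve_speed M \<gamma> t) * indicator {0..1} t}" "t \<notin> insert 0 (insert 1 S)"
      then show False
        using speed[of t] by (cases "t \<in> {0<..<1}") (auto simp: indicator_def)
    qed
  qed
  also have "\<dots> = curve_length M \<gamma>"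
    unfolding curve_length_def ..
  finally show ?thesis .
qed

text \<open>The normalization of \<open>J\<close> has the center as second argument of
  \<open>geodist\<close>, whereas polar coordinates and \<open>nonlocal_operator\<close> have it as
  first. Reversing curves gives one inequality for all pairs of points, hence equality.\<close>

lemma geodist_commute:
  assumes M: "riemannian_manifold M"
  shows "geodist M x y = geodist M y x"
proof -
  have "(INF \<gamma>\<in>{\<gamma>. piecewise_C1_curve M \<gamma> \<and> \<gamma> 0 = x \<and> \<gamma> 1 = y}. curve_length M \<gamma>) \<le>
      (INF \<gamma>\<in>{\<gamma>. piecewise_C1_curve M \<gamma> \<and> \<gamma> 0 = y \<and> \<gamma> 1 = x}. curve_length M \<gamma>)" for x y
  proof (rule INF_greatest)
    fix \<gamma> assume "\<gamma> \<in> {\<gamma>. piecewise_C1_curve M \<gamma> \<and> \<gamma> 0 = y \<and> \<gamma> 1 = x}"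
    then show "(INF \<gamma>\<in>{\<gamma>. piecewise_C1_curve M \<gamma> \<and> \<gamma> 0 = x \<and> \<gamma> 1 = y}. curve_length M \<gamma>) \<le> curve_length M \<gamma>"
      by (intro INF_lower2[of "\<lambda>s. \<gamma> (1 - s)"] curve_length_reflect_le M)
         (auto intro: piecewise_C1_curve_reflect)
  qed
  then show ?thesis
    unfolding geodist_def by (metis (no_types, lifting) antisym)
qed

lemma geodist_nonneg: "0 \<le> geodist M x y"
  by (simp add: geodist_def)

section \<open>Integration over geodesic balls\<close>

text \<open>The density of \<open>\<mu>\<close> with respect to Lebesgue measure in the coordinate
  \<open>z = r \<theta>\<close>. At \<open>z = 0\<close> the quotient is 0 by convention, so
  closeness to 1 is always stated for \<open>z \<noteq> 0\<close>.\<close>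

definition polar_density :: "(real \<Rightarrow> real) \<Rightarrow> real \<Rightarrow> 'e::euclidean_space \<Rightarrow> real" where
  "polar_density \<psi> R z = indicator (ball 0 R) z * (\<psi> (norm z) / norm z) ^ (DIM('e) - 1)"

lemma warping_function_continuous_on: "warping_function \<psi> R \<Longrightarrow> continuous_on {0..<R} \<psi>"
  unfolding warping_function_def by (meson DERIV_continuous_on)

lemma polar_density_measurable [measurable]:
  assumes "warping_function \<psi> R"
  shows "polar_density \<psi> R \<in> borel_measurable (borel :: 'e::euclidean_space measure)"
proof -
  have *: "(\<lambda>z::'e. indicator (ball 0 R) z *\<^sub>R \<psi> (norm z)) \<in> borel_measurable borel"
    by (intro borel_measurable_continuous_on_indicator
          continuous_on_compose2[OF warping_function_continuous_on[OF assms]] continuous_intros) auto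
  \<comment> \<open>\<open>\<psi>\<close> is known to be continuous only on \<open>{0..<R}\<close>;
    the indicator is repeated next to it so that this factor is measurable on the whole
    space.\<close>
  have "polar_density \<psi> R = (\<lambda>z::'e. indicator (ball 0 R) z *
      ((indicator (ball 0 R) z *\<^sub>R \<psi> (norm z)) / norm z) ^ (DIM('e) - 1))"
    by (auto simp: polar_density_def fun_eq_iff indicator_def)
  also have "\<dots> \<in> borel_measurable borel"
    by (intro borel_measurable_times borel_measurable_power borel_measurable_divide
          borel_measurable_indicator borel_measurable_norm * measurable_ident) auto
  finally show ?thesis .
qed

lemma polar_density_nonneg:
  assumes "warping_function \<psi> R"
  shows "0 \<le> polar_density \<psi> R z"
proof (cases "z \<noteq> 0 \<and> norm z < R")
  case True
  then have "0 < \<psi> (norm z)" using assms by (auto simp: warping_function_def)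
  then show ?thesis by (auto simp: polar_density_def)
next
  case False
  then show ?thesis by (auto simp: polar_density_def)
qed

context
  fixes M :: "('m::{t2_space,second_countable_topology}, 'e::euclidean_space) riemannian_structure"
    and \<psi> R c \<Phi> and \<mu> :: "'m measure"
  assumes warping: "warping_function \<psi> R"
    and polar: "polar_coordinates M \<psi> R c \<Phi>"
    and volume: "polar_volume M \<psi> R \<mu>"
begin

text \<open>The iterated integral in \<open>polar_volume\<close> becomes a Lebesgue integral by
  \<open>nn_integral_polar\<close>. Since \<open>distr\<close> wants a map on the whole space,
  \<open>\<Phi>\<close> is continued by the constant \<open>c\<close>, where the density vanishes
  anyway.\<close>

lemma polar_volume_eq_distr:
  "density \<mu> (\<lambda>y. ennreal (indicator (geodesic_ball M c R) y)) =
    distr (density lborel (\<lambda>z. ennreal (polar_density \<psi> R z))) borel (\<lambda>z. if z \<in> ball 0 R then \<Phi> z else c)"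
    (is "?L = distr ?D borel ?\<Phi>")
proof (rule measure_eqI)
  let ?B = "geodesic_ball M c R"
  note [measurable] = polar_density_measurable[OF warping]
  have sets: "sets \<mu> = sets borel"
    using volume by (simp add: polar_volume_def)
  then show "sets ?L = sets (distr ?D borel ?\<Phi>)" by simp
  have "open ?B" using polar by (simp add: polar_coordinates_def)
  then have B: "?B \<in> sets \<mu>" by (simp add: sets)
  obtain \<Psi> where hom: "homeomorphism (ball 0 R) ?B \<Phi> \<Psi>"
    using polar by (auto simp: polar_coordinates_def)
  have \<Phi> [measurable]: "?\<Phi> \<in> borel_measurable borel"
    using homeomorphism_cont1[OF hom]
    by (intro borel_measurable_continuous_on_if) auto
  have \<Phi>D: "?\<Phi> \<in> measurable ?D borel"
    using \<Phi> by (rule measurable_cong_sets[THEN equalityD2, THEN subsetD, rotated 2]) simp_all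
  fix A assume "A \<in> sets ?L"
  then have A: "A \<in> sets \<mu>" by simp
  then have [measurable]: "A \<in> sets borel" by (simp add: sets)
  let ?h = "\<lambda>z::'e. ennreal (polar_density \<psi> R z) * indicator A (?\<Phi> z)"
  have "emeasure ?L A = (\<integral>\<^sup>+y. indicator (A \<inter> ?B) y \<partial>\<mu>)"
    using A B by (auto simp: emeasure_density ennreal_indicator indicator_def intro!: nn_integral_cong)
  also have "\<dots> = emeasure \<mu> (A \<inter> ?B)"
    using A B by simp
  also have "\<dots> = (\<integral>\<^sup>+\<theta>. (\<integral>\<^sup>+r\<in>{0<..<R}. indicator (A \<inter> ?B) (\<Phi> (r *\<^sub>R \<theta>)) * ennreal (\<psi> r ^ (DIM('e) - 1)) \<partial>lborel)
             \<partial>(sphere_measure :: 'e measure))"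
    using volume polar A B sets by (auto simp: polar_volume_def)
  also have "\<dots> = (\<integral>\<^sup>+\<theta>. (\<integral>\<^sup>+r\<in>{0<..}. ?h (r *\<^sub>R \<theta>) * ennreal (r ^ (DIM('e) - 1)) \<partial>lborel) \<partial>sphere_measure)"
  proof (rule nn_integral_cong_AE)
    have "(\<integral>\<^sup>+r\<in>{0<..<R}. indicator (A \<inter> ?B) (\<Phi> (r *\<^sub>R \<theta>)) * ennreal (\<psi> r ^ (DIM('e) - 1)) \<partial>lborel) =
      (\<integral>\<^sup>+r\<in>{0<..}. ?h (r *\<^sub>R \<theta>) * ennreal (r ^ (DIM('e) - 1)) \<partial>lborel)" if "norm \<theta> = 1" for \<theta> :: 'e
    proof (rule nn_integral_cong)
      fix r :: real
      show "indicator (A \<inter> ?B) (\<Phi> (r *\<^sub>R \<theta>)) * ennreal (\<psi> r ^ (DIM('e) - 1)) * indicator {0<..<R} r =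
        ?h (r *\<^sub>R \<theta>) * ennreal (r ^ (DIM('e) - 1)) * indicator {0<..} r"
      proof (cases "0 < r \<and> r < R")
        case True
        then have "r *\<^sub>R \<theta> \<in> ball 0 R" using that by simp
        then have "\<Phi> (r *\<^sub>R \<theta>) \<in> ?B" using hom by (auto simp: homeomorphism_def)
        have "0 < \<psi> r" using warping True by (auto simp: warping_function_def)
        have "(\<psi> r / r) ^ (DIM('e) - 1) * r ^ (DIM('e) - 1) = \<psi> r ^ (DIM('e) - 1)"
          using True by (simp add: power_divide)
        moreover have "polar_density \<psi> R (r *\<^sub>R \<theta>) = (\<psi> r / r) ^ (DIM('e) - 1)"
          using True that by (simp add: polar_density_def)
        ultimately have "ennreal (polar_density \<psi> R (r *\<^sub>R \<theta>)) * ennreal (r ^ (DIM('e) - 1)) = ennreal (\<psi> r ^ (DIM('e) - 1))"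
          using True \<open>0 < \<psi> r\<close> by (simp flip: ennreal_mult')
        then show ?thesis
          using True \<open>\<Phi> (r *\<^sub>R \<theta>) \<in> ?B\<close> \<open>r *\<^sub>R \<theta> \<in> ball 0 R\<close>
          by (simp add: indicator_def mult.commute)
      next
        case False
        then show ?thesis using that by (auto simp: polar_density_def)
      qed
    qed
    then show "AE \<theta> in sphere_measure. (\<integral>\<^sup>+r\<in>{0<..<R}. indicator (A \<inter> ?B) (\<Phi> (r *\<^sub>R \<theta>)) * ennreal (\<psi> r ^ (DIM('e) - 1)) \<partial>lborel) =
      (\<integral>\<^sup>+r\<in>{0<..}. ?h (r *\<^sub>R \<theta>) * ennreal (r ^ (DIM('e) - 1)) \<partial>lborel)"
      using AE_sphere_measure_norm by (auto elim: eventually_mono)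
  qed
  also have "\<dots> = (\<integral>\<^sup>+z. ?h z \<partial>lborel)"
    by (rule nn_integral_polar) measurable
  also have "\<dots> = (\<integral>\<^sup>+z. ennreal (polar_density \<psi> R z) * indicator (?\<Phi> -` A) z \<partial>lborel)"
    by (simp add: indicator_def)
  also have "\<dots> = emeasure ?D (?\<Phi> -` A)"
    using measurable_sets[OF \<Phi> \<open>A \<in> sets borel\<close>]
    by (intro emeasure_density[symmetric]) (simp_all only: space_borel Int_UNIV_right sets_lborel, measurable)
  also have "\<dots> = emeasure (distr ?D borel ?\<Phi>) A"
    using emeasure_distr[OF \<Phi>D, of A] by simp
  finally show "emeasure ?L A = emeasure (distr ?D borel ?\<Phi>) A" .
qed

text \<open>Measurability is asked of the coordinate expression, which for kernels built from
  \<open>J\<close> and \<open>geodist\<close> can be checked. Composition with the inverse chart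
  \<open>\<Psi>\<close> transfers it to \<open>F\<close> itself.\<close>

lemma
  fixes F :: "'m \<Rightarrow> real"
  assumes meas: "(\<lambda>z. indicator (ball 0 R) z * F (\<Phi> z)) \<in> borel_measurable borel"
    and zero: "\<And>y. y \<notin> geodesic_ball M c R \<Longrightarrow> F y = 0"
  shows integrable_polar_volume_iff:
      "integrable \<mu> F \<longleftrightarrow> integrable lborel (\<lambda>z. polar_density \<psi> R z * F (\<Phi> z))"
    and integral_polar_volume:
      "(\<integral>y. F y \<partial>\<mu>) = (\<integral>z. polar_density \<psi> R z * F (\<Phi> z) \<partial>lborel)"
proof -
  let ?B = "geodesic_ball M c R"
  let ?\<Phi> = "\<lambda>z. if z \<in> ball 0 R then \<Phi> z else c"
  note [measurable] = polar_density_measurable[OF warping] meas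
  have sets: "sets \<mu> = sets borel"
    using volume by (simp add: polar_volume_def)
  have "open ?B" using polar by (simp add: polar_coordinates_def)
  then have B: "?B \<in> sets \<mu>" "?B \<in> sets borel" by (simp_all add: sets)
  obtain \<Psi> where hom: "homeomorphism (ball 0 R) ?B \<Phi> \<Psi>"
    using polar by (auto simp: polar_coordinates_def)
  have \<Phi> [measurable]: "?\<Phi> \<in> borel_measurable borel"
    using homeomorphism_cont1[OF hom]
    by (intro borel_measurable_continuous_on_if) auto
  have \<Phi>D: "?\<Phi> \<in> measurable (density lborel (\<lambda>z. ennreal (polar_density \<psi> R z))) borel"
    using \<Phi> by (rule measurable_cong_sets[THEN equalityD2, THEN subsetD, rotated 2]) simp_all
  have \<Psi>: "(\<lambda>y. if y \<in> ?B then \<Psi> y else 0) \<in> borel_measurable borel"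
    using homeomorphism_cont2[OF hom] B
    by (intro borel_measurable_continuous_on_if) auto
  have "F = (\<lambda>y. indicator ?B y * (indicator (ball 0 R) (if y \<in> ?B then \<Psi> y else 0) *
      F (\<Phi> (if y \<in> ?B then \<Psi> y else 0))))"
    using zero hom by (auto simp: fun_eq_iff indicator_def homeomorphism_def)
  also have "\<dots> \<in> borel_measurable borel"
    by (rule borel_measurable_times[OF borel_measurable_indicator[OF B(2)] measurable_compose[OF \<Psi> meas]])
  finally have F [measurable]: "F \<in> borel_measurable borel" .
  have F\<Phi>: "(\<lambda>z. F (?\<Phi> z)) \<in> borel_measurable lborel"
    using measurable_compose[OF \<Phi> F] by (simp only: measurable_lborel2)
  have F\<mu>: "F \<in> borel_measurable \<mu>" using F by (simp add: measurable_cong_sets[OF sets])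
  have ind: "indicator ?B y *\<^sub>R F y = F y" for y
    using zero[of y] by (auto simp: indicator_def)
  have dens: "polar_density \<psi> R z *\<^sub>R F (?\<Phi> z) = polar_density \<psi> R z * F (\<Phi> z)" for z
    by (simp add: polar_density_def)
  have "integrable \<mu> F \<longleftrightarrow> integrable (density \<mu> (\<lambda>y. ennreal (indicator ?B y))) F"
    using B F\<mu> by (subst integrable_density) (auto simp del: real_scaleR_def simp: ind)
  also have "\<dots> \<longleftrightarrow> integrable (density lborel (\<lambda>z. ennreal (polar_density \<psi> R z))) (\<lambda>z. F (?\<Phi> z))"
    unfolding polar_volume_eq_distr by (rule integrable_distr_eq[OF \<Phi>D F])
  also have "\<dots> \<longleftrightarrow> integrable lborel (\<lambda>z. polar_density \<psi> R z *\<^sub>R F (?\<Phi> z))"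
    by (rule integrable_density[OF F\<Phi>]) (auto simp: polar_density_nonneg[OF warping])
  finally show "integrable \<mu> F \<longleftrightarrow> integrable lborel (\<lambda>z. polar_density \<psi> R z * F (\<Phi> z))"
    unfolding dens .
  have "integral\<^sup>L \<mu> F = integral\<^sup>L (density \<mu> (\<lambda>y. ennreal (indicator ?B y))) F"
    using B F\<mu> by (subst integral_density) (auto simp del: real_scaleR_def simp: ind)
  also have "\<dots> = (\<integral>z. F (?\<Phi> z) \<partial>density lborel (\<lambda>z. ennreal (polar_density \<psi> R z)))"
    unfolding polar_volume_eq_distr by (rule integral_distr[OF \<Phi>D F])
  also have "\<dots> = (\<integral>z. polar_density \<psi> R z *\<^sub>R F (?\<Phi> z) \<partial>lborel)"
    by (rule integral_density[OF F\<Phi>]) (auto simp: polar_density_nonneg[OF warping])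
  finally show "(\<integral>y. F y \<partial>\<mu>) = (\<integral>z. polar_density \<psi> R z * F (\<Phi> z) \<partial>lborel)"
    unfolding dens .
qed

end

section \<open>Consistency of the nonlocal operator\<close>

text \<open>This is \<open>\<psi>(r) / r --> 1\<close> raised to the power \<open>N - 1\<close>. No
  center enters, so one radius serves all points of the manifold.\<close>

lemma polar_density_near_0:
  assumes "warping_function \<psi> R" "0 < R" "0 < \<eta>"
  obtains r where "0 < r" "r \<le> R"
    "\<And>z::'e::euclidean_space. z \<noteq> 0 \<Longrightarrow> norm z < r \<Longrightarrow> \<bar>polar_density \<psi> R z - 1\<bar> < \<eta>"
proof -
  have "((\<lambda>r. (\<psi> r / r) ^ (DIM('e) - 1)) \<longlongrightarrow> 1 ^ (DIM('e) - 1)) (at_right 0)"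
    by (intro tendsto_power warping_function_limits(1)[OF assms(1,2)])
  then have "eventually (\<lambda>r. dist ((\<psi> r / r) ^ (DIM('e) - 1)) 1 < \<eta>) (at_right 0)"
    using assms(3) by (auto dest: tendstoD)
  then obtain s where s: "0 < s" "\<And>r. 0 < r \<Longrightarrow> r < s \<Longrightarrow> dist ((\<psi> r / r) ^ (DIM('e) - 1)) 1 < \<eta>"
    unfolding eventually_at_right_field by blast
  show thesis
  proof (rule that[of "min s R"])
    fix z :: 'e assume "z \<noteq> 0" "norm z < min s R"
    then show "\<bar>polar_density \<psi> R z - 1\<bar> < \<eta>"
      using s(2)[of "norm z"] by (simp add: polar_density_def dist_real_def)
  qed (use s assms in auto)
qed

section \<open>The kernel in polar coordinates: measurability, integrability, mass\<close>

locale radial_kernel =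
  fixes M :: "('m::{t2_space,second_countable_topology}, 'e::euclidean_space) riemannian_structure"
    and \<psi> :: "real \<Rightarrow> real" and R :: real and \<mu> :: "'m measure" and J :: "real \<Rightarrow> real"
  assumes manifold: "riemannian_manifold M"
    and symmetric: "spherically_symmetric M \<psi> R"
    and volume: "polar_volume M \<psi> R \<mu>"
    and J_nonneg: "\<And>r. 0 \<le> r \<Longrightarrow> 0 \<le> J r"
    and J_support: "\<And>r. 1 < r \<Longrightarrow> J r = 0"
    and J_moment: "integrable lborel (\<lambda>z::'e. J (norm z) * (norm z)\<^sup>2)"
    and J_normalized: "\<exists>c. integrable \<mu> (\<lambda>x. J (geodist M x c))"
begin

lemma R_pos: "0 < R" and warping: "warping_function \<psi> R"
  using symmetric by (auto simp: spherically_symmetric_def)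

lemma polar_coordinates_exist: obtains \<Phi> where "polar_coordinates M \<psi> R x \<Phi>"
  using symmetric unfolding spherically_symmetric_def by blast

text \<open>The integrability of the second moment makes \<open>J (norm z) * (norm z)^2\<close>
  measurable. Dividing by \<open>(norm z)^2\<close> recovers \<open>J (norm z)\<close> off the
  single point 0.\<close>

lemma J_norm_measurable [measurable]: "(\<lambda>z::'e. J (norm z)) \<in> borel_measurable borel"
proof -
  have [measurable]: "(\<lambda>z::'e. J (norm z) * (norm z)\<^sup>2) \<in> borel_measurable borel"
    using J_moment by (simp add: integrable_iff_bounded)
  have "(\<lambda>z::'e. J (norm z)) = (\<lambda>z. if z = 0 then J 0 else (J (norm z) * (norm z)\<^sup>2) / (norm z)\<^sup>2)"
    by (auto simp: fun_eq_iff)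
  also have "\<dots> \<in> borel_measurable borel" by measurable
  finally show ?thesis .
qed

lemma J_norm_scaled_measurable: "(\<lambda>z::'e. J (norm z / \<epsilon>)) \<in> borel_measurable borel" if "0 < \<epsilon>"
proof -
  have "(\<lambda>z::'e. J (norm z / \<epsilon>)) = (\<lambda>z. J (norm (z /\<^sub>R \<epsilon>)))"
    using that by (simp add: divide_inverse mult.commute)
  also have "\<dots> \<in> borel_measurable borel"
    by (rule measurable_compose[OF _ J_norm_measurable]) measurable
  finally show ?thesis .
qed

lemma geodist_polar:
  assumes "polar_coordinates M \<psi> R x \<Phi>" "z \<in> ball 0 R"
  shows "geodist M x (\<Phi> z) = norm z"
  using assms by (auto simp: polar_coordinates_def)

lemma kernel_measurable:
  assumes \<Phi>: "polar_coordinates M \<psi> R x \<Phi>" and g: "continuous_on UNIV g" and "0 < \<epsilon>"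
  shows "(\<lambda>z. indicator (ball 0 R) z * (J (geodist M x (\<Phi> z) / \<epsilon>) * g (\<Phi> z))) \<in> borel_measurable borel"
proof -
  obtain \<Psi> where hom: "homeomorphism (ball 0 R) (geodesic_ball M x R) \<Phi> \<Psi>"
    using \<Phi> by (auto simp: polar_coordinates_def)
  have 1: "(\<lambda>z. indicator (ball 0 R) z *\<^sub>R g (\<Phi> z)) \<in> borel_measurable borel"
    by (intro borel_measurable_continuous_on_indicator
         continuous_on_compose2[OF g homeomorphism_cont1[OF hom]]) auto
  have "(\<lambda>z. indicator (ball 0 R) z * (J (geodist M x (\<Phi> z) / \<epsilon>) * g (\<Phi> z))) =
    (\<lambda>z. J (norm z / \<epsilon>) * (indicator (ball 0 R) z *\<^sub>R g (\<Phi> z)))"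
    by (auto simp: fun_eq_iff indicator_def geodist_polar[OF \<Phi>])
  also have "\<dots> \<in> borel_measurable borel"
    by (intro borel_measurable_times 1 J_norm_scaled_measurable \<open>0 < \<epsilon>\<close>)
  finally show ?thesis .
qed

lemma kernel_eq_0: "0 < \<epsilon> \<Longrightarrow> \<epsilon> < R \<Longrightarrow> y \<notin> geodesic_ball M x R \<Longrightarrow> J (geodist M x y / \<epsilon>) = 0"
  by (intro J_support) (simp add: geodesic_ball_def field_simps)

text \<open>Near \<open>0\<close> this uses the normalization of \<open>J\<close>, away from \<open>0\<close> the finite second moment.\<close>

lemma J_norm_integrable: "integrable lborel (\<lambda>z::'e. J (norm z))"
proof -
  obtain c where int: "integrable \<mu> (\<lambda>x. J (geodist M x c))" using J_normalized by blast
  obtain \<Phi> where \<Phi>: "polar_coordinates M \<psi> R c \<Phi>" by (rule polar_coordinates_exist)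
  let ?B = "geodesic_ball M c R"
  have "open ?B" using \<Phi> by (simp add: polar_coordinates_def)
  then have B: "?B \<in> sets \<mu>"
    using volume by (simp add: polar_volume_def)
  have "integrable \<mu> (\<lambda>x. indicator ?B x *\<^sub>R J (geodist M x c))"
    using B int by (rule integrable_mult_indicator)
  then have "integrable \<mu> (\<lambda>x. indicator ?B x * J (geodist M c x))"
    by (simp add: geodist_commute[OF manifold, of _ c])
  then have "integrable lborel (\<lambda>z. polar_density \<psi> R z * (indicator ?B (\<Phi> z) * J (geodist M c (\<Phi> z))))"
  proof (subst (asm) integrable_polar_volume_iff[OF warping \<Phi> volume])
    have "\<Phi> z \<in> ?B" if "z \<in> ball 0 R" for z
      using geodist_polar[OF \<Phi> that] that by (simp add: geodesic_ball_def)
    then have "(\<lambda>z. indicator (ball 0 R) z * (indicator ?B (\<Phi> z) * J (geodist M c (\<Phi> z)))) =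
        (\<lambda>z. indicator (ball 0 R) z * (J (geodist M c (\<Phi> z) / 1) * 1))"
      by (auto simp: fun_eq_iff indicator_def)
    also have "\<dots> \<in> borel_measurable borel"
      by (rule kernel_measurable[OF \<Phi>]) auto
    finally show "(\<lambda>z. indicator (ball 0 R) z * (indicator ?B (\<Phi> z) * J (geodist M c (\<Phi> z)))) \<in> borel_measurable borel" .
  qed auto
  moreover have "polar_density \<psi> R z * (indicator ?B (\<Phi> z) * J (geodist M c (\<Phi> z))) = polar_density \<psi> R z * J (norm z)" for z
    using geodist_polar[OF \<Phi>, of z] by (auto simp: polar_density_def indicator_def geodesic_ball_def)
  ultimately have int1: "integrable lborel (\<lambda>z::'e. polar_density \<psi> R z * J (norm z))" by simp
  obtain r where r: "0 < r" "\<And>z::'e. z \<noteq> 0 \<Longrightarrow> norm z < r \<Longrightarrow> \<bar>polar_density \<psi> R z - 1\<bar> < 1 / 2"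
    using polar_density_near_0[OF warping R_pos, where \<eta>="1/2" and 'e='e] by auto
  \<comment> \<open>A dominating function for \<open>J (norm z)\<close>: inside radius
    \<open>r\<close> the density exceeds 1/2, so the first term suffices; outside,
    \<open>(norm z)^2 / r^2\<close> is at least 1, so the second does.\<close>
  have int2: "integrable lborel (\<lambda>z::'e. 2 * (polar_density \<psi> R z * J (norm z)) + J (norm z) * (norm z)\<^sup>2 / r\<^sup>2)"
    using int1 J_moment by (intro Bochner_Integration.integrable_add) auto
  show ?thesis
  proof (rule Bochner_Integration.integrable_bound[OF int2])
    have "norm (J (norm z)) \<le> norm (2 * (polar_density \<psi> R z * J (norm z)) + J (norm z) * (norm z)\<^sup>2 / r\<^sup>2)"
      if "z \<noteq> 0" for z :: 'e
    proof -
      have J: "0 \<le> J (norm z)" by (rule J_nonneg) simp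
      have p: "0 \<le> polar_density \<psi> R z" by (rule polar_density_nonneg[OF warping])
      have "J (norm z) \<le> 2 * (polar_density \<psi> R z * J (norm z)) + J (norm z) * (norm z)\<^sup>2 / r\<^sup>2"
      proof (cases "norm z < r")
        case True
        then have "1 \<le> 2 * polar_density \<psi> R z" using r(2)[OF that] by linarith
        then have "1 * J (norm z) \<le> (2 * polar_density \<psi> R z) * J (norm z)" using J by (rule mult_right_mono)
        moreover have "0 \<le> J (norm z) * (norm z)\<^sup>2 / r\<^sup>2" using J by simp
        ultimately show ?thesis by simp
      next
        case False
        then have "r\<^sup>2 \<le> (norm z)\<^sup>2" using r(1) by (intro power_mono) auto
        then have "1 \<le> (norm z)\<^sup>2 / r\<^sup>2" using r(1) by simp
        then have "J (norm z) * 1 \<le> J (norm z) * ((norm z)\<^sup>2 / r\<^sup>2)" using J by (rule mult_left_mono)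
        moreover have "0 \<le> polar_density \<psi> R z * J (norm z)" using J p by simp
        ultimately show ?thesis by simp
      qed
      then show ?thesis using J by simp
    qed
    then show "AE z::'e in lborel. norm (J (norm z)) \<le> norm (2 * (polar_density \<psi> R z * J (norm z)) + J (norm z) * (norm z)\<^sup>2 / r\<^sup>2)"
      by (intro AE_I'[of "{0}"]) (auto simp: null_sets_def)
  qed measurable
qed

lemma J_norm_scaled_integrable:
  assumes "0 < \<epsilon>"
  shows "integrable lborel (\<lambda>z::'e. J (norm z / \<epsilon>))"
proof -
  have "integrable lborel (\<lambda>z::'e. J (norm (inverse \<epsilon> *\<^sub>R z)))"
    using assms J_norm_integrable by (subst integrable_lborel_scaleR) auto
  then show ?thesis using assms by (simp add: divide_inverse mult.commute)
qed

text \<open>Where the kernel is nonzero, \<open>norm z \<le> \<epsilon> < r\<close>, so the density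
  is below 2 and \<open>2 * B * J (norm z / \<epsilon>)\<close> dominates the integrand.\<close>

lemma kernel_integrable:
  assumes r: "0 < r" "r \<le> R" "\<And>z::'e. z \<noteq> 0 \<Longrightarrow> norm z < r \<Longrightarrow> \<bar>polar_density \<psi> R z - 1\<bar> < 1"
    and \<epsilon>: "0 < \<epsilon>" "\<epsilon> < r"
    and g: "continuous_on UNIV g" "\<And>y. \<bar>g y\<bar> \<le> B"
  shows "integrable \<mu> (\<lambda>y. J (geodist M x y / \<epsilon>) * g y)"
proof -
  obtain \<Phi> where \<Phi>: "polar_coordinates M \<psi> R x \<Phi>" by (rule polar_coordinates_exist)
  note meas = kernel_measurable[OF \<Phi> g(1) \<epsilon>(1)]
  note [measurable] = polar_density_measurable[OF warping]
  have "integrable lborel (\<lambda>z. polar_density \<psi> R z * (J (geodist M x (\<Phi> z) / \<epsilon>) * g (\<Phi> z)))"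
  proof (rule Bochner_Integration.integrable_bound)
    show "integrable lborel (\<lambda>z::'e. 2 * B * J (norm z / \<epsilon>))"
      using J_norm_scaled_integrable[OF \<epsilon>(1)] by simp
    have "(\<lambda>z. polar_density \<psi> R z * (J (geodist M x (\<Phi> z) / \<epsilon>) * g (\<Phi> z))) =
      (\<lambda>z. polar_density \<psi> R z * (indicator (ball 0 R) z * (J (geodist M x (\<Phi> z) / \<epsilon>) * g (\<Phi> z))))"
      by (auto simp: polar_density_def indicator_def fun_eq_iff)
    also have "\<dots> \<in> borel_measurable lborel"
      using meas by simp
    finally show "(\<lambda>z. polar_density \<psi> R z * (J (geodist M x (\<Phi> z) / \<epsilon>) * g (\<Phi> z))) \<in> borel_measurable lborel" .
    have "norm (polar_density \<psi> R z * (J (geodist M x (\<Phi> z) / \<epsilon>) * g (\<Phi> z))) \<le> norm (2 * B * J (norm z / \<epsilon>))"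
      if "z \<noteq> 0" for z
    proof (cases "norm z < R")
      case False
      then show ?thesis by (simp add: polar_density_def)
    next
      case True
      have J: "0 \<le> J (norm z / \<epsilon>)" using \<epsilon> by (intro J_nonneg) auto
      have "0 \<le> B" using g(2)[of x] by linarith
      have "\<bar>polar_density \<psi> R z\<bar> * (J (norm z / \<epsilon>) * \<bar>g (\<Phi> z)\<bar>) \<le> 2 * (J (norm z / \<epsilon>) * B)"
      proof (cases "norm z < r")
        case True
        then have "\<bar>polar_density \<psi> R z\<bar> \<le> 2" using r(3)[OF that] by linarith
        then show ?thesis using J g(2) \<open>0 \<le> B\<close> by (intro mult_mono) auto
      next
        case False
        then have "J (norm z / \<epsilon>) = 0" using \<epsilon> by (intro J_support) (simp add: field_simps)
        then show ?thesis by simp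
      qed
      then show ?thesis
        using True J \<open>0 \<le> B\<close> by (simp add: geodist_polar[OF \<Phi>] abs_mult mult_ac)
    qed
    then show "AE z in lborel. norm (polar_density \<psi> R z * (J (geodist M x (\<Phi> z) / \<epsilon>) * g (\<Phi> z))) \<le> norm (2 * B * J (norm z / \<epsilon>))"
      by (intro AE_I'[of "{0}"]) (auto simp: null_sets_def)
  qed
  then show ?thesis
    using \<epsilon> r(2) by (subst integrable_polar_volume_iff[OF warping \<Phi> volume meas]) (auto simp: kernel_eq_0)
qed

text \<open>The point of the formula is that its right-hand side does not contain \<open>x\<close>:
  homogeneity in the form that the comparison principle uses.\<close>

lemma kernel_mass:
  assumes "0 < \<epsilon>" "\<epsilon> < R"
  shows "(\<integral>y. J (geodist M x y / \<epsilon>) \<partial>\<mu>) = (\<integral>z. polar_density \<psi> R z * J (norm (z::'e) / \<epsilon>) \<partial>lborel)"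
proof -
  obtain \<Phi> where \<Phi>: "polar_coordinates M \<psi> R x \<Phi>" by (rule polar_coordinates_exist)
  have "(\<integral>y. J (geodist M x y / \<epsilon>) \<partial>\<mu>) =
    (\<integral>z. polar_density \<psi> R z * J (geodist M x (\<Phi> z) / \<epsilon>) \<partial>lborel)"
    using kernel_measurable[OF \<Phi>, of "\<lambda>_. 1" \<epsilon>] assms
    by (intro integral_polar_volume[OF warping \<Phi> volume]) (auto simp: kernel_eq_0)
  also have "\<dots> = (\<integral>z. polar_density \<psi> R z * J (norm (z::'e) / \<epsilon>) \<partial>lborel)"
    by (intro Bochner_Integration.integral_cong refl)
       (auto simp: polar_density_def indicator_def geodist_polar[OF \<Phi>])
  finally show ?thesis .
qed

text \<open>The integral is pulled back to the ball and rescaled by \<open>z = \<epsilon> y\<close>;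
  the Jacobian cancels the prefactor \<open>1 / \<epsilon>^N\<close>.\<close>

lemma nonlocal_operator_polar:
  assumes \<Phi>: "polar_coordinates M \<psi> R x \<Phi>"
    and r: "0 < r" "r \<le> R" "\<And>z::'e. z \<noteq> 0 \<Longrightarrow> norm z < r \<Longrightarrow> \<bar>polar_density \<psi> R z - 1\<bar> < 1"
    and \<epsilon>: "0 < \<epsilon>" "\<epsilon> < r"
    and g: "continuous_on UNIV g" "\<And>y. \<bar>g y\<bar> \<le> B"
  defines "G \<equiv> (\<lambda>y. J (norm y) * polar_density \<psi> R (\<epsilon> *\<^sub>R y) * ((g (\<Phi> (\<epsilon> *\<^sub>R y)) - g x) / \<epsilon>\<^sup>2))"
  shows "integrable lborel G" "nonlocal_operator M \<mu> J \<epsilon> g x = (\<integral>y. G y \<partial>lborel)"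
proof -
  let ?g = "\<lambda>y. g y - g x"
  let ?N = "DIM('e)"
  have g': "continuous_on UNIV ?g" "\<And>y. \<bar>?g y\<bar> \<le> 2 * B"
    using g(1) apply (auto intro!: continuous_intros)[1]
    subgoal for y using g(2)[of x] g(2)[of y] by linarith
    done
  let ?F = "\<lambda>y. J (geodist M x y / \<epsilon>) * ?g y"
  let ?H = "\<lambda>z. polar_density \<psi> R z * ?F (\<Phi> z)"
  have meas: "(\<lambda>z. indicator (ball 0 R) z * ?F (\<Phi> z)) \<in> borel_measurable borel"
    by (rule kernel_measurable[OF \<Phi> g'(1) \<epsilon>(1)])
  have zero: "y \<notin> geodesic_ball M x R \<Longrightarrow> ?F y = 0" for y
    using \<epsilon> r(2) by (simp add: kernel_eq_0)
  have "integrable \<mu> ?F"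
    using kernel_integrable[OF r \<epsilon> g'] by simp
  then have H: "integrable lborel ?H"
    by (subst (asm) integrable_polar_volume_iff[OF warping \<Phi> volume meas zero])
  then have Hm: "?H \<in> borel_measurable borel" by (simp add: integrable_iff_bounded)
  have G: "G y = ?H (\<epsilon> *\<^sub>R y) / \<epsilon>\<^sup>2" for y
    using \<epsilon> geodist_polar[OF \<Phi>, of "\<epsilon> *\<^sub>R y"] by (auto simp: G_def polar_density_def indicator_def)
  show "integrable lborel G"
    unfolding G[abs_def] using integrable_lborel_scaleR[OF Hm, of \<epsilon>] H \<epsilon> by simp
  have "nonlocal_operator M \<mu> J \<epsilon> g x = 1 / \<epsilon>\<^sup>2 * (\<integral>y. 1 / \<epsilon> ^ ?N * ?F y \<partial>\<mu>)"
    by (simp add: nonlocal_operator_def mult_ac)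
  also have "\<dots> = 1 / \<epsilon>\<^sup>2 * (1 / \<epsilon> ^ ?N * (\<integral>y. ?F y \<partial>\<mu>))"
    by simp
  also have "(\<integral>y. ?F y \<partial>\<mu>) = (\<integral>z. ?H z \<partial>lborel)"
    by (rule integral_polar_volume[OF warping \<Phi> volume meas zero])
  also have "\<dots> = \<bar>\<epsilon>\<bar> ^ ?N * (\<integral>y. ?H (\<epsilon> *\<^sub>R y) \<partial>lborel)"
    using \<epsilon> by (intro integral_lborel_scaleR Hm) auto
  also have "1 / \<epsilon>\<^sup>2 * (1 / \<epsilon> ^ ?N * \<dots>) = (\<integral>y. ?H (\<epsilon> *\<^sub>R y) / \<epsilon>\<^sup>2 \<partial>lborel)"
    using \<epsilon> by simp
  finally show "nonlocal_operator M \<mu> J \<epsilon> g x = (\<integral>y. G y \<partial>lborel)"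
    by (simp add: G[abs_def])
qed

end

context radial_kernel
begin

lemma nonlocal_consistency:
  fixes g :: "'m \<Rightarrow> real" and Dv :: "'e \<Rightarrow> 'e \<Rightarrow>\<^sub>L real" and D2v :: "'e \<Rightarrow> 'e \<Rightarrow>\<^sub>L 'e \<Rightarrow>\<^sub>L real"
  assumes \<Phi>: "polar_coordinates M \<psi> R x \<Phi>"
    and D1: "\<And>z. z \<in> ball 0 \<rho> \<Longrightarrow> ((\<lambda>z. g (\<Phi> z)) has_derivative blinfun_apply (Dv z)) (at z)"
    and D2: "\<And>z. z \<in> ball 0 \<rho> \<Longrightarrow> (Dv has_derivative blinfun_apply (D2v z)) (at z)"
    and K: "norm (Dv 0) \<le> K" "norm (D2v 0) \<le> K" "0 \<le> \<alpha>"
    and holder: "\<And>z. z \<in> ball 0 \<rho> \<Longrightarrow> norm (D2v z - D2v 0) \<le> K * norm z powr \<alpha>"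
    and \<eta>: "0 < \<eta>" "\<eta> \<le> 1"
    and r: "0 < r" "r \<le> R" "\<And>z::'e. z \<noteq> 0 \<Longrightarrow> norm z < r \<Longrightarrow> \<bar>polar_density \<psi> R z - 1\<bar> < \<eta>"
    and \<epsilon>: "0 < \<epsilon>" "\<epsilon> < r" "\<epsilon> < \<rho>"
    and g: "continuous_on UNIV g" "\<And>y. \<bar>g y\<bar> \<le> B"
  defines "m \<equiv> (\<integral>z. J (norm (z::'e)) * (norm z)\<^sup>2 \<partial>lborel)"
  shows "\<bar>nonlocal_operator M \<mu> J \<epsilon> g x - m / (2 * DIM('e)) * (\<Sum>b\<in>Basis. D2v 0 b b)\<bar> \<le> K * (\<epsilon> powr \<alpha> + \<eta>) * m"
proof -
  have r1: "\<bar>polar_density \<psi> R z - 1\<bar> < 1" if "z \<noteq> 0" "norm z < r" for z :: 'e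
    using r(3)[OF that] \<eta> by linarith
  have "0 \<le> K" using K(1) norm_ge_zero order_trans by blast
  note G' = nonlocal_operator_polar[OF \<Phi> r(1,2) r1 \<epsilon>(1,2) g]
  define G where "G = (\<lambda>y. J (norm y) * polar_density \<psi> R (\<epsilon> *\<^sub>R y) * ((g (\<Phi> (\<epsilon> *\<^sub>R y)) - g x) / \<epsilon>\<^sup>2))"
  have G: "integrable lborel G" "nonlocal_operator M \<mu> J \<epsilon> g x = (\<integral>y. G y \<partial>lborel)"
    unfolding G_def using G' by blast+
  note [measurable] = polar_density_measurable[OF warping]
  \<comment> \<open>The density depends on \<open>norm z\<close> only; a fixed unit vector exhibits it as a function of the radius.\<close>
  define f where "f = (\<lambda>s. J s * polar_density \<psi> R ((\<epsilon> * s) *\<^sub>R (SOME b. b \<in> (Basis :: 'e set))))"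
  have some: "norm (SOME b. b \<in> (Basis :: 'e set)) = 1"
    using nonempty_Basis by (metis norm_Basis some_in_eq)
  have f: "f (norm y) = J (norm y) * polar_density \<psi> R (\<epsilon> *\<^sub>R y)" for y :: 'e
    using \<epsilon>(1) some by (simp add: f_def polar_density_def indicator_def abs_mult)
  have fm [measurable]: "(\<lambda>y::'e. f (norm y)) \<in> borel_measurable borel"
    unfolding f by measurable
  have dens: "\<bar>polar_density \<psi> R (\<epsilon> *\<^sub>R y) - 1\<bar> < \<eta>" if "y \<noteq> 0" "norm y \<le> 1" for y :: 'e
  proof (rule r(3))
    have "\<epsilon> * norm y \<le> \<epsilon>" using that \<epsilon>(1) by simp
    also have "\<dots> < r" by (rule \<epsilon>(2))
    finally show "norm (\<epsilon> *\<^sub>R y) < r" using \<epsilon>(1) by simp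
  qed (use that \<epsilon> in auto)
  \<comment> \<open>\<open>P\<close> keeps the polar density, because its factor
    \<open>1 / \<epsilon>\<close> leaves no room for an approximation. \<open>Q\<close> has the
    weight \<open>J\<close> alone, so that its integral is exact; the discrepancy
    \<open>?p - 1\<close> is charged to the error.\<close>
  define P where "P = (\<lambda>y. f (norm y) * (Dv 0 y / \<epsilon>))"
  define Q where "Q = (\<lambda>y. J (norm y) * (D2v 0 y y / 2))"
  have bil: "bilinear (\<lambda>y z. D2v 0 y z / 2)"
    unfolding bilinear_def
    by (auto intro!: linearI simp: blinfun.add_left blinfun.add_right blinfun.scaleR_left blinfun.scaleR_right field_simps)
  have lin: "bounded_linear (\<lambda>y. Dv 0 y / \<epsilon>)"
    using bounded_linear_divide blinfun.bounded_linear_right bounded_linear_compose by blast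
  have [measurable]: "blinfun_apply (Dv 0) \<in> borel_measurable borel"
    by (intro borel_measurable_continuous_onI linear_continuous_on blinfun.bounded_linear_right)
  have [measurable]: "(\<lambda>y. D2v 0 y y) \<in> borel_measurable borel"
    by (intro borel_measurable_continuous_onI continuous_intros)
  have Jpos: "0 \<le> J (norm y)" for y :: 'e by (rule J_nonneg) simp
  have J0: "J (norm y) = 0" if "\<not> norm y \<le> 1" for y :: 'e using that by (intro J_support) simp
  have AE_ne: "AE y::'e in lborel. y \<noteq> 0"
    by (intro AE_I'[of "{0}"]) (auto simp: null_sets_def)
  have f_le: "\<bar>f (norm y)\<bar> \<le> 2 * J (norm y)" if "y \<noteq> 0" for y :: 'e
  proof (cases "norm y \<le> 1")
    case True
    then have "\<bar>polar_density \<psi> R (\<epsilon> *\<^sub>R y)\<bar> \<le> 2" using dens[OF that True] \<eta> by linarith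
    then have "J (norm y) * \<bar>polar_density \<psi> R (\<epsilon> *\<^sub>R y)\<bar> \<le> J (norm y) * 2"
      using Jpos by (rule mult_left_mono)
    then show ?thesis using Jpos by (simp add: f abs_mult)
  qed (simp add: f J0)
  have Pint: "integrable lborel P"
  proof (rule Bochner_Integration.integrable_bound)
    show "integrable lborel (\<lambda>y::'e. 2 * (K / \<epsilon>) * J (norm y))" using J_norm_integrable by simp
    have "norm (P y) \<le> norm (2 * (K / \<epsilon>) * J (norm y))" if "y \<noteq> 0" for y
    proof (cases "norm y \<le> 1")
      case True
      have "\<bar>Dv 0 y\<bar> \<le> norm (Dv 0) * norm y" using norm_blinfun[of "Dv 0" y] by simp
      also have "\<dots> \<le> K * 1" using K True \<open>0 \<le> K\<close> by (intro mult_mono) auto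
      finally have "\<bar>f (norm y)\<bar> * (\<bar>Dv 0 y\<bar> / \<epsilon>) \<le> (2 * J (norm y)) * (K / \<epsilon>)"
        using f_le[OF that] \<epsilon> Jpos[of y] by (intro mult_mono divide_right_mono) auto
      then show ?thesis using \<epsilon>(1) Jpos[of y] \<open>0 \<le> K\<close> by (simp add: P_def abs_mult mult_ac)
    qed (simp add: P_def f J0)
    then show "AE y in lborel. norm (P y) \<le> norm (2 * (K / \<epsilon>) * J (norm y))"
      using AE_ne by (auto elim: eventually_mono)
  qed (simp add: P_def)
  have Qint: "integrable lborel Q"
  proof (rule Bochner_Integration.integrable_bound)
    show "integrable lborel (\<lambda>y::'e. K * (J (norm y) * (norm y)\<^sup>2))" using J_moment by simp
    have "norm (Q y) \<le> norm (K * (J (norm y) * (norm y)\<^sup>2))" for y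
    proof -
      have "\<bar>D2v 0 y y\<bar> \<le> norm (D2v 0) * norm y * norm y"
        using norm_blinfun[of "D2v 0 y" y] norm_blinfun[of "D2v 0" y]
        by (simp add: mult_right_mono order_trans)
      also have "\<dots> \<le> K * norm y * norm y" using K by (intro mult_right_mono) auto
      finally have "\<bar>D2v 0 y y\<bar> / 2 \<le> K * norm y * norm y" by linarith
      then have "J (norm y) * (\<bar>D2v 0 y y\<bar> / 2) \<le> J (norm y) * (K * norm y * norm y)"
        using Jpos by (rule mult_left_mono)
      then show ?thesis using Jpos[of y] \<open>0 \<le> K\<close> by (simp add: Q_def abs_mult power2_eq_square mult_ac)
    qed
    then show "AE y in lborel. norm (Q y) \<le> norm (K * (J (norm y) * (norm y)\<^sup>2))" by simp
  qed (simp add: Q_def)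
  have Pval: "(\<integral>y. P y \<partial>lborel) = 0"
    unfolding P_def by (rule integral_radial_odd[OF fm lin])
  have Qval: "(\<integral>y. Q y \<partial>lborel) = m / (2 * DIM('e)) * (\<Sum>b\<in>Basis. D2v 0 b b)"
    unfolding Q_def integral_radial_quadratic[OF J_norm_measurable J_moment bil]
    by (simp add: m_def sum_divide_distrib[symmetric])
  have err: "norm (G y - (P y + Q y)) \<le> K * (\<epsilon> powr \<alpha> + \<eta>) * (J (norm y) * (norm y)\<^sup>2)" if "y \<noteq> 0" for y
  proof (cases "norm y \<le> 1")
    case False
    then show ?thesis by (simp add: G_def P_def Q_def f J0)
  next
    case True
    let ?p = "polar_density \<psi> R (\<epsilon> *\<^sub>R y)" and ?z = "\<epsilon> *\<^sub>R y"
    have nz: "norm ?z \<le> \<epsilon>" using True \<epsilon>(1) by simp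
    then have z: "?z \<in> ball 0 \<rho>" using \<epsilon>(3) by simp
    have "\<Phi> 0 = x" using \<Phi> by (simp add: polar_coordinates_def)
    define E where "E = g (\<Phi> ?z) - g x - Dv 0 ?z - D2v 0 ?z ?z / 2"
    have E: "\<bar>E\<bar> \<le> K / 2 * norm ?z powr \<alpha> * (norm ?z)\<^sup>2"
      using taylor2_holder[OF D1 D2 z \<open>0 \<le> K\<close> K(3) holder] \<open>\<Phi> 0 = x\<close> by (simp add: E_def)
    also have "\<dots> \<le> K / 2 * \<epsilon> powr \<alpha> * (norm ?z)\<^sup>2"
      using nz K(3) \<open>0 \<le> K\<close> by (intro mult_right_mono mult_left_mono powr_mono2) auto
    also have "\<dots> = K / 2 * \<epsilon> powr \<alpha> * (norm y)\<^sup>2 * \<epsilon>\<^sup>2"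
      by (simp add: power_mult_distrib)
    finally have E': "\<bar>E\<bar> / \<epsilon>\<^sup>2 \<le> K / 2 * \<epsilon> powr \<alpha> * (norm y)\<^sup>2"
      using \<epsilon>(1) by (simp add: divide_le_eq)
    have "D2v 0 ?z ?z = \<epsilon>\<^sup>2 * D2v 0 y y" "Dv 0 ?z = \<epsilon> * Dv 0 y"
      by (simp_all add: blinfun.scaleR_left blinfun.scaleR_right power2_eq_square)
    then have diff: "(g (\<Phi> ?z) - g x) / \<epsilon>\<^sup>2 = E / \<epsilon>\<^sup>2 + Dv 0 y / \<epsilon> + D2v 0 y y / 2"
      using \<epsilon>(1) by (simp add: E_def field_simps power2_eq_square)
    have "G y - (P y + Q y) = J (norm y) * (?p * (E / \<epsilon>\<^sup>2) + (?p - 1) * (D2v 0 y y / 2))"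
    proof -
      have "j * p * (a + b + c) - (j * p * b + j * c) = j * (p * a + (p - 1) * c)" for j p a b c :: real
        by (simp add: algebra_simps)
      then show ?thesis unfolding G_def P_def Q_def f diff .
    qed
    also have "\<bar>\<dots>\<bar> \<le> J (norm y) * (K * (\<epsilon> powr \<alpha> + \<eta>) * (norm y)\<^sup>2)"
    proof -
      have p: "\<bar>?p - 1\<bar> < \<eta>" using dens[OF that True] .
      then have "\<bar>?p\<bar> \<le> 2" using \<eta> by linarith
      \<comment> \<open>The bound 2 on the density cancels the factor 1/2 of the Taylor
        remainder.\<close>
      then have 1: "\<bar>?p\<bar> * (\<bar>E\<bar> / \<epsilon>\<^sup>2) \<le> 2 * (K / 2 * \<epsilon> powr \<alpha> * (norm y)\<^sup>2)"
        using E' by (intro mult_mono) auto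
      have "\<bar>D2v 0 y y\<bar> \<le> norm (D2v 0) * norm y * norm y"
        using norm_blinfun[of "D2v 0 y" y] norm_blinfun[of "D2v 0" y]
        by (simp add: mult_right_mono order_trans)
      also have "\<dots> \<le> K * norm y * norm y" using K by (intro mult_right_mono) auto
      finally have d: "\<bar>D2v 0 y y\<bar> / 2 \<le> K * (norm y)\<^sup>2" by (simp add: power2_eq_square)
      then have 2: "\<bar>?p - 1\<bar> * (\<bar>D2v 0 y y\<bar> / 2) \<le> \<eta> * (K * (norm y)\<^sup>2)"
        using p \<open>0 \<le> K\<close> by (intro mult_mono) auto
      have "\<bar>?p * (E / \<epsilon>\<^sup>2) + (?p - 1) * (D2v 0 y y / 2)\<bar> \<le> \<bar>?p\<bar> * (\<bar>E\<bar> / \<epsilon>\<^sup>2) + \<bar>?p - 1\<bar> * (\<bar>D2v 0 y y\<bar> / 2)"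
        by (rule order_trans[OF abs_triangle_ineq]) (simp add: abs_mult)
      also have "\<dots> \<le> K * (\<epsilon> powr \<alpha> + \<eta>) * (norm y)\<^sup>2"
        using 1 2 by (simp add: algebra_simps)
      finally show ?thesis
        using Jpos[of y] by (simp add: abs_mult mult_left_mono)
    qed
    finally show ?thesis by (simp add: mult_ac)
  qed
  have "nonlocal_operator M \<mu> J \<epsilon> g x - m / (2 * DIM('e)) * (\<Sum>b\<in>Basis. D2v 0 b b) = (\<integral>y. G y - (P y + Q y) \<partial>lborel)"
    using G Pint Qint by (simp add: Pval Qval)
  also have "\<bar>\<dots>\<bar> \<le> (\<integral>y. norm (G y - (P y + Q y)) \<partial>lborel)"
    using integral_norm_bound[of lborel "\<lambda>y. G y - (P y + Q y)"] by simp
  also have "\<dots> \<le> (\<integral>y. K * (\<epsilon> powr \<alpha> + \<eta>) * (J (norm (y::'e)) * (norm y)\<^sup>2) \<partial>lborel)"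
  proof (rule integral_mono_AE)
    show "AE y in lborel. norm (G y - (P y + Q y)) \<le> K * (\<epsilon> powr \<alpha> + \<eta>) * (J (norm y) * (norm y)\<^sup>2)"
      using AE_ne err by (auto elim: eventually_mono)
  qed (use G Pint Qint J_moment in auto)
  also have "\<dots> = K * (\<epsilon> powr \<alpha> + \<eta>) * m" by (simp add: m_def)
  finally show ?thesis .
qed

end

section \<open>The heat equation at the center of a chart\<close>

lemma has_real_derivative_within_unique:
  assumes "(f has_real_derivative a) (at t within {0..T})" "(f has_real_derivative b) (at t within {0..T})"
    "t \<in> {0..T}" "0 < T"
  shows "a = b"
  using vector_derivative_unique_within_closed_interval[of 0 T t f a b] assms
  by (simp add: has_real_derivative_iff_has_vector_derivative)

text \<open>The hypothesis on the Laplacian says nothing at the center of the chart, so the equation at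
  \<open>x\<close> is recovered as a limit of the equations at the points \<open>\<Phi> (\<plusminus> r e)\<close>.\<close>

lemma heat_solution_time_derivative:
  fixes M :: "('m::{t2_space,second_countable_topology}, 'e::euclidean_space) riemannian_structure"
    and Dv :: "'e \<Rightarrow> 'e \<Rightarrow>\<^sub>L real" and D2v :: "'e \<Rightarrow> 'e \<Rightarrow>\<^sub>L 'e \<Rightarrow>\<^sub>L real"
  assumes warping: "warping_function \<psi> R" and \<rho>: "0 < \<rho>" "\<rho> < R"
    and \<Phi>: "polar_coordinates M \<psi> R x \<Phi>"
    and heat: "heat_solution M \<psi> R q T u0 u" and t: "t \<in> {0<..T}"
    and D1: "\<And>z. z \<in> ball 0 \<rho> \<Longrightarrow> ((\<lambda>z. u (\<Phi> z) t) has_derivative blinfun_apply (Dv z)) (at z)"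
    and D2: "\<And>z. z \<in> ball 0 \<rho> \<Longrightarrow> (Dv has_derivative blinfun_apply (D2v z)) (at z)"
    and wt: "\<And>z. z \<in> ball 0 \<rho> \<Longrightarrow> (u (\<Phi> z) has_real_derivative wt z) (at t within {0..T})"
    and cont: "isCont D2v 0" "isCont wt 0"
  shows "wt 0 = q * (\<Sum>b\<in>Basis. D2v 0 b b)"
proof -
  obtain e :: 'e where e: "e \<in> Basis" using nonempty_Basis by blast
  let ?P = "\<lambda>z. polar_laplacian \<psi> (\<lambda>z. u (\<Phi> z) t) z"
  have eq: "wt z = q * ?P z" if z: "z \<in> ball 0 \<rho> - {0}" for z
  proof -
    obtain l where l: "has_laplace_beltrami M \<psi> R (\<lambda>y. u y t) l (\<Phi> z)"
      "(u (\<Phi> z) has_real_derivative q * l) (at t within {0..T})"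
      using heat t unfolding heat_solution_def by blast
    have "?P z = l"
      using l(1) \<Phi> z \<rho> unfolding has_laplace_beltrami_def by auto
    moreover have "wt z = q * l"
      using has_real_derivative_within_unique[OF wt l(2)] z t by auto
    ultimately show ?thesis by simp
  qed
  have R: "0 < R" using \<rho> by simp
  have lim: "((\<lambda>r. wt (r *\<^sub>R y)) \<longlongrightarrow> wt 0) (at_right 0)" for y
    by (rule isCont_tendsto_compose[OF cont(2)]) (auto intro!: tendsto_eq_intros)
  have lim1: "((\<lambda>r. wt (r *\<^sub>R e) + wt (r *\<^sub>R (- e))) \<longlongrightarrow> wt 0 + wt 0) (at_right 0)"
    by (intro tendsto_add lim)
  have lim2: "((\<lambda>r. q * (?P (r *\<^sub>R e) + ?P (r *\<^sub>R (- e)))) \<longlongrightarrow> q * (2 * (\<Sum>b\<in>Basis. D2v 0 b b))) (at_right 0)"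
    by (intro tendsto_mult tendsto_const polar_laplacian_antipodal_limit[OF D1 D2 e \<rho>(1) cont(1)]
          warping_function_limits[OF warping R])
  have "eventually (\<lambda>r. q * (?P (r *\<^sub>R e) + ?P (r *\<^sub>R (- e))) = wt (r *\<^sub>R e) + wt (r *\<^sub>R (- e))) (at_right 0)"
    unfolding eventually_at_right_field
  proof (intro exI conjI allI impI)
    fix r assume "0 < r" "r < \<rho>"
    then have "r *\<^sub>R e \<in> ball 0 \<rho> - {0}" "r *\<^sub>R (- e) \<in> ball 0 \<rho> - {0}"
      using e by auto
    from this[THEN eq] show "q * (?P (r *\<^sub>R e) + ?P (r *\<^sub>R (- e))) = wt (r *\<^sub>R e) + wt (r *\<^sub>R (- e))"
      by (simp add: distrib_left)
  qed (rule \<rho>(1))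
  from tendsto_unique[OF _ lim1 Lim_transform_eventually[OF lim2 this]]
  have "wt 0 + wt 0 = q * (2 * (\<Sum>b\<in>Basis. D2v 0 b b))" by simp
  then show ?thesis by simp
qed

section \<open>Comparison and convergence\<close>

text \<open>On a non-compact manifold the supremum of \<open>w x t - \<delta>' * t\<close> need not be attained in \<open>x\<close>.
  It suffices to maximize over \<open>t\<close> alone at a nearly optimal \<open>x\<close>, because the total
  mass of the kernel is bounded.\<close>

lemma nonlocal_comparison:
  fixes w :: "'m \<Rightarrow> real \<Rightarrow> real"
  assumes T: "0 < T" and \<delta>: "0 \<le> \<delta>"
    and k: "\<And>x. integrable \<mu> (k x)" "\<And>x y. 0 \<le> k x y" "\<And>x. (\<integral>y. k x y \<partial>\<mu>) \<le> \<Lambda>"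
    and cont: "\<And>x. continuous_on {0..T} (w x)" and init: "\<And>x. w x 0 \<le> 0"
    and bdd: "\<And>x t. t \<in> {0..T} \<Longrightarrow> w x t \<le> B"
    and int: "\<And>x t. t \<in> {0<..T} \<Longrightarrow> integrable \<mu> (\<lambda>y. k x y * (w y t - w x t))"
    and deriv: "\<And>x t. t \<in> {0<..T} \<Longrightarrow> \<exists>d \<le> (\<integral>y. k x y * (w y t - w x t) \<partial>\<mu>) + \<delta>.
       (w x has_real_derivative d) (at t within {0..T})"
    and t: "t \<in> {0..T}"
  shows "w x t \<le> \<delta> * t"
proof (rule ccontr)
  assume "\<not> w x t \<le> \<delta> * t"
  moreover from this have "0 < t" using init[of x] t by (cases "t = 0") auto
  \<comment> \<open>A slope strictly between \<open>\<delta>\<close> and \<open>w x t / t\<close>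
    leaves \<open>w x t - \<delta>' * t\<close> positive and provides the gap
    \<open>\<delta>' - \<delta>\<close> that is contradicted at the end.\<close>
  ultimately obtain \<delta>' where \<delta>': "\<delta> < \<delta>'" "\<delta>' * t < w x t"
    using dense[of \<delta> "w x t / t"] by (auto simp: pos_less_divide_eq)
  define h where "h = (\<lambda>(x, t). w x t - \<delta>' * t)"
  define S where "S = (SUP p\<in>UNIV \<times> {0..T}. h p)"
  have "h p \<le> B" if "p \<in> UNIV \<times> {0..T}" for p
    using that bdd[of "snd p" "fst p"] \<delta> \<delta>' by (auto simp: h_def intro: order_trans[of _ "w (fst p) (snd p)"])
  then have bdd_h: "bdd_above (h ` (UNIV \<times> {0..T}))" unfolding bdd_above_def by blast
  have hS: "w x t - \<delta>' * t \<le> S" if "t \<in> {0..T}" for x t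
    using cSUP_upper[OF _ bdd_h, of "(x, t)"] that by (simp add: h_def S_def)
  have "0 < S" using hS[OF t, of x] \<delta>' by linarith
  have "0 \<le> \<Lambda>" using order_trans[OF integral_nonneg_AE[OF AE_I2[OF k(2)]] k(3)] .
  \<comment> \<open>\<open>\<eta> < S\<close> keeps nearly optimal points away from
    \<open>t = 0\<close>, where \<open>w\<close> is at most 0.
    \<open>\<Lambda> * \<eta> < \<delta>' - \<delta>\<close> makes the loss from not attaining the
    supremum smaller than the gap; the \<open>+ 1\<close> covers
    \<open>\<Lambda> = 0\<close>.\<close>
  define \<eta> where "\<eta> = min S ((\<delta>' - \<delta>) / (\<Lambda> + 1)) / 2"
  have \<eta>: "0 < \<eta>" "\<eta> < S" using \<open>0 < S\<close> \<delta>' \<open>0 \<le> \<Lambda>\<close> by (auto simp: \<eta>_def min_def field_simps)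
  have "(\<Lambda> + 1) * \<eta> \<le> (\<Lambda> + 1) * (((\<delta>' - \<delta>) / (\<Lambda> + 1)) / 2)"
    using \<open>0 \<le> \<Lambda>\<close> unfolding \<eta>_def by (intro mult_left_mono divide_right_mono min.cobounded2) auto
  also have "\<dots> = (\<delta>' - \<delta>) / 2"
  proof -
    have "L * (d / L / 2) = d / 2" if "0 < L" for L d :: real using that by simp
    from this[of "\<Lambda> + 1" "\<delta>' - \<delta>"] show ?thesis using \<open>0 \<le> \<Lambda>\<close> by linarith
  qed
  finally have "(\<Lambda> + 1) * \<eta> \<le> (\<delta>' - \<delta>) / 2" .
  then have \<Lambda>\<eta>: "\<Lambda> * \<eta> < \<delta>' - \<delta>" using \<eta>(1) \<delta>'(1) by (simp add: distrib_right)
  have "UNIV \<times> {0..T} \<noteq> {}" using T by auto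
  then obtain p where "p \<in> UNIV \<times> {0..T}" "S - \<eta> < h p"
    using less_cSUP_iff[OF _ bdd_h, of "S - \<eta>"] \<eta> by (auto simp: S_def)
  then obtain x0 t0 where t0: "t0 \<in> {0..T}" "S - \<eta> < w x0 t0 - \<delta>' * t0"
    by (cases p) (auto simp: h_def)
  have "continuous_on {0..T} (\<lambda>t. w x0 t - \<delta>' * t)"
    by (intro continuous_intros cont)
  then obtain t1 where t1: "t1 \<in> {0..T}" and max: "\<And>t. t \<in> {0..T} \<Longrightarrow> w x0 t - \<delta>' * t \<le> w x0 t1 - \<delta>' * t1"
    using continuous_attains_sup[of "{0..T}" "\<lambda>t. w x0 t - \<delta>' * t"] T by fastforce
  have near: "S - \<eta> < w x0 t1 - \<delta>' * t1" using t0 max[OF t0(1)] by linarith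
  then have "t1 \<noteq> 0" using \<eta> init[of x0] by auto
  then have t1': "t1 \<in> {0<..T}" using t1 by auto
  obtain d where d: "d \<le> (\<integral>y. k x0 y * (w y t1 - w x0 t1) \<partial>\<mu>) + \<delta>"
    "(w x0 has_real_derivative d) (at t1 within {0..T})"
    using deriv[OF t1'] by blast
  have "((\<lambda>t. w x0 t - \<delta>' * t) has_real_derivative d - \<delta>') (at t1 within {0..T})"
    by (auto intro!: derivative_eq_intros d(2))
  \<comment> \<open>The maximum may sit at \<open>T\<close>, so it is compared with earlier times
    only: a negative derivative would make the function larger just before
    \<open>t1\<close>.\<close>
  moreover have "\<not> d - \<delta>' < 0"
  proof
    assume "d - \<delta>' < 0"
    from has_real_derivative_neg_dec_left[OF calculation this] obtain s where
      s: "0 < s" "\<And>h. 0 < h \<Longrightarrow> t1 - h \<in> {0..T} \<Longrightarrow> h < s \<Longrightarrow>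
        w x0 t1 - \<delta>' * t1 < w x0 (t1 - h) - \<delta>' * (t1 - h)" by blast
    define h where "h = min t1 (s / 2)"
    have h: "0 < h" "h < s" "t1 - h \<in> {0..T}" using s(1) t1' by (auto simp: h_def min_def)
    show False using s(2)[OF h(1,3,2)] max[OF h(3)] by linarith
  qed
  \<comment> \<open>At the maximal time, \<open>w y t1\<close> exceeds \<open>w x0 t1\<close> by at
    most \<open>\<eta>\<close>, since both values lose the same \<open>\<delta>' * t1\<close> and
    \<open>x0\<close> is within \<open>\<eta>\<close> of the supremum.\<close>
  moreover have "(\<integral>y. k x0 y * (w y t1 - w x0 t1) \<partial>\<mu>) \<le> \<Lambda> * \<eta>"
  proof -
    have "(\<integral>y. k x0 y * (w y t1 - w x0 t1) \<partial>\<mu>) \<le> (\<integral>y. k x0 y * \<eta> \<partial>\<mu>)"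
    proof (rule integral_mono)
      show "k x0 y * (w y t1 - w x0 t1) \<le> k x0 y * \<eta>" for y
        using hS[OF t1, of y] near k(2) by (intro mult_left_mono) auto
    qed (use int[OF t1'] k(1) in auto)
    also have "\<dots> = (\<integral>y. k x0 y \<partial>\<mu>) * \<eta>" by simp
    also have "\<dots> \<le> \<Lambda> * \<eta>" using k(3) \<eta>(1) by (intro mult_right_mono) auto
    finally show ?thesis .
  qed
  ultimately show False using d(1) \<Lambda>\<eta> by linarith
qed

section \<open>Regularity of the heat solution and the uniform error estimate\<close>

lemma holder_isCont_0:
  fixes f :: "'a::real_normed_vector \<Rightarrow> 'b::real_normed_vector"
  assumes "\<And>z. z \<in> ball 0 \<rho> \<Longrightarrow> norm (f z - f 0) \<le> K * norm z powr \<alpha>" "0 < \<rho>" "0 < \<alpha>"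
  shows "isCont f 0"
proof -
  have lim: "((\<lambda>z::'a. K * norm z powr \<alpha>) \<longlongrightarrow> K * 0) (at 0)"
    using assms(3) by (intro tendsto_intros tendsto_zero_powrI[of _ _ _ \<alpha>]) (auto intro: tendsto_norm_zero)
  have "eventually (\<lambda>z. norm (f z - f 0) \<le> K * norm z powr \<alpha>) (at 0)"
    using assms(1,2) unfolding eventually_at_topological by (intro exI[of _ "ball 0 \<rho>"]) auto
  from Lim_null_comparison[OF this] lim have "((\<lambda>z. f z - f 0) \<longlongrightarrow> 0) (at 0)" by simp
  then show ?thesis by (simp add: isCont_def LIM_zero_iff)
qed

text \<open>Every point is the center of its own chart, and the inverse chart is continuous there,
  so continuity of all coordinate expressions at 0 suffices.\<close>

lemma continuous_on_polar:
  fixes M :: "('m::{t2_space,second_countable_topology}, 'e::euclidean_space) riemannian_structure"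
    and g :: "'m \<Rightarrow> real"
  assumes sym: "spherically_symmetric M \<psi> R"
    and cont: "\<And>x \<Phi>. polar_coordinates M \<psi> R x \<Phi> \<Longrightarrow> isCont (\<lambda>z. g (\<Phi> z)) 0"
  shows "continuous_on UNIV g"
  unfolding continuous_on_eq_continuous_at[OF open_UNIV]
proof
  fix x
  obtain \<Phi> where \<Phi>: "polar_coordinates M \<psi> R x \<Phi>" "0 < R"
    using sym unfolding spherically_symmetric_def by blast
  let ?B = "geodesic_ball M x R"
  obtain \<Psi> where hom: "homeomorphism (ball 0 R) ?B \<Phi> \<Psi>" and B: "open ?B" and 0: "\<Phi> 0 = x"
    using \<Phi> by (auto simp: polar_coordinates_def)
  have x: "x \<in> ?B" "\<Psi> x = 0"
    using hom \<Phi>(2) unfolding homeomorphism_def 0[symmetric] by (auto simp flip: 0)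
  have "isCont \<Psi> x"
    using homeomorphism_cont2[OF hom] B x by (simp add: continuous_on_eq_continuous_at)
  then have "isCont (\<lambda>y. g (\<Phi> (\<Psi> y))) x"
    using isCont_o2[of x \<Psi> "\<lambda>z. g (\<Phi> z)"] cont[OF \<Phi>(1)] x by simp
  moreover have "eventually (\<lambda>y. g (\<Phi> (\<Psi> y)) = g y) (nhds x)"
    using hom B x unfolding eventually_nhds homeomorphism_def by (intro exI[of _ ?B]) auto
  ultimately show "isCont g x" by (simp add: isCont_cong)
qed

lemma parabolic_holder_boundE:
  fixes w :: "real \<Rightarrow> 'e::euclidean_space \<Rightarrow> real"
  assumes "parabolic_holder_bound K \<alpha> T B w"
  obtains wt :: "real \<Rightarrow> 'e \<Rightarrow> real" and Dw :: "real \<Rightarrow> 'e \<Rightarrow> 'e \<Rightarrow>\<^sub>L real"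
    and D2w :: "real \<Rightarrow> 'e \<Rightarrow> 'e \<Rightarrow>\<^sub>L 'e \<Rightarrow>\<^sub>L real"
  where "\<And>t z. t \<in> {0..T} \<Longrightarrow> z \<in> B \<Longrightarrow> ((\<lambda>s. w s z) has_real_derivative wt t z) (at t within {0..T})"
    and "\<And>t z. t \<in> {0..T} \<Longrightarrow> z \<in> B \<Longrightarrow> (w t has_derivative blinfun_apply (Dw t z)) (at z)"
    and "\<And>t z. t \<in> {0..T} \<Longrightarrow> z \<in> B \<Longrightarrow> (Dw t has_derivative blinfun_apply (D2w t z)) (at z)"
    and "\<And>t z. t \<in> {0..T} \<Longrightarrow> z \<in> B \<Longrightarrow> \<bar>w t z\<bar> \<le> K"
    and "\<And>t z. t \<in> {0..T} \<Longrightarrow> z \<in> B \<Longrightarrow> norm (Dw t z) \<le> K"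
    and "\<And>t z. t \<in> {0..T} \<Longrightarrow> z \<in> B \<Longrightarrow> norm (D2w t z) \<le> K"
    and "\<And>t z y. t \<in> {0..T} \<Longrightarrow> z \<in> B \<Longrightarrow> y \<in> B \<Longrightarrow> \<bar>wt t z - wt t y\<bar> \<le> K * dist z y powr \<alpha>"
    and "\<And>t z y. t \<in> {0..T} \<Longrightarrow> z \<in> B \<Longrightarrow> y \<in> B \<Longrightarrow> norm (D2w t z - D2w t y) \<le> K * dist z y powr \<alpha>"
proof -
  obtain wt :: "real \<Rightarrow> 'e \<Rightarrow> real" and Dw :: "real \<Rightarrow> 'e \<Rightarrow> 'e \<Rightarrow>\<^sub>L real" and D2w :: "real \<Rightarrow> 'e \<Rightarrow> 'e \<Rightarrow>\<^sub>L 'e \<Rightarrow>\<^sub>L real"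
    where w: "\<forall>t\<in>{0..T}. \<forall>z\<in>B.
           ((\<lambda>s. w s z) has_real_derivative wt t z) (at t within {0..T}) \<and>
           (w t has_derivative blinfun_apply (Dw t z)) (at z) \<and>
           (Dw t has_derivative blinfun_apply (D2w t z)) (at z) \<and>
           \<bar>w t z\<bar> \<le> K \<and> \<bar>wt t z\<bar> \<le> K \<and> norm (Dw t z) \<le> K \<and> norm (D2w t z) \<le> K"
    and h: "\<forall>t\<in>{0..T}. \<forall>s\<in>{0..T}. \<forall>z\<in>B. \<forall>y\<in>B.
           \<bar>wt t z - wt s y\<bar> \<le> K * (dist z y powr \<alpha> + \<bar>t - s\<bar> powr (\<alpha> / 2)) \<and>
           norm (D2w t z - D2w s y) \<le> K * (dist z y powr \<alpha> + \<bar>t - s\<bar> powr (\<alpha> / 2))"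
    using assms unfolding parabolic_holder_bound_def by (elim exE conjE)
  \<comment> \<open>At equal times the temporal part is
    \<open>0 powr (\<alpha> / 2) = 0\<close>.\<close>
  have h': "\<bar>wt t z - wt t y\<bar> \<le> K * dist z y powr \<alpha>" "norm (D2w t z - D2w t y) \<le> K * dist z y powr \<alpha>"
    if "t \<in> {0..T}" "z \<in> B" "y \<in> B" for t z y
    using h[rule_format, OF that(1,1,2,3)] by auto
  show thesis
    by (rule that[of wt Dw D2w]) (use w[rule_format] h' in blast)+
qed

context radial_kernel
begin

context
  fixes u :: "'m \<Rightarrow> real \<Rightarrow> real" and u0 :: "'m \<Rightarrow> real" and q T \<alpha> \<rho> K :: real
  assumes T: "0 < T" and \<alpha>: "0 < \<alpha>"
    and q: "q = 1 / (2 * real DIM('e)) * (\<integral>z. J (norm (z::'e)) * (norm z)\<^sup>2 \<partial>lborel)"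
    and \<rho>: "0 < \<rho>" "\<rho> < R"
    and holder_all: "\<forall>x \<Phi>. polar_coordinates M \<psi> R x \<Phi> \<longrightarrow>
       parabolic_holder_bound K \<alpha> T (ball 0 \<rho>) (\<lambda>t z. u (\<Phi> z) t)"
    and heat: "heat_solution M \<psi> R q T u0 u"
begin

lemmas holder = holder_all[rule_format]

lemma heat_bounded: "t \<in> {0..T} \<Longrightarrow> \<bar>u x t\<bar> \<le> K"
proof -
  assume t: "t \<in> {0..T}"
  obtain \<Phi> where \<Phi>: "polar_coordinates M \<psi> R x \<Phi>" by (rule polar_coordinates_exist)
  have "\<bar>u (\<Phi> 0) t\<bar> \<le> K"
    by (rule parabolic_holder_boundE[OF holder[OF \<Phi>]]) (use t \<rho>(1) in auto)
  then show ?thesis using \<Phi> by (simp add: polar_coordinates_def)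
qed

lemma heat_continuous_time: "continuous_on {0..T} (u x)"
proof -
  obtain \<Phi> where \<Phi>: "polar_coordinates M \<psi> R x \<Phi>" by (rule polar_coordinates_exist)
  have z: "0 \<in> ball (0::'e) \<rho>" using \<rho> by simp
  obtain wt where "\<And>t z. t \<in> {0..T} \<Longrightarrow> z \<in> ball (0::'e) \<rho> \<Longrightarrow>
      (u (\<Phi> z) has_real_derivative wt t z) (at t within {0..T})"
    by (rule parabolic_holder_boundE[OF holder[OF \<Phi>]]) blast
  from this[OF _ z] have "continuous_on {0..T} (u (\<Phi> 0))"
    by (rule DERIV_continuous_on)
  then show ?thesis using \<Phi> by (simp add: polar_coordinates_def)
qed

lemma heat_continuous_space:
  assumes t: "t \<in> {0..T}"
  shows "continuous_on UNIV (\<lambda>x. u x t)"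
proof (rule continuous_on_polar[OF symmetric])
  fix x \<Phi> assume \<Phi>: "polar_coordinates M \<psi> R x \<Phi>"
  have z: "0 \<in> ball (0::'e) \<rho>" using \<rho> by simp
  obtain Dw :: "real \<Rightarrow> 'e \<Rightarrow> 'e \<Rightarrow>\<^sub>L real" where "\<And>t z. t \<in> {0..T} \<Longrightarrow> z \<in> ball (0::'e) \<rho> \<Longrightarrow>
      ((\<lambda>z. u (\<Phi> z) t) has_derivative blinfun_apply (Dw t z)) (at z)"
    by (rule parabolic_holder_boundE[OF holder[OF \<Phi>]]) blast
  from this[OF t z] show "isCont (\<lambda>z. u (\<Phi> z) t) 0" by (rule has_derivative_continuous)
qed

text \<open>The nonlocal operator and the time derivative are both compared with \<open>q\<close>
  times the trace of \<open>D2w t 0\<close>: the former is close to it, the latter equals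
  it.\<close>

lemma heat_consistency:
  assumes \<eta>: "0 < \<eta>" "\<eta> \<le> 1"
    and r: "0 < r" "r \<le> R" "\<And>z::'e. z \<noteq> 0 \<Longrightarrow> norm z < r \<Longrightarrow> \<bar>polar_density \<psi> R z - 1\<bar> < \<eta>"
    and \<epsilon>: "0 < \<epsilon>" "\<epsilon> < r" "\<epsilon> < \<rho>"
    and t: "t \<in> {0<..T}"
  shows "\<exists>d. (u x has_real_derivative d) (at t within {0..T}) \<and>
    \<bar>nonlocal_operator M \<mu> J \<epsilon> (\<lambda>y. u y t) x - d\<bar> \<le>
      K * (\<epsilon> powr \<alpha> + \<eta>) * (\<integral>z. J (norm (z::'e)) * (norm z)\<^sup>2 \<partial>lborel)"
proof -
  obtain \<Phi> where \<Phi>: "polar_coordinates M \<psi> R x \<Phi>" by (rule polar_coordinates_exist)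
  then have \<Phi>0: "\<Phi> 0 = x" by (simp add: polar_coordinates_def)
  have t': "t \<in> {0..T}" using t by auto
  have b0: "0 \<in> ball (0::'e) \<rho>" using \<rho> by simp
  obtain wt :: "real \<Rightarrow> 'e \<Rightarrow> real" and Dw :: "real \<Rightarrow> 'e \<Rightarrow> 'e \<Rightarrow>\<^sub>L real" and D2w :: "real \<Rightarrow> 'e \<Rightarrow> 'e \<Rightarrow>\<^sub>L 'e \<Rightarrow>\<^sub>L real"
    where w: "\<And>t z. t \<in> {0..T} \<Longrightarrow> z \<in> ball 0 \<rho> \<Longrightarrow> (u (\<Phi> z) has_real_derivative wt t z) (at t within {0..T})"
      "\<And>t z. t \<in> {0..T} \<Longrightarrow> z \<in> ball 0 \<rho> \<Longrightarrow> ((\<lambda>z. u (\<Phi> z) t) has_derivative blinfun_apply (Dw t z)) (at z)"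
      "\<And>t z. t \<in> {0..T} \<Longrightarrow> z \<in> ball 0 \<rho> \<Longrightarrow> (Dw t has_derivative blinfun_apply (D2w t z)) (at z)"
      "\<And>t z. t \<in> {0..T} \<Longrightarrow> z \<in> ball 0 \<rho> \<Longrightarrow> norm (Dw t z) \<le> K"
      "\<And>t z. t \<in> {0..T} \<Longrightarrow> z \<in> ball 0 \<rho> \<Longrightarrow> norm (D2w t z) \<le> K"
    and h: "\<And>t z y. t \<in> {0..T} \<Longrightarrow> z \<in> ball 0 \<rho> \<Longrightarrow> y \<in> ball 0 \<rho> \<Longrightarrow> \<bar>wt t z - wt t y\<bar> \<le> K * dist z y powr \<alpha>"
      "\<And>t z y. t \<in> {0..T} \<Longrightarrow> z \<in> ball 0 \<rho> \<Longrightarrow> y \<in> ball 0 \<rho> \<Longrightarrow> norm (D2w t z - D2w t y) \<le> K * dist z y powr \<alpha>"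
    by (rule parabolic_holder_boundE[OF holder[OF \<Phi>]]) blast
  note wT = w(1)[OF t'] and D1 = w(2)[OF t'] and D2 = w(3)[OF t'] and bounds = w(4,5)[OF t' b0]
  have hz: "\<bar>wt t z - wt t 0\<bar> \<le> K * norm z powr \<alpha>" "norm (D2w t z - D2w t 0) \<le> K * norm z powr \<alpha>"
    if "z \<in> ball 0 \<rho>" for z
    using h(1)[OF t' that b0] h(2)[OF t' that b0] by simp_all
  have c1: "isCont (D2w t) 0"
    by (rule holder_isCont_0[OF hz(2) \<rho>(1) \<alpha>])
  have c2: "isCont (wt t) 0"
    by (rule holder_isCont_0[OF _ \<rho>(1) \<alpha>]) (use hz(1) in auto)
  have "wt t 0 = q * (\<Sum>b\<in>Basis. D2w t 0 b b)"
    by (rule heat_solution_time_derivative[OF warping \<rho> \<Phi> heat t D1 D2 wT c1 c2])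
  moreover have "\<bar>nonlocal_operator M \<mu> J \<epsilon> (\<lambda>y. u y t) x -
      (\<integral>z. J (norm (z::'e)) * (norm z)\<^sup>2 \<partial>lborel) / (2 * DIM('e)) * (\<Sum>b\<in>Basis. D2w t 0 b b)\<bar>
      \<le> K * (\<epsilon> powr \<alpha> + \<eta>) * (\<integral>z. J (norm (z::'e)) * (norm z)\<^sup>2 \<partial>lborel)"
    by (rule nonlocal_consistency[OF \<Phi> D1 D2 bounds less_imp_le[OF \<alpha>] hz(2) \<eta> r \<epsilon>
          heat_continuous_space[OF t'] heat_bounded[OF t']])
  moreover have "(u x has_real_derivative wt t 0) (at t within {0..T})"
    using wT[OF b0] \<Phi>0 by simp
  ultimately show ?thesis
    unfolding q by (intro exI[of _ "wt t 0"]) simp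
qed

text \<open>The consistency error acts as the source \<open>\<delta>\<close> in
  \<open>nonlocal_comparison\<close>. That lemma is one-sided, so it is applied to
  \<open>v - u\<close> and to \<open>u - v\<close>, which the sign \<open>\<sigma>\<close> treats
  together; both start from 0.\<close>

lemma nonlocal_heat_estimate:
  assumes \<eta>: "0 < \<eta>" "\<eta> \<le> 1"
    and r: "0 < r" "r \<le> R" "\<And>z::'e. z \<noteq> 0 \<Longrightarrow> norm z < r \<Longrightarrow> \<bar>polar_density \<psi> R z - 1\<bar> < \<eta>"
    and \<epsilon>: "0 < \<epsilon>" "\<epsilon> < r" "\<epsilon> < \<rho>"
    and v: "nonlocal_solution M \<mu> J \<epsilon> T u0 v"
    and t: "t \<in> {0..T}"
  shows "\<bar>v x t - u x t\<bar> \<le> K * (\<epsilon> powr \<alpha> + \<eta>) * (\<integral>z. J (norm (z::'e)) * (norm z)\<^sup>2 \<partial>lborel) * t"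
proof -
  define \<delta> where "\<delta> = K * (\<epsilon> powr \<alpha> + \<eta>) * (\<integral>z. J (norm (z::'e)) * (norm z)\<^sup>2 \<partial>lborel)"
  have r1: "\<bar>polar_density \<psi> R z - 1\<bar> < 1" if "z \<noteq> 0" "norm z < r" for z :: 'e
    using r(3)[OF that] \<eta> by linarith
  have "0 \<le> K" using heat_bounded[OF t, of x] by linarith
  have "0 \<le> (\<integral>z. J (norm (z::'e)) * (norm z)\<^sup>2 \<partial>lborel)"
    by (intro integral_nonneg_AE AE_I2 mult_nonneg_nonneg J_nonneg) auto
  then have \<delta>: "0 \<le> \<delta>" using \<open>0 \<le> K\<close> \<eta> by (simp add: \<delta>_def)
  have v_cont: "continuous_on (UNIV \<times> {0..T}) (\<lambda>(x, t). v x t)"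
    and v_init: "\<And>x. v x 0 = u0 x"
    and v_deriv: "\<And>x t. t \<in> {0<..T} \<Longrightarrow>
        (v x has_real_derivative nonlocal_operator M \<mu> J \<epsilon> (\<lambda>y. v y t) x) (at t within {0..T})"
    using v by (auto simp: nonlocal_solution_def)
  have "bounded ((\<lambda>(x, t). v x t) ` (UNIV \<times> {0..T}))"
    using v by (simp add: nonlocal_solution_def)
  then obtain B where B': "\<forall>y\<in>(\<lambda>(x, t). v x t) ` (UNIV \<times> {0..T}). norm y \<le> B"
    unfolding bounded_iff by blast
  have B: "\<bar>v x t\<bar> \<le> B" if "t \<in> {0..T}" for x t
    using B'[rule_format, OF image_eqI[of _ _ "(x, t)"]] that by auto
  have v_time: "continuous_on {0..T} (v x)" for x
    using continuous_on_compose2[OF v_cont, of "{0..T}" "\<lambda>t. (x, t)", OF continuous_on_Pair[OF continuous_on_const continuous_on_id]]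
    by auto
  have v_space: "continuous_on UNIV (\<lambda>x. v x t)" if "t \<in> {0..T}" for t
  proof -
    have "(\<lambda>x. (x, t)) ` UNIV \<subseteq> UNIV \<times> {0..T}" using that by auto
    from continuous_on_compose2[OF v_cont continuous_on_Pair[OF continuous_on_id continuous_on_const] this]
    show ?thesis by simp
  qed
  have u_init: "u x 0 = u0 x" for x using heat by (simp add: heat_solution_def)
  define c where "c = 1 / \<epsilon>\<^sup>2 * (1 / \<epsilon> ^ DIM('e))"
  have c: "0 \<le> c" using \<epsilon> by (simp add: c_def)
  define k where "k = (\<lambda>x y. c * J (geodist M x y / \<epsilon>))"
  have nonlocal: "nonlocal_operator M \<mu> J \<epsilon> g x = (\<integral>y. k x y * (g y - g x) \<partial>\<mu>)" for g x
    by (simp add: nonlocal_operator_def k_def c_def mult_ac flip: integral_mult_right_zero)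
  have int: "integrable \<mu> (\<lambda>y. k x y * (g y - g x))"
    if g: "continuous_on UNIV g" "\<And>y. \<bar>g y\<bar> \<le> C" for g C x
  proof -
    have c1: "continuous_on UNIV (\<lambda>y. g y - g x)" using g(1) by (intro continuous_intros)
    have b1: "\<bar>g y - g x\<bar> \<le> 2 * C" for y using g(2)[of x] g(2)[of y] by linarith
    have "integrable \<mu> (\<lambda>y. J (geodist M x y / \<epsilon>) * (g y - g x))"
      by (rule kernel_integrable[OF r(1,2) r1 \<epsilon>(1,2) c1 b1])
    then have "integrable \<mu> (\<lambda>y. c * (J (geodist M x y / \<epsilon>) * (g y - g x)))" by simp
    then show ?thesis by (simp add: k_def mult.assoc)
  qed
  have k_int: "integrable \<mu> (k x)" for x
    using kernel_integrable[OF r(1,2) r1 \<epsilon>(1,2), of "\<lambda>_. 1" 1 x] by (simp add: k_def)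
  have k_pos: "0 \<le> k x y" for x y
    using c \<epsilon>(1) by (auto simp: k_def geodist_nonneg intro!: mult_nonneg_nonneg J_nonneg)
  have k_mass: "(\<integral>y. k x y \<partial>\<mu>) \<le> c * (\<integral>z. polar_density \<psi> R z * J (norm (z::'e) / \<epsilon>) \<partial>lborel)" for x
    using kernel_mass[of \<epsilon> x] \<epsilon> r(2) by (simp add: k_def)
  have est: "\<sigma> * (v x t - u x t) \<le> \<delta> * t" if \<sigma>: "\<sigma> = 1 \<or> \<sigma> = -1" for \<sigma>
  proof -
    have v_int: "integrable \<mu> (\<lambda>y. k x y * (v y t - v x t))"
      and u_int: "integrable \<mu> (\<lambda>y. k x y * (u y t - u x t))" if "t \<in> {0<..T}" for x t
      using that int[OF v_space, of t B x] B int[OF heat_continuous_space, of t K x] heat_bounded by auto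
    have split: "k x y * (\<sigma> * (v y t - u y t) - \<sigma> * (v x t - u x t)) =
        \<sigma> * (k x y * (v y t - v x t) - k x y * (u y t - u x t))" for x y t
      by (simp add: algebra_simps)
    show ?thesis
    proof (rule nonlocal_comparison[OF T \<delta> k_int k_pos k_mass, where w="\<lambda>x t. \<sigma> * (v x t - u x t)"])
      show "continuous_on {0..T} (\<lambda>t. \<sigma> * (v x t - u x t))" for x
        by (intro continuous_intros v_time heat_continuous_time)
      show "\<sigma> * (v x 0 - u x 0) \<le> 0" for x by (simp add: v_init u_init)
      show "\<sigma> * (v x t - u x t) \<le> B + K" if "t \<in> {0..T}" for x t
        using \<sigma> B[OF that, of x] heat_bounded[OF that, of x] by auto
      fix x t assume t: "t \<in> {0<..T}"
      show "integrable \<mu> (\<lambda>y. k x y * (\<sigma> * (v y t - u y t) - \<sigma> * (v x t - u x t)))"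
        unfolding split using v_int[OF t] u_int[OF t] by simp
      have I: "(\<integral>y. k x y * (\<sigma> * (v y t - u y t) - \<sigma> * (v x t - u x t)) \<partial>\<mu>) =
        \<sigma> * (nonlocal_operator M \<mu> J \<epsilon> (\<lambda>y. v y t) x - nonlocal_operator M \<mu> J \<epsilon> (\<lambda>y. u y t) x)"
        unfolding split nonlocal using v_int[OF t] u_int[OF t] by simp
      obtain d where d: "(u x has_real_derivative d) (at t within {0..T})"
        "\<bar>nonlocal_operator M \<mu> J \<epsilon> (\<lambda>y. u y t) x - d\<bar> \<le> \<delta>"
        using heat_consistency[OF \<eta> r \<epsilon> t] unfolding \<delta>_def by blast
      have "((\<lambda>t. \<sigma> * (v x t - u x t)) has_real_derivative
          \<sigma> * (nonlocal_operator M \<mu> J \<epsilon> (\<lambda>y. v y t) x - d)) (at t within {0..T})"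
        by (intro DERIV_cmult DERIV_diff v_deriv t d(1))
      moreover have "\<sigma> * (nonlocal_operator M \<mu> J \<epsilon> (\<lambda>y. v y t) x - d) \<le>
          (\<integral>y. k x y * (\<sigma> * (v y t - u y t) - \<sigma> * (v x t - u x t)) \<partial>\<mu>) + \<delta>"
        unfolding I using \<sigma> d(2) by auto
      ultimately show "\<exists>d\<le>(\<integral>y. k x y * (\<sigma> * (v y t - u y t) - \<sigma> * (v x t - u x t)) \<partial>\<mu>) + \<delta>.
          ((\<lambda>t. \<sigma> * (v x t - u x t)) has_real_derivative d) (at t within {0..T})"
        by blast
    qed (rule t)
  qed
  show ?thesis
    using est[of 1] est[of "-1"] by (simp add: \<delta>_def)
qed

end

end

theorem theorem3p2:
  fixes M :: "('m::{t2_space,second_countable_topology}, 'e::euclidean_space) riemannian_structure"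
    and origin :: 'm
    and \<tau> :: "'m \<Rightarrow> 'm \<Rightarrow> 'm"
    and \<mu> :: "'m measure"
    and \<psi> J :: "real \<Rightarrow> real"
    and R \<alpha> T q :: real
    and u0 :: "'m \<Rightarrow> real"
    and u :: "'m \<Rightarrow> real \<Rightarrow> real"
    and u\<epsilon> :: "real \<Rightarrow> 'm \<Rightarrow> real \<Rightarrow> real"
  assumes manifold: "riemannian_manifold M"
    and isometries: "\<And>x. riemannian_isometry M (\<tau> x)" "\<And>x. \<tau> x x = origin"
    and symmetric: "spherically_symmetric M \<psi> R"
    and volume: "polar_volume M \<psi> R \<mu>"
    and J_nonneg: "\<And>r. 0 \<le> r \<Longrightarrow> 0 \<le> J r"
    and J_normalized: "(\<integral>x. J (geodist M x origin) \<partial>\<mu>) = 1"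
    and J_support: "\<And>r. 1 < r \<Longrightarrow> J r = 0"
    and q_finite: "integrable lborel (\<lambda>z::'e. J (norm z) * (norm z)\<^sup>2)"
    and q_def: "q = 1 / (2 * real DIM('e)) * integral\<^sup>L lborel (\<lambda>z::'e. J (norm z) * (norm z)\<^sup>2)"
    and \<alpha>: "0 < \<alpha>" "\<alpha> < 1"
    and T: "0 < T"
    and u_holder: "parabolic_holder M \<psi> R \<alpha> T u"
    and u_solution: "heat_solution M \<psi> R q T u0 u"
    and u\<epsilon>_solution: "\<And>\<epsilon>. 0 < \<epsilon> \<Longrightarrow> nonlocal_solution M \<mu> J \<epsilon> T u0 (u\<epsilon> \<epsilon>)"
  shows "uniform_limit (UNIV \<times> {0..T}) (\<lambda>\<epsilon> (x, t). u\<epsilon> \<epsilon> x t) (\<lambda>(x, t). u x t) (at_right 0)"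
proof -
  \<comment> \<open>A non-integrable function has integral 0, so the value 1 forces
    integrability.\<close>
  have "integrable \<mu> (\<lambda>x. J (geodist M x origin))"
    using J_normalized not_integrable_integral_eq[of \<mu> "\<lambda>x. J (geodist M x origin)"] by auto
  then have kernel: "\<exists>c. integrable \<mu> (\<lambda>x. J (geodist M x c))" ..
  interpret radial_kernel M \<psi> R \<mu> J
    by (rule radial_kernel.intro[OF manifold symmetric volume J_nonneg J_support q_finite kernel])
  obtain \<rho> K where \<rho>: "0 < \<rho>" "\<rho> < R" and holder: "\<forall>x \<Phi>. polar_coordinates M \<psi> R x \<Phi> \<longrightarrow>
       parabolic_holder_bound K \<alpha> T (ball 0 \<rho>) (\<lambda>t z. u (\<Phi> z) t)"
    using u_holder unfolding parabolic_holder_def by blast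
  note estimate = nonlocal_heat_estimate[OF T \<alpha>(1) q_def \<rho> holder u_solution]
  let ?m = "\<integral>z. J (norm (z::'e)) * (norm z)\<^sup>2 \<partial>lborel"
  have m: "0 \<le> ?m"
    by (intro integral_nonneg_AE AE_I2 mult_nonneg_nonneg J_nonneg) auto
  have K: "0 \<le> K"
    using heat_bounded[OF T \<alpha>(1) q_def \<rho> holder u_solution, of 0 origin] T by auto
  show ?thesis
  proof (rule uniform_limitI)
    fix e :: real assume e: "0 < e"
    \<comment> \<open>The \<open>+ 1\<close> keeps \<open>C\<close> positive for the divisions by
      it, also if \<open>K * ?m\<close> vanishes.\<close>
    define C where "C = K * ?m * T + 1"
    have C: "0 < C" using K m T by (simp add: C_def add_nonneg_pos)
    \<comment> \<open>Order of choices: \<open>e\<close> fixes \<open>\<eta>\<close>,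
      \<open>\<eta>\<close> fixes the radius \<open>r\<close>, and only then does
      \<open>\<epsilon>\<close> become small. The tolerance and the Hoelder remainder each take half
      of \<open>e\<close>.\<close>
    define \<eta> where "\<eta> = min 1 (e / (2 * C))"
    have \<eta>: "0 < \<eta>" "\<eta> \<le> 1" "\<eta> * C \<le> e / 2"
      using e C by (auto simp: \<eta>_def min_def field_simps)
    obtain r where r: "0 < r" "r \<le> R" "\<And>z::'e. z \<noteq> 0 \<Longrightarrow> norm z < r \<Longrightarrow> \<bar>polar_density \<psi> R z - 1\<bar> < \<eta>"
      using polar_density_near_0[OF warping R_pos \<eta>(1), where 'e='e] by blast
    have "((\<lambda>\<epsilon>::real. \<epsilon> powr \<alpha>) \<longlongrightarrow> 0) (at_right 0)"
      using \<alpha>(1) by (intro tendsto_zero_powrI[of _ _ _ \<alpha>]) (auto simp: eventually_at_right_field)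
    then have "eventually (\<lambda>\<epsilon>::real. \<epsilon> powr \<alpha> < e / (2 * C)) (at_right 0)"
      using e C by (intro order_tendstoD(2)) auto
    moreover have "eventually (\<lambda>\<epsilon>. 0 < \<epsilon> \<and> \<epsilon> < r \<and> \<epsilon> < \<rho>) (at_right (0::real))"
      unfolding eventually_at_right_field using r(1) \<rho>(1) by (intro exI[of _ "min r \<rho>"]) auto
    ultimately show "eventually (\<lambda>\<epsilon>. \<forall>p\<in>UNIV \<times> {0..T}. dist (case p of (x, t) \<Rightarrow> u\<epsilon> \<epsilon> x t) (case p of (x, t) \<Rightarrow> u x t) < e) (at_right 0)"
    proof eventually_elim
      case (elim \<epsilon>)
      then have \<epsilon>: "0 < \<epsilon>" "\<epsilon> < r" "\<epsilon> < \<rho>" and small: "\<epsilon> powr \<alpha> * C < e / 2"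
        using C by (auto simp: field_simps)
      have "\<bar>u\<epsilon> \<epsilon> x t - u x t\<bar> < e" if t: "t \<in> {0..T}" for x t
      proof -
        have "\<bar>u\<epsilon> \<epsilon> x t - u x t\<bar> \<le> K * (\<epsilon> powr \<alpha> + \<eta>) * ?m * t"
          by (rule estimate[OF \<eta>(1,2) r \<epsilon> u\<epsilon>_solution[OF \<epsilon>(1)] t])
        also have "\<dots> \<le> K * (\<epsilon> powr \<alpha> + \<eta>) * ?m * T"
          using t K m \<eta>(1) by (intro mult_left_mono) auto
        also have "\<dots> = (\<epsilon> powr \<alpha> + \<eta>) * (K * ?m * T)" by (simp add: mult_ac)
        also have "\<dots> \<le> (\<epsilon> powr \<alpha> + \<eta>) * C"
          using \<eta>(1) by (intro mult_left_mono) (auto simp: C_def)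
        also have "\<dots> < e" using small \<eta>(3) by (simp add: distrib_right)
        finally show ?thesis .
      qed
      then show ?case by (auto simp: dist_real_def)
    qed
  qed
qed

end
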